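(* Let $n\ge3$, $m\ge2$, $l\ge1$ be integers, and let either $d=\frac95$ and $(n,m)\in\{(4,4),(5,3)\}$, or $d=3$ and $n+m\ge9$. For every $C\ge1$ there are $\tau_0,\delta_0>0$ such that for every closed $K\subset\mathbb{R}^l$, all $0<\tau\le\tau_0$, $0<\delta\le\delta_0$ and every Simon data $(h,u,f)$ over $K$ with parameters $\tau,\delta$ and constant $C$, the following holds at all points $(x,\xi,y)\in\mathbb{R}^n\times\mathbb{R}^m\times\mathbb{R}^l$ with $x\ne0$, $\xi\neq0$. Let $$E(x,\xi,y)=\begin{cases}(u(x,y)^2-|\xi|^2)\,u(x,y)^d,& |\xi|\le u(x,y),\\ (u(x,y)^2-|\xi|^2)\,|\xi|^d,&|\xi|\ge u(x,y).\end{cases}$$ Then, in the metric $g=dx^2+f(x,y)\,d\xi^2+dy^2$, $$\operatorname{div}_g\frac{\nabla^gE}{\|\nabla^gE\|_g}\ \begin{cases}\ge0,&\text{if }u(x,y)-|\xi|\ge0,\\ \le0,&\text{if }u(x,y)-|\xi|\le0,\end{cases}$$ where at points with $|\xi|=u(x,y)$ the divergence in the first (second) line is that of the field built from the first (second) branch of $E$.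
   Context: Integers $n\ge3$, $m\ge2$, $l\ge1$, $n+m\ge8$; $\alpha_0=\sqrt{(m-1)/(n-1)}$. Coordinates $(x,\xi,y)\in\mathbb{R}^n\times\mathbb{R}^m\times\mathbb{R}^l$, $r=|x|$. For functions of $(x,y)$, the symbols $D,\nabla,\Delta,D^2$ and the dot product are the Euclidean ones on $\mathbb{R}^{n+l}$, and $D^2u(\nabla u,\nabla u)=\sum_{i,j}D_iu\,D_ju\,D_{ij}u$. Quantities with label $g$ ($\nabla^g$, $\|\cdot\|_g$, $\operatorname{div}_g$) are taken in the metric $g$. The function $\varphi:[0,\infty)\to[1,\infty)$ is the smooth solution of $\frac{\varphi''\varphi}{1+(\varphi')^2}+\frac{n-1}{r}\varphi\varphi'=m-1$ $(r>0)$ with $\varphi(0)=1$, $\varphi'(0)=0$; for $\lambda>0$, $\varphi_\lambda(r)=\lambda\varphi(r/\lambda)$. Simon data. Let $K\subset\mathbb{R}^l$ be closed, $U=\mathbb{R}^l\setminus K$, $\tau,\delta\in(0,1)$, $C\ge1$. Simon data over $K$ with parameters $\tau,\delta$ and constant $C$ is a triple $(h,u,f)$ as follows (this is the data furnished by L. Simon's construction of minimal hypersurfaces with singular set $\{0\}\times\{0\}\times K$). (1) $h:\mathbb{R}^l\to[0,\infty)$ is smooth, $h=0$ exactly on $K$, and $h$ and its derivatives up to order 3 are bounded by $C\tau$. (2) $u:\mathbb{R}^n\times\mathbb{R}^l\to[0,\infty)$ is continuous, depends on $x$ only through $|x|$, is smooth and positive off $\{0\}\times K$, and $u(x,y)=\alpha_0|x|$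 whenever $y\in K$, or $y\in U$ and $|x|\ge\frac34h(y)^2$. $f:\mathbb{R}^n\times\mathbb{R}^l\to(0,\infty)$ is smooth and $f(x,y)=1$ whenever $y\in K$, or $y\in U$ and $|x|\le\frac12h(y)^2$. (3) Off $\{0\}\times K$ (minimality of $\{|\xi|=u\}$ in the metric $g$): $$\tfrac12\left(m+(1+f|Du|^2)^{-1}\right)Df\cdot Du=-f\Delta u+\frac{f^2}{1+f|Du|^2}D^2u(\nabla u,\nabla u)+\frac{m-1}{u}.$$ (4) For $y\in U$ and $|x|>\frac12h(y)^2$: $|f-1|,\ |Df|,\ |Du-\alpha_0Dr|,\ |D^2u-\alpha_0D^2r|\le C\tau$; and $|u-\alpha_0r|\le Ch(y)^4$ when $\frac12h(y)^2<|x|<\frac34h(y)^2$. (5) For $y\in U$ and $|x|\le\frac12h(y)^2$, with $\lambda_y=u(0,y)$: $(\lambda_y+|x|)^{-1}|u(x,y)-\varphi_{\lambda_y}(|x|)|<\delta$, $\ |D_{x,z}(u(x,z)-\varphi_{\lambda_y}(|x|))|_{z=y}<\delta$, $\ (\lambda_y+|x|)\,|D^2_{x,z}(u(x,z)-\varphi_{\lambda_y}(|x|))|_{z=y}<\delta$ (here $\lambda_y$ is held fixed while differentiating in $(x,z)$). *)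

theory Defs
  imports "HOL-Analysis.Analysis"
begin

text \<open>
  These operators are meaningful where the functions involved are sufficiently often
  differentiable; elsewhere \<open>frechet_derivative\<close> is an unspecified value.
\<close>

text \<open>\<open>iter_partial [v\<^sub>1, \<dots>, v\<^sub>k] F\<close> is \<open>D\<^sub>v\<^sub>1 (\<dots> (D\<^sub>v\<^sub>k F))\<close>.\<close>

primrec iter_partial :: "'a::euclidean_space list \<Rightarrow> ('a \<Rightarrow> real) \<Rightarrow> 'a \<Rightarrow> real" where
  "iter_partial [] F = F"
| "iter_partial (v # vs) F = (\<lambda>p. frechet_derivative (iter_partial vs F) (at p) v)"

text \<open>
  \<open>C\<^sup>\<infinity>\<close> on an open set \<open>S\<close>: all iterated partial derivatives are Frechet differentiable on \<open>S\<close>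
  (hence continuous there).
\<close>

definition smooth_on :: "'a::euclidean_space set \<Rightarrow> ('a \<Rightarrow> real) \<Rightarrow> bool" where
  "smooth_on S F \<longleftrightarrow>
     (\<forall>vs. set vs \<subseteq> Basis \<longrightarrow> (\<forall>p\<in>S. iter_partial vs F differentiable (at p)))"

definition grad :: "('a::euclidean_space \<Rightarrow> real) \<Rightarrow> 'a \<Rightarrow> 'a" where
  "grad F p = (\<Sum>i\<in>Basis. iter_partial [i] F p *\<^sub>R i)"

definition laplacian :: "('a::euclidean_space \<Rightarrow> real) \<Rightarrow> 'a \<Rightarrow> real" where
  "laplacian F p = (\<Sum>i\<in>Basis. iter_partial [i, i] F p)"

text \<open>\<open>D\<^sup>2F(\<nabla>F, \<nabla>F)\<close>\<close>

definition hess_grad_grad :: "('a::euclidean_space \<Rightarrow> real) \<Rightarrow> 'a \<Rightarrow> real" where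
  "hess_grad_grad F p =
     (\<Sum>i\<in>Basis. \<Sum>j\<in>Basis.
        iter_partial [i] F p * iter_partial [j] F p * iter_partial [i, j] F p)"

text \<open>\<open>|D\<^sup>kF|\<close>, the Euclidean (Frobenius) norm of the tensor of all partial derivatives of order \<open>k\<close>\<close>

definition deriv_norm :: "nat \<Rightarrow> ('a::euclidean_space \<Rightarrow> real) \<Rightarrow> 'a \<Rightarrow> real" where
  "deriv_norm k F p =
     sqrt (\<Sum>vs \<in> {vs. length vs = k \<and> set vs \<subseteq> Basis}. (iter_partial vs F p)\<^sup>2)"

text \<open>A metric is a function \<open>G\<close> such that \<open>G p\<close> is the inner product on tangent vectors at \<open>p\<close>.\<close>

definition metric_grad ::
  "('a::euclidean_space \<Rightarrow> 'a \<Rightarrow> 'a \<Rightarrow> real) \<Rightarrow> ('a \<Rightarrow> real) \<Rightarrow> 'a \<Rightarrow> 'a" where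
  "metric_grad G F p = (THE v. \<forall>w. G p v w = frechet_derivative F (at p) w)"

definition metric_norm ::
  "('a::euclidean_space \<Rightarrow> 'a \<Rightarrow> 'a \<Rightarrow> real) \<Rightarrow> 'a \<Rightarrow> 'a \<Rightarrow> real" where
  "metric_norm G p v = sqrt (G p v v)"

text \<open>
  The Riemannian volume density: the square root of the determinant of the Gram matrix
  of the coordinate basis, with the determinant given by the Leibniz formula (the library's
  \<open>det\<close> needs matrices indexed by a type rather than by the set \<open>Basis\<close>).
\<close>

definition metric_vol :: "('a::euclidean_space \<Rightarrow> 'a \<Rightarrow> 'a \<Rightarrow> real) \<Rightarrow> 'a \<Rightarrow> real" where
  "metric_vol G p =
     sqrt (\<Sum>\<pi> | \<pi> permutes Basis. of_int (sign \<pi>) * (\<Prod>b\<in>Basis. G p b (\<pi> b)))"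

definition metric_div ::
  "('a::euclidean_space \<Rightarrow> 'a \<Rightarrow> 'a \<Rightarrow> real) \<Rightarrow> ('a \<Rightarrow> 'a) \<Rightarrow> 'a \<Rightarrow> real" where
  "metric_div G X p =
     (\<Sum>b\<in>Basis. frechet_derivative (\<lambda>q. metric_vol G q * (X q \<bullet> b)) (at p) b) / metric_vol G p"

definition metric_unit_grad ::
  "('a::euclidean_space \<Rightarrow> 'a \<Rightarrow> 'a \<Rightarrow> real) \<Rightarrow> ('a \<Rightarrow> real) \<Rightarrow> 'a \<Rightarrow> 'a" where
  "metric_unit_grad G F p = metric_grad G F p /\<^sub>R metric_norm G p (metric_grad G F p)"

text \<open>The metric \<open>dx\<^sup>2 + f(x,y) d\<xi>\<^sup>2 + dy\<^sup>2\<close> at the point \<open>(x, \<xi>, y)\<close>\<close>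

definition warped_metric ::
  "((real^'n) \<times> (real^'l) \<Rightarrow> real) \<Rightarrow> (real^'n) \<times> (real^'m) \<times> (real^'l)
     \<Rightarrow> (real^'n) \<times> (real^'m) \<times> (real^'l) \<Rightarrow> (real^'n) \<times> (real^'m) \<times> (real^'l) \<Rightarrow> real" where
  "warped_metric f =
     (\<lambda>(x, \<xi>, y) (v1, v2, v3) (w1, w2, w3). v1 \<bullet> w1 + f (x, y) * (v2 \<bullet> w2) + v3 \<bullet> w3)"

text \<open>
  \<open>D k\<close> is the \<open>k\<close>-th derivative of \<open>\<phi>\<close> on \<open>[0, \<infinity>)\<close>, one-sided at \<open>0\<close>.
  Values of \<open>\<phi>\<close> at negative arguments are irrelevant.
\<close>

definition profile :: "nat \<Rightarrow> nat \<Rightarrow> (real \<Rightarrow> real) \<Rightarrow> bool" where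
  "profile n m \<phi> \<longleftrightarrow>
     (\<forall>r\<ge>0. 1 \<le> \<phi> r) \<and>
     (\<exists>D :: nat \<Rightarrow> real \<Rightarrow> real.
        D 0 = \<phi> \<and>
        (\<forall>k. \<forall>r\<ge>0. (D k has_real_derivative D (Suc k) r) (at r within {0..})) \<and>
        \<phi> 0 = 1 \<and> D 1 0 = 0 \<and>
        (\<forall>r>0. D 2 r * \<phi> r / (1 + (D 1 r)\<^sup>2) + (real n - 1) / r * \<phi> r * D 1 r = real m - 1))"

definition scaled_profile :: "(real \<Rightarrow> real) \<Rightarrow> real \<Rightarrow> real \<Rightarrow> real" where
  "scaled_profile \<phi> s r = s * \<phi> (r / s)"

definition cone_slope :: "nat \<Rightarrow> nat \<Rightarrow> real" where
  "cone_slope n m = sqrt ((real m - 1) / (real n - 1))"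

text \<open>
  The dimensions \<open>n\<close> and \<open>l\<close> are \<open>CARD('n)\<close> and \<open>CARD('l)\<close>; \<open>m\<close> is an explicit parameter
  because no vector of \<open>\<real>\<^sup>m\<close> occurs. The partial differential equation is minimality of
  \<open>{|\<xi>| = u}\<close> in the metric \<open>dx\<^sup>2 + f d\<xi>\<^sup>2 + dy\<^sup>2\<close>. The bounds on derivatives of
  \<open>u - \<alpha>|x|\<close> are those on \<open>Du - \<alpha>D|x|\<close> and \<open>D\<^sup>2u - \<alpha>D\<^sup>2|x|\<close>, as \<open>x \<noteq> 0\<close> there. In the last
  clause the scale \<open>s = u (0, y)\<close> is held fixed while differentiating, and is positive since
  \<open>y \<notin> K\<close>.
\<close>

definition simon_data ::
  "nat \<Rightarrow> (real \<Rightarrow> real) \<Rightarrow> (real^'l) set \<Rightarrow> real \<Rightarrow> real \<Rightarrow> real \<Rightarrow> (real^'l \<Rightarrow> real)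
     \<Rightarrow> ((real^'n) \<times> (real^'l) \<Rightarrow> real) \<Rightarrow> ((real^'n) \<times> (real^'l) \<Rightarrow> real) \<Rightarrow> bool" where
  "simon_data m \<phi> K \<tau> \<delta> C h u f \<longleftrightarrow>
     (let \<alpha> = cone_slope CARD('n) m in
       closed K \<and> 0 < \<tau> \<and> \<tau> < 1 \<and> 0 < \<delta> \<and> \<delta> < 1 \<and> 1 \<le> C \<and>
       (smooth_on UNIV h \<and> (\<forall>y. 0 \<le> h y) \<and> (\<forall>y. h y = 0 \<longleftrightarrow> y \<in> K) \<and>
        (\<forall>k\<le>3. \<forall>y. deriv_norm k h y \<le> C * \<tau>)) \<and>
       (continuous_on UNIV u \<and> (\<forall>p. 0 \<le> u p) \<and>
        (\<forall>x x' y. norm x = norm x' \<longrightarrow> u (x, y) = u (x', y)) \<and>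
        smooth_on (- ({0} \<times> K)) u \<and> (\<forall>p. p \<notin> {0} \<times> K \<longrightarrow> 0 < u p) \<and>
        (\<forall>x y. y \<in> K \<or> y \<notin> K \<and> 3/4 * (h y)\<^sup>2 \<le> norm x \<longrightarrow> u (x, y) = \<alpha> * norm x)) \<and>
       (smooth_on UNIV f \<and> (\<forall>p. 0 < f p) \<and>
        (\<forall>x y. y \<in> K \<or> y \<notin> K \<and> norm x \<le> 1/2 * (h y)\<^sup>2 \<longrightarrow> f (x, y) = 1)) \<and>
       (\<forall>p. p \<notin> {0} \<times> K \<longrightarrow>
          1/2 * (real m + inverse (1 + f p * (norm (grad u p))\<^sup>2)) * (grad f p \<bullet> grad u p)
          = - f p * laplacian u p
            + (f p)\<^sup>2 / (1 + f p * (norm (grad u p))\<^sup>2) * hess_grad_grad u p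
            + (real m - 1) / u p) \<and>
       (\<forall>x y. y \<notin> K \<and> 1/2 * (h y)\<^sup>2 < norm x \<longrightarrow>
          \<bar>f (x, y) - 1\<bar> \<le> C * \<tau> \<and>
          deriv_norm 1 f (x, y) \<le> C * \<tau> \<and>
          deriv_norm 1 (\<lambda>q. u q - \<alpha> * norm (fst q)) (x, y) \<le> C * \<tau> \<and>
          deriv_norm 2 (\<lambda>q. u q - \<alpha> * norm (fst q)) (x, y) \<le> C * \<tau> \<and>
          (norm x < 3/4 * (h y)\<^sup>2 \<longrightarrow> \<bar>u (x, y) - \<alpha> * norm x\<bar> \<le> C * h y ^ 4)) \<and>
       (\<forall>x y. y \<notin> K \<and> norm x \<le> 1/2 * (h y)\<^sup>2 \<longrightarrow>
          (let s = u (0, y); w = (\<lambda>q. u q - scaled_profile \<phi> s (norm (fst q))) in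
            inverse (s + norm x) * \<bar>w (x, y)\<bar> < \<delta> \<and>
            deriv_norm 1 w (x, y) < \<delta> \<and>
            (s + norm x) * deriv_norm 2 w (x, y) < \<delta>)))"

definition E_inner ::
  "real \<Rightarrow> ((real^'n) \<times> (real^'l) \<Rightarrow> real) \<Rightarrow> (real^'n) \<times> (real^'m) \<times> (real^'l) \<Rightarrow> real" where
  "E_inner d u = (\<lambda>(x, \<xi>, y). ((u (x, y))\<^sup>2 - (norm \<xi>)\<^sup>2) * u (x, y) powr d)"

definition E_outer ::
  "real \<Rightarrow> ((real^'n) \<times> (real^'l) \<Rightarrow> real) \<Rightarrow> (real^'n) \<times> (real^'m) \<times> (real^'l) \<Rightarrow> real" where
  "E_outer d u = (\<lambda>(x, \<xi>, y). ((u (x, y))\<^sup>2 - (norm \<xi>)\<^sup>2) * norm \<xi> powr d)"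

text \<open>The branches agree (both vanish) where \<open>|\<xi>| = u\<close>.\<close>

definition E_fun ::
  "real \<Rightarrow> ((real^'n) \<times> (real^'l) \<Rightarrow> real) \<Rightarrow> (real^'n) \<times> (real^'m) \<times> (real^'l) \<Rightarrow> real" where
  "E_fun d u = (\<lambda>(x, \<xi>, y).
     if norm \<xi> \<le> u (x, y) then E_inner d u (x, \<xi>, y) else E_outer d u (x, \<xi>, y))"

end

theory Submission
  imports Defs
begin

text \<open>
  Since \<open>E\<close> depends on \<open>u\<close> and \<open>t = |\<xi>|\<close> only, its unit normal field is determined by \<open>Du\<close> and the ratio
  \<open>\<rho> = - E\<^sub>t / E\<^sub>u\<close>, and the divergence involves \<open>u\<close> and \<open>f\<close> only through \<open>|Du|\<^sup>2\<close>, \<open>\<Delta>u\<close>, \<open>D\<^sup>2u(\<nabla>u, \<nabla>u)\<close>, \<open>f\<close> and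
  \<open>Df \<cdot> Du\<close>. Minimality of \<open>{|\<xi>| = u}\<close> eliminates \<open>Df \<cdot> Du\<close> and makes the divergence vanish to first
  order at \<open>t = u\<close>. After division by this zero its sign follows from a strict polynomial inequality
  in \<open>t/u\<close>, \<open>P = |Du|\<^sup>2/\<alpha>\<^sup>2\<close> and an upper bound for \<open>k = uu''/(1 + u'\<^sup>2)\<close>, so that \<open>u\<close> may be replaced by
  its radial model, either the cone (\<open>P = 1\<close>, \<open>k = 0\<close>) or a rescaled profile \<open>\<phi>\<close>. For the profile the
  bound \<open>k \<le> (m - 1) g(P)\<close> with a suitable rational function \<open>g\<close> comes from a barrier argument in the
  phase plane of the ordinary differential equation.
\<close>

section \<open>Polynomial inequalities\<close>

text \<open>The decisive constraints sit at the cone. Put N = a + b. A curve crossed only upwards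
  needs its end slope \<kappa> = \<open>c / (A + s)\<close> strictly between the two roots, which
  for N \<ge> 3 are real and distinct only if N > 3 + 2 sqrt 2, that is n + m \<ge> 8. On the side
  of E, the divided divergence at t = u over the cone is positive exactly when d N > (d + 1) (d +
  2), which says that -(d + 2) lies strictly between the two characteristic exponents of the same
  linearization. For N = 6 this demands 1 < d < 2, while d = 3 demands N \<ge> 7; hence the two
  alternatives for d. The other obstacle is the axis x = 0: P tends to 0 there, and for small t/u
  the inner numerator tends to 0 with it, so no absolute margin survives. The margin in the
  polynomial inequalities is therefore proportional to P, and the curvature term is bounded by
  |Du|^2 (k + \<eta>), never with an additive error.\<close>

text \<open>
  With \<open>g P = c (1 - P) / (A + s P)\<close>, positivity of the first polynomial says that the curve
  \<open>Y = 1 - g P\<close> can only be crossed upwards by the phase curve of the profile. The other two are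
  the numerators of the divergence of the two branches, divided by their zero at \<open>|\<xi>| = u\<close>, for
  the extreme value \<open>b g P\<close> of the curvature term; the argument \<open>q\<close> is \<open>(|\<xi>|/u)\<^sup>2\<close> or its inverse, and
  the term \<open>1/10\<close> provides a margin.
\<close>

definition barrier_poly :: "real \<Rightarrow> real \<Rightarrow> real \<Rightarrow> real \<Rightarrow> real \<Rightarrow> real \<Rightarrow> real" where
  "barrier_poly a b c A s P = (A + s * P) * (c + c * (a + b * P) - (A + s * P)) * (A + s * P - c * (1 - P))
     - 2 * P * c\<^sup>2 * (A + s) * (a + b * P)"

definition inner_poly :: "real \<Rightarrow> real \<Rightarrow> real \<Rightarrow> real \<Rightarrow> real \<Rightarrow> real \<Rightarrow> real \<Rightarrow> real \<Rightarrow> real" where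
  "inner_poly a b d c A s P q = P * ((b * d * (d + 2 - d * q)\<^sup>2 - 2 * (d + 2) * (d + 2 + d * q) - 1/10) * (A + s * P)
     - b * c * (1 - P) * (((d + 2)\<^sup>2 - d\<^sup>2 * q) * (d + 2 - d * q))) + 4 * d * a * q * (A + s * P)"

definition outer_poly :: "real \<Rightarrow> real \<Rightarrow> real \<Rightarrow> real \<Rightarrow> real \<Rightarrow> real \<Rightarrow> real \<Rightarrow> real \<Rightarrow> real" where
  "outer_poly a b d c A s P q = P * ((4 * d * b * q - 2 * (d + 2) * (d + 2 + d * q) - 1/10) * (A + s * P)
     - b * c * (1 - P) * (2 * ((d + 2)\<^sup>2 - d\<^sup>2 * q))) + a * d * (d + 2 - d * q)\<^sup>2 * (A + s * P)"

text \<open>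
  Write \<open>a = n - 1\<close>, \<open>b = m - 1\<close>. In the lemmas below \<open>x\<close> and \<open>y\<close> measure by how much \<open>a\<close> and \<open>b\<close> exceed
  their minimal values. The sums on the left-hand sides are Bernstein-type positivity
  certificates on the unit square for each coefficient with respect to \<open>x\<close> and \<open>y\<close>, found by
  computer search; so is the constant subtracted from the barrier polynomial.
\<close>

lemma barrier_poly_generic_2_5:
  fixes x y P :: real
  assumes "0 \<le> x" "0 \<le> y" "0 \<le> P" "P \<le> 1"
  shows "0 < barrier_poly (2 + x) (5 + y) (9/4) (2 + x + 3) (5 + y) P"
proof -
  \<comment> \<open>The cubic Bernstein coefficients in P of the part free of x and y are not all
    nonnegative. The square, centred near the interior minimum, takes up this dip.\<close>
  have "0 \<le> (300 * P * (P - 9/20)^2 + 1917/80 * (1 - P)^4 + 483/80 * P * (1 - P)^3 + 561/40 * P^2 * (1 - P)^2 + 647/20 * P^3 * (1 - P) + 2/5 * P^4) + y * (21/2 * P * (1 - P)^2 + 3/2 * P^2 * (1 - P) + 903/8 * P^3) + y^2 * (21/16 * P^2 * (1 - P) + 183/8 * P^3) + y^3 * (5/4 * P^3) + x * (123/4 * (1 - P)^2 + 579/8 * P * (1 - P) + 903/8 * P^2) + x * y * (51/4 * P * (1 - P) + 183/4 * P^2) + x * y^2 * (15/4 * P^2) + x^2 * (183/16 * (1 - P) + 183/8 * P) + x^2 * y * (15/4 * P) + x^3 * (5/4)"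
    using assms by (intro add_nonneg_nonneg mult_nonneg_nonneg, simp_all)
  also have "\<dots> = barrier_poly (2 + x) (5 + y) (9/4) (2 + x + 3) (5 + y) P - 1/10"
    unfolding barrier_poly_def by (simp add: field_simps power2_eq_square power3_eq_cube power4_eq_xxxx)
  finally show ?thesis by simp
qed

lemma inner_poly_generic_2_5:
  fixes x y P q :: real
  assumes "0 \<le> x" "0 \<le> y" "0 \<le> P" "P \<le> 1" "0 \<le> q" "q \<le> 1"
  shows "0 \<le> inner_poly (2 + x) (5 + y) 3 (9/4) (2 + x + 3) (5 + y) P q"
proof -
  define C0 where "C0 = (873/4 * P * (1 - P) + 3249 * P^2) + y * (375/4 * P * (1 - P) + 10749/10 * P^2) + y^2 * (75 * P^2) + x * (3249/10 * P) + x * y * (75 * P)"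
  define C1 where "C1 = (800 * (P - 1/20)^2 + 58 * (1 - P)^3 + 29/4 * P * (1 - P)^2 + 785/4 * P^2 * (1 - P) + 247 * P^3) + y * (63/4 * P * (1 - P) + 3969/10 * P^2) + y^2 * (30 * P^2) + x * (42 * (1 - P) + 1569/10 * P) + x * y * (36 * P) + x^2 * (6)"
  define C2 where "C2 = (200 * (P - 23/40)^2 + 431/8 * (1 - P)^3 + 409/8 * P * (1 - P)^2 + 1/8 * P^2 * (1 - P) + 23/8 * P^3) + y * (12 * P * (1 - P) + 1239/10 * P^2) + y^2 * (12 * P^2) + x * (84 * (1 - P) + 1239/10 * P) + x * y * (24 * P) + x^2 * (12)"
  have "0 \<le> C0" "0 \<le> C1" "0 \<le> C2"
    unfolding C0_def C1_def C2_def using assms by (intro add_nonneg_nonneg mult_nonneg_nonneg, simp_all)+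
  then have "0 \<le> C0 * (1 - q)^2 + 2 * C1 * q^1 * (1 - q)^1 + C2 * q^2"
    using assms by (intro add_nonneg_nonneg mult_nonneg_nonneg, simp_all)
  also have "\<dots> = inner_poly (2 + x) (5 + y) 3 (9/4) (2 + x + 3) (5 + y) P q"
    unfolding inner_poly_def C0_def C1_def C2_def by (simp add: field_simps power2_eq_square power3_eq_cube power4_eq_xxxx)
  finally show ?thesis .
qed

lemma outer_poly_generic_2_5:
  fixes x y P q :: real
  assumes "0 \<le> x" "0 \<le> y" "0 \<le> P" "P \<le> 1" "0 \<le> q" "q \<le> 1"
  shows "0 \<le> outer_poly (2 + x) (5 + y) 3 (9/4) (2 + x + 3) (5 + y) P q"
proof -
  \<comment> \<open>The polynomial is quadratic in q, but in its middle Bernstein coefficient of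
    degree 2 the coefficient of y is negative for small P. Raising the degree in q to 3 repairs
    this.\<close>
  define C0 where "C0 = (750 * (1 - P)^2 + 1437 * P * (1 - P) + 999 * P^2) + y * (75/2 * P * (1 - P) + 999/10 * P^2) + x * (525 * (1 - P) + 8499/10 * P) + x * y * (75 * P) + x^2 * (75)"
  define C1 where "C1 = (450 * (1 - P)^2 + 1309/2 * P * (1 - P) + 499 * P^2) + y * (11 * P * (1 - P) + 899/10 * P^2) + y^2 * (4 * P^2) + x * (315 * (1 - P) + 4999/10 * P) + x * y * (49 * P) + x^2 * (45)"
  define C2 where "C2 = (240 * (1 - P)^2 + 142 * P * (1 - P) + 179 * P^2) + y * (5/2 * P * (1 - P) + 979/10 * P^2) + y^2 * (8 * P^2) + x * (168 * (1 - P) + 2579/10 * P) + x * y * (32 * P) + x^2 * (24)"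
  define C3 where "C3 = (200 * (P - 23/40)^2 + 431/8 * (1 - P)^3 + 409/8 * P * (1 - P)^2 + 1/8 * P^2 * (1 - P) + 23/8 * P^3) + y * (12 * P * (1 - P) + 1239/10 * P^2) + y^2 * (12 * P^2) + x * (84 * (1 - P) + 1239/10 * P) + x * y * (24 * P) + x^2 * (12)"
  have "0 \<le> C0" "0 \<le> C1" "0 \<le> C2" "0 \<le> C3"
    unfolding C0_def C1_def C2_def C3_def using assms by (intro add_nonneg_nonneg mult_nonneg_nonneg, simp_all)+
  then have "0 \<le> C0 * (1 - q)^3 + 3 * C1 * q^1 * (1 - q)^2 + 3 * C2 * q^2 * (1 - q)^1 + C3 * q^3"
    using assms by (intro add_nonneg_nonneg mult_nonneg_nonneg, simp_all)
  also have "\<dots> = outer_poly (2 + x) (5 + y) 3 (9/4) (2 + x + 3) (5 + y) P q"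
    unfolding outer_poly_def C0_def C1_def C2_def C3_def by (simp add: field_simps power2_eq_square power3_eq_cube power4_eq_xxxx)
  finally show ?thesis .
qed

lemma barrier_poly_generic_3_4:
  fixes x y P :: real
  assumes "0 \<le> x" "0 \<le> y" "0 \<le> P" "P \<le> 1"
  shows "0 < barrier_poly (3 + x) (4 + y) (9/4) (3 + x + 3) (4 + y) P"
proof -
  have "0 \<le> (133/2 * (1 - P)^3 + 663/4 * P * (1 - P)^2 + 129/2 * P^2 * (1 - P) + 361/4 * P^3) + y * (27 * P * (1 - P)^2 + 459/8 * P^2 * (1 - P) + 903/8 * P^3) + y^2 * (81/16 * P^2 * (1 - P) + 183/8 * P^3) + y^3 * (5/4 * P^3) + x * (459/8 * (1 - P)^2 + 513/4 * P * (1 - P) + 903/8 * P^2) + x * y * (81/4 * P * (1 - P) + 183/4 * P^2) + x * y^2 * (15/4 * P^2) + x^2 * (243/16 * (1 - P) + 183/8 * P) + x^2 * y * (15/4 * P) + x^3 * (5/4)"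
    using assms by (intro add_nonneg_nonneg mult_nonneg_nonneg, simp_all)
  also have "\<dots> = barrier_poly (3 + x) (4 + y) (9/4) (3 + x + 3) (4 + y) P - 1"
    unfolding barrier_poly_def by (simp add: field_simps power2_eq_square power3_eq_cube power4_eq_xxxx)
  finally show ?thesis by simp
qed

lemma inner_poly_generic_3_4:
  fixes x y P q :: real
  assumes "0 \<le> x" "0 \<le> y" "0 \<le> P" "P \<le> 1" "0 \<le> q" "q \<le> 1"
  shows "0 \<le> inner_poly (3 + x) (4 + y) 3 (9/4) (3 + x + 3) (4 + y) P q"
proof -
  define C0 where "C0 = (1872/5 * P * (1 - P) + 2499 * P^2) + y * (675/4 * P * (1 - P) + 9999/10 * P^2) + y^2 * (75 * P^2) + x * (2499/10 * P) + x * y * (75 * P)"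
  define C1 where "C1 = (108 * (1 - P)^2 + 162/5 * P * (1 - P) + 729 * P^2) + y * (207/4 * P * (1 - P) + 3729/10 * P^2) + y^2 * (30 * P^2) + x * (54 * (1 - P) + 1329/10 * P) + x * y * (36 * P) + x^2 * (6)"
  define C2 where "C2 = (216 * (1 - P)^2 + 477/5 * P * (1 - P) + 39 * P^2) + y * (36 * P * (1 - P) + 1239/10 * P^2) + y^2 * (12 * P^2) + x * (108 * (1 - P) + 1239/10 * P) + x * y * (24 * P) + x^2 * (12)"
  have "0 \<le> C0" "0 \<le> C1" "0 \<le> C2"
    unfolding C0_def C1_def C2_def using assms by (intro add_nonneg_nonneg mult_nonneg_nonneg, simp_all)+
  then have "0 \<le> C0 * (1 - q)^2 + 2 * C1 * q^1 * (1 - q)^1 + C2 * q^2"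
    using assms by (intro add_nonneg_nonneg mult_nonneg_nonneg, simp_all)
  also have "\<dots> = inner_poly (3 + x) (4 + y) 3 (9/4) (3 + x + 3) (4 + y) P q"
    unfolding inner_poly_def C0_def C1_def C2_def by (simp add: field_simps power2_eq_square power3_eq_cube power4_eq_xxxx)
  finally show ?thesis .
qed

lemma outer_poly_generic_3_4:
  fixes x y P q :: real
  assumes "0 \<le> x" "0 \<le> y" "0 \<le> P" "P \<le> 1" "0 \<le> q" "q \<le> 1"
  shows "0 \<le> outer_poly (3 + x) (4 + y) 3 (9/4) (3 + x + 3) (4 + y) P q"
proof -
  define C0 where "C0 = (1350 * (1 - P)^2 + 14247/5 * P * (1 - P) + 1749 * P^2) + y * (225/2 * P * (1 - P) + 1749/10 * P^2) + x * (675 * (1 - P) + 9249/10 * P) + x * y * (75 * P) + x^2 * (75)"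
  define C1 where "C1 = (540 * (1 - P)^2 + 4122/5 * P * (1 - P) + 489 * P^2) + y * (135/4 * P * (1 - P) + 1089/10 * P^2) + y^2 * (6 * P^2) + x * (270 * (1 - P) + 3489/10 * P) + x * y * (36 * P) + x^2 * (30)"
  define C2 where "C2 = (216 * (1 - P)^2 + 477/5 * P * (1 - P) + 39 * P^2) + y * (36 * P * (1 - P) + 1239/10 * P^2) + y^2 * (12 * P^2) + x * (108 * (1 - P) + 1239/10 * P) + x * y * (24 * P) + x^2 * (12)"
  have "0 \<le> C0" "0 \<le> C1" "0 \<le> C2"
    unfolding C0_def C1_def C2_def using assms by (intro add_nonneg_nonneg mult_nonneg_nonneg, simp_all)+
  then have "0 \<le> C0 * (1 - q)^2 + 2 * C1 * q^1 * (1 - q)^1 + C2 * q^2"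
    using assms by (intro add_nonneg_nonneg mult_nonneg_nonneg, simp_all)
  also have "\<dots> = outer_poly (3 + x) (4 + y) 3 (9/4) (3 + x + 3) (4 + y) P q"
    unfolding outer_poly_def C0_def C1_def C2_def by (simp add: field_simps power2_eq_square power3_eq_cube power4_eq_xxxx)
  finally show ?thesis .
qed

lemma barrier_poly_generic_4_3:
  fixes x y P :: real
  assumes "0 \<le> x" "0 \<le> y" "0 \<le> P" "P \<le> 1"
  shows "0 < barrier_poly (4 + x) (3 + y) (9/4) (4 + x + 3) (3 + y) P"
proof -
  have "0 \<le> (2245/16 * (1 - P)^3 + 2859/8 * P * (1 - P)^2 + 993/4 * P^2 * (1 - P) + 361/4 * P^3) + y * (51 * P * (1 - P)^2 + 453/4 * P^2 * (1 - P) + 903/8 * P^3) + y^2 * (141/16 * P^2 * (1 - P) + 183/8 * P^3) + y^3 * (5/4 * P^3) + x * (183/2 * (1 - P)^2 + 1473/8 * P * (1 - P) + 903/8 * P^2) + x * y * (111/4 * P * (1 - P) + 183/4 * P^2) + x * y^2 * (15/4 * P^2) + x^2 * (303/16 * (1 - P) + 183/8 * P) + x^2 * y * (15/4 * P) + x^3 * (5/4)"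
    using assms by (intro add_nonneg_nonneg mult_nonneg_nonneg, simp_all)
  also have "\<dots> = barrier_poly (4 + x) (3 + y) (9/4) (4 + x + 3) (3 + y) P - 1"
    unfolding barrier_poly_def by (simp add: field_simps power2_eq_square power3_eq_cube power4_eq_xxxx)
  finally show ?thesis by simp
qed

lemma inner_poly_generic_4_3:
  fixes x y P q :: real
  assumes "0 \<le> x" "0 \<le> y" "0 \<le> P" "P \<le> 1" "0 \<le> q" "q \<le> 1"
  shows "0 \<le> inner_poly (4 + x) (3 + y) 3 (9/4) (4 + x + 3) (3 + y) P q"
proof -
  define C0 where "C0 = (7611/20 * P * (1 - P) + 1749 * P^2) + y * (975/4 * P * (1 - P) + 9249/10 * P^2) + y^2 * (75 * P^2) + x * (1749/10 * P) + x * y * (75 * P)"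
  define C1 where "C1 = (168 * (1 - P)^2 + 2871/20 * P * (1 - P) + 489 * P^2) + y * (351/4 * P * (1 - P) + 3489/10 * P^2) + y^2 * (30 * P^2) + x * (66 * (1 - P) + 1089/10 * P) + x * y * (36 * P) + x^2 * (6)"
  define C2 where "C2 = (336 * (1 - P)^2 + 2913/10 * P * (1 - P) + 39 * P^2) + y * (60 * P * (1 - P) + 1239/10 * P^2) + y^2 * (12 * P^2) + x * (132 * (1 - P) + 1239/10 * P) + x * y * (24 * P) + x^2 * (12)"
  have "0 \<le> C0" "0 \<le> C1" "0 \<le> C2"
    unfolding C0_def C1_def C2_def using assms by (intro add_nonneg_nonneg mult_nonneg_nonneg, simp_all)+
  then have "0 \<le> C0 * (1 - q)^2 + 2 * C1 * q^1 * (1 - q)^1 + C2 * q^2"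
    using assms by (intro add_nonneg_nonneg mult_nonneg_nonneg, simp_all)
  also have "\<dots> = inner_poly (4 + x) (3 + y) 3 (9/4) (4 + x + 3) (3 + y) P q"
    unfolding inner_poly_def C0_def C1_def C2_def by (simp add: field_simps power2_eq_square power3_eq_cube power4_eq_xxxx)
  finally show ?thesis .
qed

lemma outer_poly_generic_4_3:
  fixes x y P q :: real
  assumes "0 \<le> x" "0 \<le> y" "0 \<le> P" "P \<le> 1" "0 \<le> q" "q \<le> 1"
  shows "0 \<le> outer_poly (4 + x) (3 + y) 3 (9/4) (4 + x + 3) (3 + y) P q"
proof -
  define C0 where "C0 = (2100 * (1 - P)^2 + 22059/5 * P * (1 - P) + 2499 * P^2) + y * (375/2 * P * (1 - P) + 2499/10 * P^2) + x * (825 * (1 - P) + 9999/10 * P) + x * y * (75 * P) + x^2 * (75)"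
  define C1 where "C1 = (840 * (1 - P)^2 + 28671/20 * P * (1 - P) + 729 * P^2) + y * (279/4 * P * (1 - P) + 1329/10 * P^2) + y^2 * (6 * P^2) + x * (330 * (1 - P) + 3729/10 * P) + x * y * (36 * P) + x^2 * (30)"
  define C2 where "C2 = (336 * (1 - P)^2 + 2913/10 * P * (1 - P) + 39 * P^2) + y * (60 * P * (1 - P) + 1239/10 * P^2) + y^2 * (12 * P^2) + x * (132 * (1 - P) + 1239/10 * P) + x * y * (24 * P) + x^2 * (12)"
  have "0 \<le> C0" "0 \<le> C1" "0 \<le> C2"
    unfolding C0_def C1_def C2_def using assms by (intro add_nonneg_nonneg mult_nonneg_nonneg, simp_all)+
  then have "0 \<le> C0 * (1 - q)^2 + 2 * C1 * q^1 * (1 - q)^1 + C2 * q^2"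
    using assms by (intro add_nonneg_nonneg mult_nonneg_nonneg, simp_all)
  also have "\<dots> = outer_poly (4 + x) (3 + y) 3 (9/4) (4 + x + 3) (3 + y) P q"
    unfolding outer_poly_def C0_def C1_def C2_def by (simp add: field_simps power2_eq_square power3_eq_cube power4_eq_xxxx)
  finally show ?thesis .
qed

lemma barrier_poly_generic_5_2:
  fixes x y P :: real
  assumes "0 \<le> x" "0 \<le> y" "0 \<le> P" "P \<le> 1"
  shows "0 < barrier_poly (5 + x) (2 + y) (9/4) (5 + x + 3) (2 + y) P"
proof -
  have "0 \<le> (252 * (1 - P)^3 + 615 * P * (1 - P)^2 + 432 * P^2 * (1 - P) + 361/4 * P^3) + y * (165/2 * P * (1 - P)^2 + 1353/8 * P^2 * (1 - P) + 903/8 * P^3) + y^2 * (201/16 * P^2 * (1 - P) + 183/8 * P^3) + y^3 * (5/4 * P^3) + x * (1065/8 * (1 - P)^2 + 240 * P * (1 - P) + 903/8 * P^2) + x * y * (141/4 * P * (1 - P) + 183/4 * P^2) + x * y^2 * (15/4 * P^2) + x^2 * (363/16 * (1 - P) + 183/8 * P) + x^2 * y * (15/4 * P) + x^3 * (5/4)"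
    using assms by (intro add_nonneg_nonneg mult_nonneg_nonneg, simp_all)
  also have "\<dots> = barrier_poly (5 + x) (2 + y) (9/4) (5 + x + 3) (2 + y) P - 1"
    unfolding barrier_poly_def by (simp add: field_simps power2_eq_square power3_eq_cube power4_eq_xxxx)
  finally show ?thesis by simp
qed

lemma inner_poly_generic_5_2:
  fixes x y P q :: real
  assumes "0 \<le> x" "0 \<le> y" "0 \<le> P" "P \<le> 1" "0 \<le> q" "q \<le> 1"
  shows "0 \<le> inner_poly (5 + x) (2 + y) 3 (9/4) (5 + x + 3) (2 + y) P q"
proof -
  define C0 where "C0 = (2367/10 * P * (1 - P) + 999 * P^2) + y * (1275/4 * P * (1 - P) + 8499/10 * P^2) + y^2 * (75 * P^2) + x * (999/10 * P) + x * y * (75 * P)"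
  define C1 where "C1 = (240 * (1 - P)^2 + 2067/10 * P * (1 - P) + 249 * P^2) + y * (495/4 * P * (1 - P) + 3249/10 * P^2) + y^2 * (30 * P^2) + x * (78 * (1 - P) + 849/10 * P) + x * y * (36 * P) + x^2 * (6)"
  define C2 where "C2 = (480 * (1 - P)^2 + 2436/5 * P * (1 - P) + 39 * P^2) + y * (84 * P * (1 - P) + 1239/10 * P^2) + y^2 * (12 * P^2) + x * (156 * (1 - P) + 1239/10 * P) + x * y * (24 * P) + x^2 * (12)"
  have "0 \<le> C0" "0 \<le> C1" "0 \<le> C2"
    unfolding C0_def C1_def C2_def using assms by (intro add_nonneg_nonneg mult_nonneg_nonneg, simp_all)+
  then have "0 \<le> C0 * (1 - q)^2 + 2 * C1 * q^1 * (1 - q)^1 + C2 * q^2"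
    using assms by (intro add_nonneg_nonneg mult_nonneg_nonneg, simp_all)
  also have "\<dots> = inner_poly (5 + x) (2 + y) 3 (9/4) (5 + x + 3) (2 + y) P q"
    unfolding inner_poly_def C0_def C1_def C2_def by (simp add: field_simps power2_eq_square power3_eq_cube power4_eq_xxxx)
  finally show ?thesis .
qed

lemma outer_poly_generic_5_2:
  fixes x y P q :: real
  assumes "0 \<le> x" "0 \<le> y" "0 \<le> P" "P \<le> 1" "0 \<le> q" "q \<le> 1"
  shows "0 \<le> outer_poly (5 + x) (2 + y) 3 (9/4) (5 + x + 3) (2 + y) P q"
proof -
  define C0 where "C0 = (3000 * (1 - P)^2 + 30621/5 * P * (1 - P) + 3249 * P^2) + y * (525/2 * P * (1 - P) + 3249/10 * P^2) + x * (975 * (1 - P) + 10749/10 * P) + x * y * (75 * P) + x^2 * (75)"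
  define C1 where "C1 = (1200 * (1 - P)^2 + 20907/10 * P * (1 - P) + 969 * P^2) + y * (423/4 * P * (1 - P) + 1569/10 * P^2) + y^2 * (6 * P^2) + x * (390 * (1 - P) + 3969/10 * P) + x * y * (36 * P) + x^2 * (30)"
  define C2 where "C2 = (480 * (1 - P)^2 + 2436/5 * P * (1 - P) + 39 * P^2) + y * (84 * P * (1 - P) + 1239/10 * P^2) + y^2 * (12 * P^2) + x * (156 * (1 - P) + 1239/10 * P) + x * y * (24 * P) + x^2 * (12)"
  have "0 \<le> C0" "0 \<le> C1" "0 \<le> C2"
    unfolding C0_def C1_def C2_def using assms by (intro add_nonneg_nonneg mult_nonneg_nonneg, simp_all)+
  then have "0 \<le> C0 * (1 - q)^2 + 2 * C1 * q^1 * (1 - q)^1 + C2 * q^2"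
    using assms by (intro add_nonneg_nonneg mult_nonneg_nonneg, simp_all)
  also have "\<dots> = outer_poly (5 + x) (2 + y) 3 (9/4) (5 + x + 3) (2 + y) P q"
    unfolding outer_poly_def C0_def C1_def C2_def by (simp add: field_simps power2_eq_square power3_eq_cube power4_eq_xxxx)
  finally show ?thesis .
qed

lemma barrier_poly_m2:
  fixes x P :: real
  assumes "0 \<le> x" "0 \<le> P" "P \<le> 1"
  shows "0 < barrier_poly (6 + x) 1 (19/100) 1 0 P"
proof -
  have "0 \<le> (2573/10000 * (1 - P)^2 + 149/500 * P * (1 - P) + 23/5000 * P^2) + x * (1539/10000 * (1 - P) + 589/5000 * P)"
    using assms by (intro add_nonneg_nonneg mult_nonneg_nonneg, simp_all)
  also have "\<dots> = barrier_poly (6 + x) 1 (19/100) 1 0 P - 1/100"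
    unfolding barrier_poly_def by (simp add: field_simps power2_eq_square power3_eq_cube power4_eq_xxxx)
  finally show ?thesis by simp
qed

lemma inner_poly_m2:
  fixes x P q :: real
  assumes "0 \<le> x" "0 \<le> P" "P \<le> 1" "0 \<le> q" "q \<le> 1"
  shows "0 \<le> inner_poly (6 + x) 1 3 (19/100) 1 0 P q"
proof -
  define C0 where "C0 = (23/20 * P * (1 - P) + 249/10 * P^2)"
  define C1 where "C1 = (36 * (1 - P)^2 + 491/20 * P * (1 - P) + 9/10 * P^2) + x * (6)"
  define C2 where "C2 = (72 * (1 - P)^2 + 3491/50 * P * (1 - P) + 39/10 * P^2) + x * (12)"
  have "0 \<le> C0" "0 \<le> C1" "0 \<le> C2"
    unfolding C0_def C1_def C2_def using assms by (intro add_nonneg_nonneg mult_nonneg_nonneg, simp_all)+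
  then have "0 \<le> C0 * (1 - q)^2 + 2 * C1 * q^1 * (1 - q)^1 + C2 * q^2"
    using assms by (intro add_nonneg_nonneg mult_nonneg_nonneg, simp_all)
  also have "\<dots> = inner_poly (6 + x) 1 3 (19/100) 1 0 P q"
    unfolding inner_poly_def C0_def C1_def C2_def by (simp add: field_simps power2_eq_square power3_eq_cube power4_eq_xxxx)
  finally show ?thesis .
qed

lemma outer_poly_m2:
  fixes x P q :: real
  assumes "0 \<le> x" "0 \<le> P" "P \<le> 1" "0 \<le> q" "q \<le> 1"
  shows "0 \<le> outer_poly (6 + x) 1 3 (19/100) 1 0 P q"
proof -
  define C0 where "C0 = (450 * (1 - P)^2 + 4202/5 * P * (1 - P) + 3999/10 * P^2) + x * (75)"
  define C1 where "C1 = (180 * (1 - P)^2 + 29311/100 * P * (1 - P) + 1209/10 * P^2) + x * (30)"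
  define C2 where "C2 = (72 * (1 - P)^2 + 3491/50 * P * (1 - P) + 39/10 * P^2) + x * (12)"
  have "0 \<le> C0" "0 \<le> C1" "0 \<le> C2"
    unfolding C0_def C1_def C2_def using assms by (intro add_nonneg_nonneg mult_nonneg_nonneg, simp_all)+
  then have "0 \<le> C0 * (1 - q)^2 + 2 * C1 * q^1 * (1 - q)^1 + C2 * q^2"
    using assms by (intro add_nonneg_nonneg mult_nonneg_nonneg, simp_all)
  also have "\<dots> = outer_poly (6 + x) 1 3 (19/100) 1 0 P q"
    unfolding outer_poly_def C0_def C1_def C2_def by (simp add: field_simps power2_eq_square power3_eq_cube power4_eq_xxxx)
  finally show ?thesis .
qed

lemma barrier_poly_4_4:
  fixes P :: real
  assumes "0 \<le> P" "P \<le> 1"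
  shows "0 < barrier_poly 3 3 (7/25) 1 0 P"
proof -
  have "0 \<le> (191/2500 * (1 - P)^2 + 401/1250 * P * (1 - P) + 23/2500 * P^2)"
    using assms by (intro add_nonneg_nonneg mult_nonneg_nonneg, simp_all)
  also have "\<dots> = barrier_poly 3 3 (7/25) 1 0 P - 1/100"
    unfolding barrier_poly_def by (simp add: field_simps power2_eq_square power3_eq_cube power4_eq_xxxx)
  finally show ?thesis by simp
qed

lemma inner_poly_4_4:
  fixes P q :: real
  assumes "0 \<le> P" "P \<le> 1" "0 \<le> q" "q \<le> 1"
  shows "0 \<le> inner_poly 3 3 (9/5) (7/25) 1 0 P q"
proof -
  define C0 where "C0 = (18147/6250 * P * (1 - P) + 12249/250 * P^2)"
  define C1 where "C1 = (54/5 * (1 - P)^3 + 9519/1250 * P * (1 - P)^2 + 8022/625 * P^2 * (1 - P) + 801/50 * P^3)"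
  define C2 where "C2 = (108/5 * (1 - P)^2 + 831/250 * P * (1 - P) + 27/50 * P^2)"
  have "0 \<le> C0" "0 \<le> C1" "0 \<le> C2"
    unfolding C0_def C1_def C2_def using assms by (intro add_nonneg_nonneg mult_nonneg_nonneg, simp_all)+
  then have "0 \<le> C0 * (1 - q)^2 + 2 * C1 * q^1 * (1 - q)^1 + C2 * q^2"
    using assms by (intro add_nonneg_nonneg mult_nonneg_nonneg, simp_all)
  also have "\<dots> = inner_poly 3 3 (9/5) (7/25) 1 0 P q"
    unfolding inner_poly_def C0_def C1_def C2_def by (simp add: field_simps power2_eq_square power3_eq_cube power4_eq_xxxx)
  finally show ?thesis .
qed

lemma outer_poly_4_4:
  fixes P q :: real
  assumes "0 \<le> P" "P \<le> 1" "0 \<le> q" "q \<le> 1"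
  shows "0 \<le> outer_poly 3 3 (9/5) (7/25) 1 0 P q"
proof -
  define C0 where "C0 = (9747/125 * (1 - P)^2 + 128391/1250 * P * (1 - P) + 12249/250 * P^2)"
  define C1 where "C1 = (1026/25 * (1 - P)^2 + 44403/1250 * P * (1 - P) + 801/50 * P^2)"
  define C2 where "C2 = (108/5 * (1 - P)^2 + 831/250 * P * (1 - P) + 27/50 * P^2)"
  have "0 \<le> C0" "0 \<le> C1" "0 \<le> C2"
    unfolding C0_def C1_def C2_def using assms by (intro add_nonneg_nonneg mult_nonneg_nonneg, simp_all)+
  then have "0 \<le> C0 * (1 - q)^2 + 2 * C1 * q^1 * (1 - q)^1 + C2 * q^2"
    using assms by (intro add_nonneg_nonneg mult_nonneg_nonneg, simp_all)
  also have "\<dots> = outer_poly 3 3 (9/5) (7/25) 1 0 P q"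
    unfolding outer_poly_def C0_def C1_def C2_def by (simp add: field_simps power2_eq_square power3_eq_cube power4_eq_xxxx)
  finally show ?thesis .
qed

lemma barrier_poly_5_3:
  fixes P :: real
  assumes "0 \<le> P" "P \<le> 1"
  shows "0 < barrier_poly 4 2 (41/200) 1 (- 3/10) P"
proof -
  have "0 \<le> (119/8000 * (1 - P)^3 + 146159/400000 * P * (1 - P)^2 + 132971/400000 * P^2 * (1 - P) + 107/50000 * P^3)"
    using assms by (intro add_nonneg_nonneg mult_nonneg_nonneg, simp_all)
  also have "\<dots> = barrier_poly 4 2 (41/200) 1 (- 3/10) P - 1/200"
    unfolding barrier_poly_def by (simp add: field_simps power2_eq_square power3_eq_cube power4_eq_xxxx)
  finally show ?thesis by simp
qed

lemma inner_poly_5_3: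
  fixes P q :: real
  assumes "0 \<le> P" "P \<le> 1" "0 \<le> q" "q \<le> 1"
  shows "0 \<le> inner_poly 4 2 (9/5) (41/200) 1 (- 3/10) P q"
proof -
  define C0 where "C0 = (6331/12500 * P * (1 - P) + 40257/2500 * P^2)"
  define C1 where "C1 = (72/5 * (1 - P)^2 + 3437/2500 * P * (1 - P) + 2079/500 * P^2)"
  define C2 where "C2 = (144/5 * (1 - P)^2 + 2879/250 * P * (1 - P) + 189/500 * P^2)"
  have "0 \<le> C0" "0 \<le> C1" "0 \<le> C2"
    unfolding C0_def C1_def C2_def using assms by (intro add_nonneg_nonneg mult_nonneg_nonneg, simp_all)+
  then have "0 \<le> C0 * (1 - q)^2 + 2 * C1 * q^1 * (1 - q)^1 + C2 * q^2"
    using assms by (intro add_nonneg_nonneg mult_nonneg_nonneg, simp_all)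
  also have "\<dots> = inner_poly 4 2 (9/5) (41/200) 1 (- 3/10) P q"
    unfolding inner_poly_def C0_def C1_def C2_def by (simp add: field_simps power2_eq_square power3_eq_cube power4_eq_xxxx)
  finally show ?thesis .
qed

lemma outer_poly_5_3:
  fixes P q :: real
  assumes "0 \<le> P" "P \<le> 1" "0 \<le> q" "q \<le> 1"
  shows "0 \<le> outer_poly 4 2 (9/5) (41/200) 1 (- 3/10) P q"
proof -
  define C0 where "C0 = (12996/125 * (1 - P)^2 + 84953/625 * P * (1 - P) + 131229/2500 * P^2)"
  define C1 where "C1 = (1368/25 * (1 - P)^2 + 134729/2500 * P * (1 - P) + 1827/100 * P^2)"
  define C2 where "C2 = (144/5 * (1 - P)^2 + 2879/250 * P * (1 - P) + 189/500 * P^2)"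
  have "0 \<le> C0" "0 \<le> C1" "0 \<le> C2"
    unfolding C0_def C1_def C2_def using assms by (intro add_nonneg_nonneg mult_nonneg_nonneg, simp_all)+
  then have "0 \<le> C0 * (1 - q)^2 + 2 * C1 * q^1 * (1 - q)^1 + C2 * q^2"
    using assms by (intro add_nonneg_nonneg mult_nonneg_nonneg, simp_all)
  also have "\<dots> = outer_poly 4 2 (9/5) (41/200) 1 (- 3/10) P q"
    unfolding outer_poly_def C0_def C1_def C2_def by (simp add: field_simps power2_eq_square power3_eq_cube power4_eq_xxxx)
  finally show ?thesis .
qed

text \<open>Three demands on g pull against each other: g 0 > 1 / n, so that the profile starts
  above the curve; the window for the end slope at P = 1; and the inner inequality at q = 0 as P
  tends to 0, which bounds g 0 by roughly (b d - 2) / (b (d + 2)). The parameters are chosen to fit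
  between them.\<close>

lemma exists_barrier:
  fixes n m :: nat and d :: real
  assumes n: "n \<ge> 3" and m: "m \<ge> 2"
    and d: "d = 9/5 \<and> (n, m) \<in> {(4, 4), (5, 3)} \<or> d = 3 \<and> n + m \<ge> 9"
  obtains c A s where "c > 0" "A > 0" "A + s > 0" "2 * c \<le> A" "A < c * real n"
    "\<And>P. \<lbrakk>0 \<le> P; P \<le> 1\<rbrakk> \<Longrightarrow> barrier_poly (real n - 1) (real m - 1) c A s P > 0"
    "\<And>P q. \<lbrakk>0 \<le> P; P \<le> 1; 0 \<le> q; q \<le> 1\<rbrakk> \<Longrightarrow> inner_poly (real n - 1) (real m - 1) d c A s P q \<ge> 0"
    "\<And>P q. \<lbrakk>0 \<le> P; P \<le> 1; 0 \<le> q; q \<le> 1\<rbrakk> \<Longrightarrow> outer_poly (real n - 1) (real m - 1) d c A s P q \<ge> 0"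
proof -
  consider "n = 4" "m = 4" "d = 9/5" | "n = 5" "m = 3" "d = 9/5" | "m = 2" "n \<ge> 7" "d = 3"
    | "m \<ge> 3" "n + m \<ge> 9" "d = 3"
    using d m by force
  then show thesis
  proof cases
    case 1
    \<comment> \<open>For N = 6 the end slope must lie between 1/4 and 1/3, and here g 0 must stay
      below about 34/114. A constant denominator meets both demands with g 0 and end slope equal to
      7/25.\<close>
    then show thesis
      using that[of "7/25" 1 0] barrier_poly_4_4 inner_poly_4_4 outer_poly_4_4
      unfolding 1 by simp
  next
    case 2
    \<comment> \<open>Here g 0 must stay below about 16/76 < 1/4, so an affine g cannot have its end
      slope in the window from 1/4 to 1/3. The negative \<open>s\<close> bends the curve: g 0 =
      41/200 and end slope 41/140.\<close>
    then show thesis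
      using that[of "41/200" 1 "- 3/10"] barrier_poly_5_3 inner_poly_5_3 outer_poly_5_3
      unfolding 2 by simp
  next
    case 3
    \<comment> \<open>With m = 2 the bound on g 0 is about 1/5, which excludes the general choice
      below (it gives 1/4 for n = 7). The smaller root for n = 7 is (4 - sqrt 2) / 14, about 0.185,
      so 19/100 fits.\<close>
    define x where "x = real n - 7"
    have x: "real n - 1 = 6 + x" "0 \<le> x" "real n = 7 + x" using 3 by (auto simp: x_def)
    show thesis
      using that[of "19/100" 1 0] barrier_poly_m2 inner_poly_m2 outer_poly_m2 3 x by simp
  next
    case 4
    \<comment> \<open>The region n + m \<ge> 9 with n, m \<ge> 3 is a union of four quadrants. In
      each of them the excesses x and y over the corner are independent nonnegative variables. The
      denominator of g is a + b P + 3, adapted to the factor a + b P of the phase plane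
      system.\<close>
    consider "n \<ge> 3" "m \<ge> 6" | "n \<ge> 4" "m \<ge> 5" | "n \<ge> 5" "m \<ge> 4" | "n \<ge> 6" "m \<ge> 3"
      using 4 n by linarith
    then have *: "(\<forall>P. 0 \<le> P \<longrightarrow> P \<le> 1 \<longrightarrow> barrier_poly (real n - 1) (real m - 1) (9/4) (real n + 2) (real m - 1) P > 0) \<and>
      (\<forall>P q. 0 \<le> P \<longrightarrow> P \<le> 1 \<longrightarrow> 0 \<le> q \<longrightarrow> q \<le> 1 \<longrightarrow>
        inner_poly (real n - 1) (real m - 1) 3 (9/4) (real n + 2) (real m - 1) P q \<ge> 0 \<and>
        outer_poly (real n - 1) (real m - 1) 3 (9/4) (real n + 2) (real m - 1) P q \<ge> 0)"
    proof cases
      case 1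
      define x y where "x = real n - 3" "y = real m - 6"
      have "real n - 1 = 2 + x" "real n + 2 = 2 + x + 3" "real m - 1 = 5 + y" "0 \<le> x" "0 \<le> y"
        using 1 by (auto simp: x_y_def)
      then show ?thesis
        using barrier_poly_generic_2_5 inner_poly_generic_2_5 outer_poly_generic_2_5 by simp
    next
      case 2
      define x y where "x = real n - 4" "y = real m - 5"
      have "real n - 1 = 3 + x" "real n + 2 = 3 + x + 3" "real m - 1 = 4 + y" "0 \<le> x" "0 \<le> y"
        using 2 by (auto simp: x_y_def)
      then show ?thesis
        using barrier_poly_generic_3_4 inner_poly_generic_3_4 outer_poly_generic_3_4 by simp
    next
      case 3
      define x y where "x = real n - 5" "y = real m - 4"
      have "real n - 1 = 4 + x" "real n + 2 = 4 + x + 3" "real m - 1 = 3 + y" "0 \<le> x" "0 \<le> y"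
        using 3 by (auto simp: x_y_def)
      then show ?thesis
        using barrier_poly_generic_4_3 inner_poly_generic_4_3 outer_poly_generic_4_3 by simp
    next
      case 4
      define x y where "x = real n - 6" "y = real m - 3"
      have "real n - 1 = 5 + x" "real n + 2 = 5 + x + 3" "real m - 1 = 2 + y" "0 \<le> x" "0 \<le> y"
        using 4 by (auto simp: x_y_def)
      then show ?thesis
        using barrier_poly_generic_5_2 inner_poly_generic_5_2 outer_poly_generic_5_2 by simp
    qed
    show thesis
      using that[of "9/4" "real n + 2" "real m - 1"] * 4 n by simp
  qed
qed

section \<open>The barrier curve in the phase plane\<close>

definition barrier_fun :: "real \<Rightarrow> real \<Rightarrow> real \<Rightarrow> real \<Rightarrow> real" where
  "barrier_fun c A s P = c * (1 - P) / (A + s * P)"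

lemma barrier_denominator_pos:
  fixes A s P :: real
  assumes "A > 0" "A + s > 0" "0 \<le> P" "P \<le> 1"
  shows "A + s * P > 0"
proof -
  have "A + s * P = (1 - P) * A + P * (A + s)" by (simp add: algebra_simps)
  moreover have "\<dots> > 0"
    using assms by (cases "P = 0") (auto intro!: add_nonneg_pos mult_nonneg_nonneg mult_pos_pos)
  ultimately show ?thesis by simp
qed

text \<open>\<open>cA\<close> gives g \<le> 1/2, hence Y \<ge> 1/2 along the barrier region, which
  keeps the denominator Y of P' away from 0. \<open>cn\<close> says that 1 - g 0 < a / (a + 1), so
  that the starting point of the phase curve lies strictly above the barrier.\<close>

locale barrier =
  fixes a b c A s :: real
  assumes a: "a > 0" and b: "b > 0" and c: "c > 0" and A: "A > 0" "A + s > 0"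
    and cA: "2 * c \<le> A" and cn: "A < c * (a + 1)"
    and bar: "\<And>P. \<lbrakk>0 \<le> P; P \<le> 1\<rbrakk> \<Longrightarrow> barrier_poly a b c A s P > 0"
begin

abbreviation "g \<equiv> barrier_fun c A s"

lemma den: "0 \<le> P \<Longrightarrow> P \<le> 1 \<Longrightarrow> A + s * P > 0"
  using barrier_denominator_pos A by blast

lemma g_bounds:
  assumes "0 \<le> P" "P \<le> 1"
  shows "0 \<le> g P" "g P \<le> 1/2"
proof -
  have d: "A + s * P > 0" using den assms by blast
  show "0 \<le> g P" using d c assms by (simp add: barrier_fun_def)
  have "(A + s * P) - 2 * (c * (1 - P)) = (1 - P) * (A - 2 * c) + P * (A + s)" by (simp add: algebra_simps)
  moreover have "\<dots> \<ge> 0" using cA A assms by (intro add_nonneg_nonneg[OF mult_nonneg_nonneg mult_nonneg_nonneg]) auto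
  ultimately show "g P \<le> 1/2" using d by (simp add: barrier_fun_def field_simps)
qed

lemma den_lower: obtains e where "e > 0" "\<And>P. \<lbrakk>0 \<le> P; P \<le> 1\<rbrakk> \<Longrightarrow> e \<le> A + s * P"
proof
  show "min A (A + s) > 0" using A by simp
  fix P :: real assume P: "0 \<le> P" "P \<le> 1"
  have "A + s * P = (1 - P) * A + P * (A + s)" by (simp add: algebra_simps)
  moreover have "\<dots> \<ge> (1 - P) * min A (A + s) + P * min A (A + s)"
    using P by (intro add_mono mult_left_mono) auto
  ultimately show "min A (A + s) \<le> A + s * P" by (simp add: algebra_simps)
qed

lemma g_linear: obtains M where "M > 0" "\<And>P. \<lbrakk>0 \<le> P; P \<le> 1\<rbrakk> \<Longrightarrow> g P \<le> M * (1 - P)"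
proof -
  obtain e where e: "e > 0" "\<And>P. \<lbrakk>0 \<le> P; P \<le> 1\<rbrakk> \<Longrightarrow> e \<le> A + s * P" using den_lower by blast
  show thesis
  proof (rule that[of "c / e"])
    show "c / e > 0" using c e by simp
    fix P :: real assume P: "0 \<le> P" "P \<le> 1"
    show "g P \<le> c / e * (1 - P)"
      unfolding barrier_fun_def using e(1) e(2)[OF P] c P by (auto simp: intro!: frac_le)
  qed
qed

lemma g_lipschitz:
  obtains L where "L \<ge> 0"
    "\<And>P P'. \<lbrakk>0 \<le> P; P \<le> 1; 0 \<le> P'; P' \<le> 1\<rbrakk> \<Longrightarrow> g P \<le> g P' + L * \<bar>P - P'\<bar>"
proof -
  obtain e where e: "e > 0" "\<And>P. \<lbrakk>0 \<le> P; P \<le> 1\<rbrakk> \<Longrightarrow> e \<le> A + s * P" using den_lower by blast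
  show thesis
  proof (rule that[of "c * (A + s) / (e * e)"])
    show "c * (A + s) / (e * e) \<ge> 0" using c e A by simp
    fix P P' :: real assume P: "0 \<le> P" "P \<le> 1" "0 \<le> P'" "P' \<le> 1"
    have d: "e \<le> A + s * P" "e \<le> A + s * P'" using e P by auto
    then have d0: "A + s * P > 0" "A + s * P' > 0" using e by auto
    have "g P - g P' = (c * (A + s)) * (P' - P) / ((A + s * P) * (A + s * P'))"
      using d0 unfolding barrier_fun_def by (simp add: diff_frac_eq) (simp add: algebra_simps)
    also have "\<dots> \<le> (c * (A + s)) * \<bar>P - P'\<bar> / (e * e)"
      using d e c A by (intro frac_le mult_mono mult_left_mono mult_nonneg_nonneg mult_pos_pos) auto
    finally show "g P \<le> g P' + c * (A + s) / (e * e) * \<bar>P - P'\<bar>" by simp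
  qed
qed

lemma g_deriv:
  assumes "0 \<le> P" "P \<le> 1"
  shows "(g has_real_derivative - c * (A + s) / (A + s * P)\<^sup>2) (at P)"
proof -
  have "A + s * P \<noteq> 0" using den[OF assms] by simp
  then show ?thesis
    unfolding barrier_fun_def
    by (auto intro!: derivative_eq_intros simp: field_simps power2_eq_square)
qed

text \<open>This is the derivative of Y - 1 + g P with respect to log r at a point of the curve Y =
  1 - g P. It vanishes at the equilibrium P = 1, where the curve ends; with the factor 1 - P split
  off, the numerator is \<open>barrier_poly\<close>.\<close>

lemma barrier_crossing:
  assumes P: "0 \<le> P" "P < 1"
  shows "P - (1 - g P) + (a + b * P) * g P
    + (- c * (A + s) / (A + s * P)\<^sup>2) * (2 * P * (a + b * P) * g P / (1 - g P)) > 0"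
proof -
  define E where "E = A + s * P"
  define R where "R = E - c * (1 - P)"
  have E: "E > 0" using den P by (auto simp: E_def)
  have "g P \<le> 1/2" using g_bounds P by simp
  then have "c * (1 - P) \<le> 1/2 * E" unfolding barrier_fun_def E_def[symmetric] using E by (simp only: pos_divide_le_eq)
  then have R: "R > 0" using E unfolding R_def by linarith
  have gE: "g P = c * (1 - P) / E" by (simp add: barrier_fun_def E_def)
  have gR: "1 - g P = R / E" using E by (simp add: gE R_def field_simps)
  have "P - (1 - g P) + (a + b * P) * g P
    + (- c * (A + s) / E\<^sup>2) * (2 * P * (a + b * P) * g P / (1 - g P)) =
    (1 - P) * barrier_poly a b c A s P / (E\<^sup>2 * R)"
  proof -
    have 1: "P - (1 - g P) = (1 - P) * (- 1 + c / E)" using E by (simp add: gE field_simps)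
    have 2: "2 * P * (a + b * P) * g P / (1 - g P) = 2 * P * (a + b * P) * (c * (1 - P)) / R"
      unfolding gR unfolding gE using E by simp
    show ?thesis
      unfolding 1 2 unfolding gE barrier_poly_def E_def[symmetric] R_def[symmetric]
      using E R by (simp add: divide_simps) (simp add: algebra_simps power2_eq_square)
  qed
  moreover have "\<dots> > 0" using bar[of P] P E R by simp
  ultimately show ?thesis by (simp add: E_def)
qed

end

section \<open>The profile in the phase plane\<close>

text \<open>
  In terms of \<open>P = \<phi>'\<^sup>2/\<alpha>\<^sup>2\<close> and \<open>Y = \<phi>\<phi>'/(\<alpha>\<^sup>2 r)\<close> and of \<open>log r\<close> the profile equation is the autonomous system
  \<open>Y' = P - Y + (a + b P)(1 - Y)\<close>, \<open>P' = 2 P (a + b P)(1 - Y)/Y\<close>, starting at \<open>(a/(a + 1), 0)\<close> and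
  tending to the equilibrium \<open>(1, 1)\<close> of the cone. The region \<open>P < 1\<close>, \<open>1 - g P < Y < 1\<close> is invariant:
  \<open>Y = 1\<close> is left downwards, \<open>Y = 1 - g P\<close> upwards, and \<open>P = 1\<close> is not reached in finite time since
  \<open>P'\<close> is bounded by a multiple of \<open>1 - P\<close> there.
\<close>

definition profile_derivs :: "real \<Rightarrow> real \<Rightarrow> (nat \<Rightarrow> real \<Rightarrow> real) \<Rightarrow> bool" where
  "profile_derivs a b D \<longleftrightarrow>
     (\<forall>k. \<forall>r\<ge>0. (D k has_real_derivative D (Suc k) r) (at r within {0..})) \<and>
     D 0 0 = 1 \<and> D 1 0 = 0 \<and> (\<forall>r\<ge>0. 1 \<le> D 0 r) \<and>
     (\<forall>r>0. D 2 r * D 0 r / (1 + (D 1 r)\<^sup>2) + a / r * D 0 r * D 1 r = b)"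

lemma first_exit:
  fixes G :: "real \<Rightarrow> real"
  assumes cont: "\<And>r. r > 0 \<Longrightarrow> isCont G r" and start: "eventually (\<lambda>r. G r > 0) (at_right 0)"
    and R: "R > 0" "G R \<le> 0"
  obtains r0 where "r0 > 0" "G r0 = 0" "\<And>r. \<lbrakk>0 < r; r < r0\<rbrakk> \<Longrightarrow> G r > 0"
proof -
  obtain e where e: "e > 0" "\<And>r. \<lbrakk>0 < r; r < e\<rbrakk> \<Longrightarrow> G r > 0"
    using start unfolding eventually_at_right_field by blast
  \<comment> \<open>Near 0 the function is known only to be positive, not to extend continuously.
    Starting at \<open>e'\<close> makes the set of nonpositive values compact, so its minimum
    exists.\<close>
  define e' where "e' = min (e / 2) R"
  have e': "0 < e'" "e' < e" "e' \<le> R" using e R by (auto simp: e'_def)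
  have contR: "continuous_on {e'..R} G"
    by (intro continuous_at_imp_continuous_on ballI cont) (use e' in auto)
  define S where "S = {r \<in> {e'..R}. G r \<le> 0}"
  have "compact S"
  proof -
    have "S = {e'..R} \<inter> G -` {..0}" by (auto simp: S_def)
    moreover have "closed ({e'..R} \<inter> G -` {..0})"
      by (intro continuous_closed_preimage contR) auto
    ultimately show ?thesis
      
      by (simp add: compact_eq_bounded_closed) (auto intro: bounded_subset[OF bounded_closed_interval])
  qed
  moreover have "S \<noteq> {}" using R e' by (auto simp: S_def)
  ultimately obtain r0 where r0: "r0 \<in> S" "\<And>r. r \<in> S \<Longrightarrow> r0 \<le> r"
    using compact_attains_inf by metis
  have pos: "G r > 0" if "0 < r" "r < r0" for r
  proof (cases "r < e")
    case False
    then have "r \<notin> S" using r0(2) that by force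
    then show ?thesis using False that r0(1) e' by (auto simp: S_def)
  qed (use e that in auto)
  have r0e: "e' < r0"
    using r0(1) e(2)[of e'] e' by (cases "r0 = e'") (auto simp: S_def)
  have "G r0 \<ge> 0"
  proof (rule continuous_ge_on_closure[where f = G and x = r0])
    show "continuous_on (closure {e'<..<r0}) G"
      using r0e r0(1) by (auto simp: S_def intro: continuous_on_subset[OF contR])
    show "r0 \<in> closure {e'<..<r0}" using r0e by simp
  qed (use pos e' in \<open>auto intro: less_imp_le\<close>)
  then have "G r0 = 0" using r0(1) by (auto simp: S_def)
  then show thesis using that[of r0] pos r0e e' by auto
qed

lemma (in barrier) profile_in_barrier:
  fixes D :: "nat \<Rightarrow> real \<Rightarrow> real"
  assumes sol: "profile_derivs a b D"
    and r: "r > 0"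
  shows "(D 1 r)\<^sup>2 * a / b < 1" and "D 0 r * D 1 r / r * a / b < 1"
    and "1 - D 0 r * D 1 r / r * a / b < g ((D 1 r)\<^sup>2 * a / b)"
proof -
  have deriv: "\<And>k r. r \<ge> 0 \<Longrightarrow> (D k has_real_derivative D (Suc k) r) (at r within {0..})"
    and init: "D 0 0 = 1" "D 1 0 = 0" and ge1: "\<And>r. r \<ge> 0 \<Longrightarrow> 1 \<le> D 0 r"
    and ode: "\<And>r. r > 0 \<Longrightarrow> D 2 r * D 0 r / (1 + (D 1 r)\<^sup>2) + a / r * D 0 r * D 1 r = b"
    using sol by (auto simp only: profile_derivs_def)
  define P where "P = (\<lambda>r. (D 1 r)\<^sup>2 * a / b)"
  define Y where "Y = (\<lambda>r. D 0 r * D 1 r / r * a / b)"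
  define B where "B = (\<lambda>r. Y r - 1 + c * (1 - P r) / (A + s * P r))"
  have P0: "P r \<ge> 0" for r using a b by (simp add: P_def)
  have der: "(D k has_real_derivative D (Suc k) r) (at r)" if "r > 0" for k r
    using deriv[of r k] that by (metis at_within_interior interior_real_atLeast greaterThan_iff less_imp_le)
  have D2: "D 2 r * D 0 r = (1 + (D 1 r)\<^sup>2) * (b * (1 - Y r))" if "r > 0" for r
  proof -
    have N: "1 + (D 1 r)\<^sup>2 > 0" by (simp add: add_pos_nonneg)
    have "b * (1 - Y r) = b - a / r * D 0 r * D 1 r" using b by (simp add: Y_def field_simps)
    also have "\<dots> = D 2 r * D 0 r / (1 + (D 1 r)\<^sup>2)" using ode[OF that] by linarith
    finally show ?thesis using N by simp
  qed
  have derY: "(Y has_real_derivative (P r - Y r + (a + b * P r) * (1 - Y r)) / r) (at r)" if "r > 0" for r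
  proof -
    have "(Y has_real_derivative ((D 1 r * D 1 r + D 0 r * D 2 r) * r - D 0 r * D 1 r) / (r * r) * a / b) (at r)"
      using der[of r 0] der[of r 1] that b unfolding Y_def
      by (auto intro!: derivative_eq_intros simp: numeral_2_eq_2 field_simps)
    moreover have "((D 1 r * D 1 r + D 0 r * D 2 r) * r - D 0 r * D 1 r) / (r * r) * a / b =
        (P r - Y r + (a + b * P r) * (1 - Y r)) / r"
    proof -
      have 1: "D 1 r * D 1 r = P r * b / a" using a b by (simp add: P_def power2_eq_square)
      have 2: "D 0 r * D 2 r = (1 + P r * b / a) * (b * (1 - Y r))"
        using D2[OF that] 1 by (simp add: mult.commute power2_eq_square)
      have 3: "D 0 r * D 1 r = Y r * b * r / a" using that a b by (simp add: Y_def)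
      show ?thesis unfolding 1 2 3 using that a b by (simp add: field_simps)
    qed
    ultimately show ?thesis by simp
  qed
  have derP: "(P has_real_derivative 2 * D 1 r * D 2 r * a / b) (at r)" if "r > 0" for r
    using der[of r 1] that b unfolding P_def
    by (auto intro!: derivative_eq_intros simp: numeral_2_eq_2)
  have P': "2 * D 1 r * D 2 r * a / b = (2 * P r * (a + b * P r) * (1 - Y r) / Y r) / r" if "r > 0" "Y r > 0" for r
  proof -
    have d0: "D 0 r > 0" using ge1[of r] that by simp
    have "D 2 r = (1 + (D 1 r)\<^sup>2) * (b * (1 - Y r)) / D 0 r" using D2[OF that(1)] d0 by (simp add: field_simps)
    then have "2 * D 1 r * D 2 r * a / b = 2 * D 1 r * (1 + (D 1 r)\<^sup>2) * (1 - Y r) * a * (1 / D 0 r)"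
      using b by simp
    \<comment> \<open>Eliminating 1 / \<phi> through Y supplies a second factor \<phi>' and makes
      the equation for P autonomous, at the price of Y in the denominator.\<close>
    also have "1 / D 0 r = D 1 r * a / (b * Y r * r)"
    proof -
      have y: "D 1 r \<noteq> 0" using that by (auto simp: Y_def)
      show ?thesis using that(1) a b d0 y unfolding Y_def by (simp add: field_simps)
    qed
    finally show ?thesis using that a b by (simp add: P_def field_simps power2_eq_square)
  qed
  define G where "G = (\<lambda>r. min (1 - P r) (min (B r) (1 - Y r)))"
  have contP: "isCont P r" and contY: "isCont Y r" if "r > 0" for r
    using derP[OF that] derY[OF that] DERIV_isCont by blast+
  have lim0: "(D k \<longlongrightarrow> D k 0) (at_right 0)" for k
  proof -
    have "(D k \<longlongrightarrow> D k 0) (at 0 within {0..})"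
      using DERIV_continuous[OF deriv[of 0 k]] by (simp add: continuous_within)
    then show ?thesis by (rule tendsto_within_subset) auto
  qed
  have limq: "((\<lambda>r. D 1 r / r) \<longlongrightarrow> D 2 0) (at_right 0)"
  proof -
    have "((\<lambda>r. (D 1 r - D 1 0) / (r - 0)) \<longlongrightarrow> D (Suc 1) 0) (at 0 within {0..})"
      using deriv[of 0 1] by (simp add: has_field_derivative_iff)
    then have "((\<lambda>r. (D 1 r - D 1 0) / (r - 0)) \<longlongrightarrow> D (Suc 1) 0) (at_right 0)"
      by (rule tendsto_within_subset) auto
    then show ?thesis using init by (simp add: numeral_2_eq_2)
  qed
  \<comment> \<open>Passing to the limit r -> 0 in the equation, where \<phi>' / r tends to
    \<phi>''(0), gives (1 + a) \<phi>''(0) = b. This fixes the limit a / (a + 1) of Y.\<close>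
  have D20: "D 2 0 = b / (a + 1)"
  proof -
    have "((\<lambda>r. D 2 r * D 0 r / (1 + (D 1 r)\<^sup>2) + a * D 0 r * (D 1 r / r)) \<longlongrightarrow>
        D 2 0 * D 0 0 / (1 + (D 1 0)\<^sup>2) + a * D 0 0 * D 2 0) (at_right 0)"
      by (intro tendsto_intros lim0 limq) (simp add: init[simplified])
    moreover have "eventually (\<lambda>r. D 2 r * D 0 r / (1 + (D 1 r)\<^sup>2) + a * D 0 r * (D 1 r / r) = b) (at_right 0)"
      using eventually_at_right_less[of "0::real"] by eventually_elim (use ode in \<open>simp add: mult.commute mult.left_commute\<close>)
    ultimately have "((\<lambda>r::real. b) \<longlongrightarrow> D 2 0 * D 0 0 / (1 + (D 1 0)\<^sup>2) + a * D 0 0 * D 2 0) (at_right 0)"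
      by (rule Lim_transform_eventually)
    then have "b = D 2 0 * D 0 0 / (1 + (D 1 0)\<^sup>2) + a * D 0 0 * D 2 0"
      by (intro tendsto_unique[OF _ tendsto_const]) auto
    then show ?thesis using a by (simp add: init[simplified] field_simps)
  qed
  have limP: "(P \<longlongrightarrow> 0) (at_right 0)"
  proof -
    have "(P \<longlongrightarrow> (D 1 0)\<^sup>2 * a / b) (at_right 0)" unfolding P_def
      by (intro tendsto_intros lim0) (use b in auto)
    then show ?thesis by (simp add: init[simplified])
  qed
  have limY: "(Y \<longlongrightarrow> a / (a + 1)) (at_right 0)"
  proof -
    have "((\<lambda>r. D 0 r * (D 1 r / r) * a / b) \<longlongrightarrow> D 0 0 * D 2 0 * a / b) (at_right 0)"
      by (intro tendsto_intros lim0 limq) (use b in auto)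
    moreover have "D 0 0 * D 2 0 * a / b = a / (a + 1)" using b by (simp add: init[simplified] D20)
    ultimately show ?thesis by (simp add: Y_def)
  qed
  have limB: "(B \<longlongrightarrow> a / (a + 1) - 1 + c * (1 - 0) / (A + s * 0)) (at_right 0)"
    unfolding B_def by (intro tendsto_intros limP limY) (use A in auto)
  have "eventually (\<lambda>r. G r > 0) (at_right 0)"
  proof -
    have "a / (a + 1) - 1 + c * (1 - 0) / (A + s * 0) > 0"
    proof -
      have "1 / (a + 1) < c / A" using cn A a by (simp add: field_simps)
      moreover have "a / (a + 1) = 1 - 1 / (a + 1)" using a by (simp add: field_simps)
      ultimately show ?thesis by simp
    qed
    from order_tendstoD(1)[OF limB this] have "eventually (\<lambda>r. B r > 0) (at_right 0)" .
    moreover have "eventually (\<lambda>r. P r < 1) (at_right 0)" by (rule order_tendstoD(2)[OF limP]) simp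
    moreover have "eventually (\<lambda>r. Y r < 1) (at_right 0)" by (rule order_tendstoD(2)[OF limY]) (use a in simp)
    ultimately show ?thesis by eventually_elim (simp add: G_def)
  qed
  note start = this
  have Ecut: "G r > 0" if R: "r > 0" for r
  proof (rule ccontr)
    assume neg: "\<not> G r > 0"
    \<comment> \<open>The truncation keeps the denominator \<open>A + s * P\<close> away from 0 before \<open>P \<le> 1\<close> is known.\<close>
    define P1 where "P1 = (\<lambda>r. min (P r) 1)"
    define G1 where "G1 = (\<lambda>r. min (1 - P r) (min (Y r - 1 + c * (1 - P1 r) / (A + s * P1 r)) (1 - Y r)))"
    have GG1: "G1 r > 0 \<longleftrightarrow> G r > 0" for r by (auto simp: G_def G1_def B_def P1_def min_def)
    have "isCont G1 r" if "r > 0" for r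
    proof -
      have "A + s * P1 r \<noteq> 0" using den[of "P1 r"] P0[of r] by (simp add: P1_def)
      then show ?thesis unfolding G1_def P1_def
        by (intro continuous_intros contP contY that) (simp add: P1_def)
    qed
    moreover have "eventually (\<lambda>r. G1 r > 0) (at_right 0)" using start by (simp add: GG1)
    moreover have "G1 r \<le> 0" using neg GG1[of r] by linarith
    ultimately obtain r0 where r0: "r0 > 0" "G1 r0 = 0" "\<And>r. \<lbrakk>0 < r; r < r0\<rbrakk> \<Longrightarrow> G1 r > 0"
      using first_exit[of G1 r] R by blast
    have good: "P r < 1" "B r > 0" "Y r < 1" if "0 < r" "r < r0" for r
      using r0(3)[OF that] by (auto simp: G1_def P1_def B_def min_def split: if_splits)
    have at0: "P r0 \<le> 1" "B r0 \<ge> 0" "Y r0 \<le> 1"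
      using r0(2) by (auto simp: G1_def P1_def B_def min_def split: if_splits)
    have Bg: "B r = Y r - 1 + g (P r)" for r by (simp add: B_def barrier_fun_def)
    have Yhalf: "Y r \<ge> 1/2" if "0 < r" "r \<le> r0" for r
    proof -
      have "P r \<le> 1" "B r \<ge> 0" using good[of r] at0 that by (cases "r = r0"; force)+
      then show ?thesis using g_bounds(2)[of "P r"] P0[of r] by (simp add: Bg)
    qed
    have P1: "P r0 < 1"
    proof (rule ccontr)
      assume "\<not> P r0 < 1"
      then have Pr0: "P r0 = 1" using at0 by simp
      obtain M where M: "M > 0" "\<And>P. \<lbrakk>0 \<le> P; P \<le> 1\<rbrakk> \<Longrightarrow> g P \<le> M * (1 - P)" using g_linear by blast
      obtain N :: nat where N: "4 * (a + b) * M \<le> real N" using real_arch_simple by blast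
      \<comment> \<open>Gronwall argument in log r: from 1 - Y < g P \<le> M (1 - P), Y \<ge> 1/2
        and P \<le> 1 follows r P' \<le> 4 (a + b) M (1 - P) \<le> N (1 - P). So \<open>H\<close> is
        nondecreasing and cannot drop from a positive value at r0 / 2 to 0 at r0.\<close>
      define H where "H = (\<lambda>r. (1 - P r) * r ^ N)"
      define H' where "H' = (\<lambda>r. - (2 * D 1 r * D 2 r * a / b) * r ^ N + (1 - P r) * (real N * r ^ (N - 1)))"
      have derH: "(H has_real_derivative H' r) (at r)" if "r > 0" for r
        unfolding H_def H'_def using derP[OF that]
        by (auto intro!: derivative_eq_intros)
      have H'pos: "H' r \<ge> 0" if "0 < r" "r < r0" for r
      proof -
        have Pr: "0 \<le> P r" "P r < 1" and Yr: "1/2 \<le> Y r" "Y r < 1" and Br: "1 - Y r < g (P r)"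
          using good[OF that] P0[of r] Yhalf[of r] that by (auto simp: Bg)
        have "2 * P r * (a + b * P r) * (1 - Y r) / Y r \<le> 2 * (a + b) * (M * (1 - P r)) / (1/2)"
        proof (intro frac_le mult_mono)
          show "2 * P r \<le> 2" "a + b * P r \<le> a + b" using Pr b by (auto simp: mult_left_le)
          show "1 - Y r \<le> M * (1 - P r)" using Br M(2)[of "P r"] Pr by simp
        qed (use Pr Yr a b M in auto)
        also have "\<dots> = 4 * (a + b) * M * (1 - P r)" by (simp add: algebra_simps)
        also have "\<dots> \<le> real N * (1 - P r)" using N Pr by (intro mult_right_mono) auto
        finally have k: "2 * P r * (a + b * P r) * (1 - Y r) / Y r \<le> real N * (1 - P r)" .
        have Npos: "N > 0" 
        proof -
          have "4 * (a + b) * M > 0" using M a b by simp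
          then show ?thesis using N by linarith
        qed
        have rN: "r ^ N = r * r ^ (N - 1)" using Npos by (simp add: power_eq_if)
        define X where "X = 2 * P r * (a + b * P r) * (1 - Y r) / Y r"
        have X: "2 * D 1 r * D 2 r * a / b = X / r" unfolding X_def by (rule P') (use Yr that in auto)
        have "H' r = r ^ (N - 1) * (real N * (1 - P r) - X)"
          unfolding H'_def X rN using that by (simp add: algebra_simps)
        with k[folded X_def]
        show ?thesis using that by simp
      qed
      have "H (r0 / 2) \<le> H r0"
      proof (rule DERIV_nonneg_imp_increasing_open[where f = H])
        show "r0 / 2 \<le> r0" using r0 by simp
        show "\<exists>y. (H has_real_derivative y) (at x) \<and> 0 \<le> y" if "r0 / 2 < x" "x < r0" for x
          using derH[of x] H'pos[of x] that r0(1) by (intro exI[of _ "H' x"]) auto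
        show "continuous_on {r0 / 2..r0} H"
          by (intro continuous_at_imp_continuous_on ballI DERIV_isCont[OF derH]) (use r0 in auto)
      qed
      moreover have "H r0 = 0" by (simp add: H_def Pr0)
      moreover have "H (r0 / 2) > 0" using good[of "r0 / 2"] r0 by (simp add: H_def)
      ultimately show False by simp
    qed
    have Y1: "Y r0 < 1"
    proof (rule ccontr)
      assume "\<not> Y r0 < 1"
      then have Yr0: "Y r0 = 1" using at0 by simp
      \<comment> \<open>On Y = 1 the derivative reduces to (P - 1) / r < 0, so Y would exceed 1 just
        before r0.\<close>
      then have "(P r0 - Y r0 + (a + b * P r0) * (1 - Y r0)) / r0 < 0" using P1 r0 by (simp add: divide_neg_pos)
      from DERIV_neg_dec_left[OF derY[OF r0(1)] this]
      obtain e where e: "e > 0" "\<And>h. \<lbrakk>0 < h; h < e\<rbrakk> \<Longrightarrow> Y r0 < Y (r0 - h)" by blast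
      define h where "h = min (e / 2) (r0 / 2)"
      have "Y r0 < Y (r0 - h)" using e r0 by (intro e(2)) (auto simp: h_def)
      moreover have "Y (r0 - h) < 1" using e r0 by (intro good(3)) (auto simp: h_def)
      ultimately show False using Yr0 by simp
    qed
    \<comment> \<open>At a first zero of \<open>B\<close> its derivative is positive by
      \<open>barrier_crossing\<close>, so \<open>B\<close> would be negative just before r0.\<close>
    have B1: "B r0 > 0"
    proof (rule ccontr)
      assume "\<not> B r0 > 0"
      then have "B r0 = 0" using at0 by simp
      then have Yg: "1 - Y r0 = g (P r0)" "Y r0 = 1 - g (P r0)" by (auto simp: Bg)
      have Ypos: "Y r0 > 0" using Yhalf[of r0] r0 by simp
      let ?dg = "- c * (A + s) / (A + s * P r0)\<^sup>2"
      have "(B has_real_derivative (P r0 - Y r0 + (a + b * P r0) * (1 - Y r0)) / r0 +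
          ?dg * (2 * D 1 r0 * D 2 r0 * a / b)) (at r0)"
      proof -
        have "((\<lambda>r. g (P r)) has_real_derivative ?dg * (2 * D 1 r0 * D 2 r0 * a / b)) (at r0)"
          using DERIV_chain2[OF g_deriv[of "P r0"] derP[OF r0(1)]] P0 at0 by simp
        then have "((\<lambda>r. Y r - 1 + g (P r)) has_real_derivative (P r0 - Y r0 + (a + b * P r0) * (1 - Y r0)) / r0 +
          ?dg * (2 * D 1 r0 * D 2 r0 * a / b)) (at r0)"
          using derY[OF r0(1)] by (auto intro!: derivative_eq_intros)
        then show ?thesis unfolding Bg[abs_def] .
      qed
      moreover have "(P r0 - Y r0 + (a + b * P r0) * (1 - Y r0)) / r0 + ?dg * (2 * D 1 r0 * D 2 r0 * a / b) > 0"
      proof -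
        have "(P r0 - Y r0 + (a + b * P r0) * (1 - Y r0)) / r0 + ?dg * (2 * D 1 r0 * D 2 r0 * a / b) =
          (P r0 - (1 - g (P r0)) + (a + b * P r0) * g (P r0)
            + ?dg * (2 * P r0 * (a + b * P r0) * g (P r0) / (1 - g (P r0)))) / r0"
          unfolding P'[OF r0(1) Ypos] Yg(1) unfolding Yg(2) by (simp add: add_divide_distrib diff_divide_distrib)
        then show ?thesis using barrier_crossing[of "P r0"] P0 P1 r0(1) by simp
      qed
      ultimately obtain e where e: "e > 0" "\<And>h. \<lbrakk>0 < h; h < e\<rbrakk> \<Longrightarrow> B (r0 - h) < B r0"
        using DERIV_pos_inc_left by blast
      define h where "h = min (e / 2) (r0 / 2)"
      have "B (r0 - h) < B r0" using e r0 by (intro e(2)) (auto simp: h_def)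
      moreover have "B (r0 - h) > 0" using e r0 by (intro good(2)) (auto simp: h_def)
      ultimately show False using \<open>B r0 = 0\<close> by simp
    qed
    have "G r0 > 0" using P1 Y1 B1 by (simp add: G_def)
    then show False using r0(2) GG1[of r0] by simp
  qed
  have "P r < 1" "Y r < 1" "1 - Y r < g (P r)"
    using Ecut[OF r] by (auto simp: G_def B_def barrier_fun_def)
  then show "(D 1 r)\<^sup>2 * a / b < 1" "D 0 r * D 1 r / r * a / b < 1"
    "1 - D 0 r * D 1 r / r * a / b < g ((D 1 r)\<^sup>2 * a / b)"
    by (simp_all add: P_def Y_def)
qed

section \<open>Perturbation of the sign conditions\<close>

text \<open>The margin \<open>\<epsilon> * P\<close> degenerates as P tends to 0, so every error
  must be made proportional to p. A change of the weight v of \<open>Y q\<close> has no such factor;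
  it is handled by multiplying the whole base inequality by the new weight and charging the
  difference to the term that carries p.\<close>

lemma affine_perturbation:
  fixes X0 Z Y g :: "real \<Rightarrow> real"
  assumes bnd: "\<And>q. 0 \<le> q \<Longrightarrow> q \<le> 1 \<Longrightarrow> \<bar>X0 q\<bar> \<le> M \<and> 0 \<le> Z q \<and> Z q \<le> M \<and> 0 \<le> Y q"
    and g: "\<And>P. 0 \<le> P \<Longrightarrow> P \<le> 1 \<Longrightarrow> 0 \<le> g P \<and> g P \<le> 1"
    and lip: "\<And>P P'. \<lbrakk>0 \<le> P; P \<le> 1; 0 \<le> P'; P' \<le> 1\<rbrakk> \<Longrightarrow> g P \<le> g P' + Lg * \<bar>P - P'\<bar>"
    and a: "a > 0" and \<kappa>: "\<kappa> \<ge> 0" and Lg: "Lg \<ge> 0" and \<epsilon>: "\<epsilon> > 0"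
    and base: "\<And>P q. \<lbrakk>0 < P; P \<le> 1; 0 \<le> q; q \<le> 1\<rbrakk> \<Longrightarrow> a * P * (X0 q - \<kappa> * g P * Z q) + Y q \<ge> \<epsilon> * P"
  shows "\<exists>\<eta>>0. \<forall>P0 p v k q. 0 \<le> P0 \<longrightarrow> P0 \<le> 1 \<longrightarrow> 0 \<le> p \<longrightarrow> \<bar>p - a * P0\<bar> \<le> \<eta> \<longrightarrow>
      \<bar>v - 1\<bar> \<le> \<eta> \<longrightarrow> k \<le> \<kappa> * g P0 + \<eta> \<longrightarrow> 0 \<le> q \<longrightarrow> q \<le> 1 \<longrightarrow>
      p * (X0 q - k * Z q) + v * Y q \<ge> 0"
proof -
  have M: "M \<ge> 0" using bnd[of 0] by auto
  define c1 where "c1 = 1 + \<kappa> * Lg / a"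
  define c2 where "c2 = 1 + 1 / a"
  define M2 where "M2 = M + \<kappa> * M"
  have c: "c1 > 0" "c2 > 1" "M2 \<ge> 0" using a \<kappa> Lg M by (auto simp: c1_def c2_def M2_def add_pos_nonneg)
  define c3 where "c3 = c2 * M2 + c1 * M + 1"
  have c3: "c3 > 0" using c M by (auto simp: c3_def intro!: add_nonneg_pos add_nonneg_nonneg)
  define \<eta> where "\<eta> = min (1 / (2 * c2)) (\<epsilon> / (2 * a * c3))"
  have \<eta>: "\<eta> > 0" "c2 * \<eta> \<le> 1/2" "c3 * \<eta> \<le> \<epsilon> / (2 * a)"
  proof -
    show "\<eta> > 0" using c c3 \<epsilon> a by (auto simp: \<eta>_def)
    have "c2 * \<eta> \<le> c2 * (1 / (2 * c2))" using c by (intro mult_left_mono) (auto simp: \<eta>_def)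
    then show "c2 * \<eta> \<le> 1/2" using c by simp
    have "c3 * \<eta> \<le> c3 * (\<epsilon> / (2 * a * c3))" using c3 by (intro mult_left_mono) (auto simp: \<eta>_def)
    then show "c3 * \<eta> \<le> \<epsilon> / (2 * a)" using c3 by simp
  qed
  have \<eta>1: "\<eta> \<le> 1/2" "\<eta> / a \<le> 1 / 2"
  proof -
    have "\<eta> + \<eta> / a \<le> 1/2" using \<eta>(2) by (simp add: c2_def distrib_right)
    moreover have "\<eta> / a > 0" using \<eta>(1) a by simp
    ultimately show "\<eta> \<le> 1/2" "\<eta> / a \<le> 1 / 2" using \<eta>(1) by linarith+
  qed
  show ?thesis
  proof (intro exI[of _ \<eta>] conjI allI impI)
    show "\<eta> > 0" by fact
    fix P0 p v k q :: real
    assume P0: "0 \<le> P0" "P0 \<le> 1" and p0: "0 \<le> p" and pP: "\<bar>p - a * P0\<bar> \<le> \<eta>"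
      and v: "\<bar>v - 1\<bar> \<le> \<eta>" and k: "k \<le> \<kappa> * g P0 + \<eta>" and q: "0 \<le> q" "q \<le> 1"
    have X0: "\<bar>X0 q\<bar> \<le> M" and Z: "0 \<le> Z q" "Z q \<le> M" and Y: "0 \<le> Y q" using bnd[OF q] by auto
    have vpos: "v > 0" using v \<eta>1 by linarith
    show "0 \<le> p * (X0 q - k * Z q) + v * Y q"
    proof (cases "p = 0")
      case True
      then show ?thesis using vpos Y by simp
    next
      case False
      then have p: "p > 0" using p0 by simp
      \<comment> \<open>p may exceed a, and p / a then leaves [0, 1], the range on which g is
        controlled. Truncation costs a factor p1 / p \<ge> 1 - \<eta> / a, which is moved into the
        weight of \<open>Y q\<close>. The base inequality is used at P = p1 / a instead of P0, so
        that its margin is comparable to p1 even if P0 = 0.\<close>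
      define p1 where "p1 = min p a"
      have p1: "p1 > 0" "p1 \<le> p" "p1 \<le> a" using p a by (auto simp: p1_def)
      define P where "P = p1 / a"
      have P: "0 < P" "P \<le> 1" using p1 a by (auto simp: P_def)
      have aP: "a * P = p1" using a by (simp add: P_def)
      have aP0: "a * P0 \<le> a" using P0 a by (simp add: mult_left_le)
      have "\<bar>p1 - a * P0\<bar> \<le> \<eta>" using pP aP0 by (auto simp: p1_def)
      then have "\<bar>a * (P0 - P)\<bar> \<le> \<eta>" by (simp add: right_diff_distrib aP abs_minus_commute)
      then have dP: "\<bar>P0 - P\<bar> \<le> \<eta> / a" using a by (simp only: abs_mult abs_of_pos pos_le_divide_eq mult.commute)
      have "g P0 \<le> g P + Lg * (\<eta> / a)"
        using lip[of P0 P] P0 P mult_left_mono[OF dP Lg] by simp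
      then have "\<kappa> * g P0 \<le> \<kappa> * g P + \<kappa> * Lg / a * \<eta>"
        using mult_left_mono[of _ _ \<kappa>] \<kappa> by (fastforce simp: algebra_simps)
      then have k1: "k \<le> \<kappa> * g P + c1 * \<eta>" using k by (simp add: c1_def algebra_simps)
      define X where "X = X0 q - \<kappa> * g P * Z q"
      have "k * Z q \<le> \<kappa> * g P * Z q + c1 * \<eta> * M"
      proof -
        have "k * Z q \<le> (\<kappa> * g P + c1 * \<eta>) * Z q" using k1 Z by (intro mult_right_mono) auto
        also have "\<dots> \<le> \<kappa> * g P * Z q + c1 * \<eta> * M"
          using c \<eta> Z by (simp add: distrib_right mult_left_mono)
        finally show ?thesis .
      qed
      then have Xk: "X0 q - k * Z q \<ge> X - c1 * \<eta> * M" by (simp add: X_def)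
      have XM: "\<bar>X\<bar> \<le> M2"
      proof -
        have "g P * Z q \<le> 1 * M" using g[of P] P Z by (intro mult_mono) auto
        moreover have "g P * Z q \<ge> 0" using g[of P] P Z by simp
        ultimately have "\<bar>\<kappa> * (g P * Z q)\<bar> \<le> \<kappa> * M" using \<kappa> by (simp add: abs_mult mult_left_mono)
        then show ?thesis using X0 unfolding X_def M2_def by (simp add: mult.assoc)
      qed
      have b: "p1 * X + Y q \<ge> \<epsilon> * P" using base[of P q] P q by (simp add: aP X_def)
      define v' where "v' = v * (p1 / p)"
      have ratio: "1 - \<eta> / a \<le> p1 / p" "p1 / p \<le> 1"
      proof -
        show "p1 / p \<le> 1" using p p1 by simp
        show "1 - \<eta> / a \<le> p1 / p"
        proof (cases "p \<le> a")
          case True then show ?thesis using p \<eta> a by (simp add: p1_def)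
        next
          case False
          then have "p - p1 \<le> \<eta>" using pP aP0 by (auto simp: p1_def)
          then have "(p - p1) / p \<le> \<eta> / a" using False a \<eta> p by (intro frac_le) auto
          then show ?thesis using p by (simp add: diff_divide_distrib)
        qed
      qed
      have v1: "\<bar>1 - v'\<bar> \<le> c2 * \<eta>"
      proof -
        have "v' \<le> v * 1" unfolding v'_def using ratio vpos by (intro mult_left_mono) auto
        moreover have "v' \<ge> (1 - \<eta>) * (1 - \<eta> / a)"
          unfolding v'_def
        proof (rule mult_mono)
          show "0 \<le> 1 - \<eta> / a" using \<eta>1 by linarith
        qed (use ratio v vpos in auto)
        moreover have "(1 - \<eta>) * (1 - \<eta> / a) \<ge> 1 - c2 * \<eta>"
          using \<eta> a by (simp add: c2_def field_simps)
        moreover have "c2 * \<eta> \<ge> \<eta>" using c \<eta> by simp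
        ultimately show ?thesis using v by linarith
      qed
      have v2: "v' \<ge> 1/2" using v1 \<eta>(2) by linarith
      \<comment> \<open>The first summand keeps half of the margin; the other two carry the factor
        p1, and \<open>\<eta>\<close> is chosen so that together they use up at most that
        half.\<close>
      have "p1 * (X - c1 * \<eta> * M) + v' * Y q = v' * (p1 * X + Y q) + (1 - v') * (p1 * X) - p1 * (c1 * \<eta> * M)"
        by (simp add: algebra_simps)
      moreover have "v' * (p1 * X + Y q) \<ge> 1/2 * (\<epsilon> * P)"
        using v2 b \<epsilon> P by (intro mult_mono) auto
      moreover have "(1 - v') * (p1 * X) \<ge> - (p1 * (c2 * \<eta> * M2))"
      proof -
        have "\<bar>(1 - v') * (p1 * X)\<bar> = p1 * (\<bar>1 - v'\<bar> * \<bar>X\<bar>)" using p1 by (simp add: abs_mult)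
        also have "\<dots> \<le> p1 * (c2 * \<eta> * M2)"
          using v1 XM p1 c \<eta> by (intro mult_left_mono mult_mono) auto
        finally show ?thesis by linarith
      qed
      moreover have "p1 * (c2 * \<eta> * M2) + p1 * (c1 * \<eta> * M) \<le> 1/2 * (\<epsilon> * P)"
      proof -
        have "p1 * (c2 * \<eta> * M2) + p1 * (c1 * \<eta> * M) \<le> p1 * (c3 * \<eta>)"
          using p1 \<eta> by (simp add: c3_def algebra_simps)
        also have "\<dots> \<le> p1 * (\<epsilon> / (2 * a))" using \<eta> p1 by (intro mult_left_mono) auto
        also have "\<dots> = 1/2 * (\<epsilon> * P)" using a by (simp add: P_def)
        finally show ?thesis .
      qed
      ultimately have "p1 * (X - c1 * \<eta> * M) + v' * Y q \<ge> 0" by linarith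
      moreover have "p1 * (X - c1 * \<eta> * M) \<le> p1 * (X0 q - k * Z q)"
        using Xk p1 by (intro mult_left_mono) auto
      ultimately have "p1 * (X0 q - k * Z q) + v' * Y q \<ge> 0" by linarith
      then have "p / p1 * (p1 * (X0 q - k * Z q) + v' * Y q) \<ge> 0"
        using p p1 by (intro mult_nonneg_nonneg) auto
      moreover have "p / p1 * (p1 * (X0 q - k * Z q) + v' * Y q) = p * (X0 q - k * Z q) + v * Y q"
        using p p1 by (simp add: v'_def field_simps)
      ultimately show ?thesis by simp
    qed
  qed
qed

text \<open>
  Here \<open>u\<close> is close in \<open>C\<^sup>2\<close> to a radial solution \<open>\<psi>\<close> of the minimal surface equation; \<open>k\<close> is its
  curvature term \<open>\<psi>\<psi>''/(1 + \<psi>'\<^sup>2)\<close>, \<open>p = |Du|\<^sup>2\<close>, \<open>p0 = \<psi>'\<^sup>2\<close>, and \<open>s = Df \<cdot> Du\<close> is eliminated by means of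
  the minimality of \<open>u\<close>, so that no bound on \<open>Df\<close> enters.
\<close>

lemma J_upper_bound:
  fixes m N0 Kb Pb A \<eta> :: real
  assumes m: "m \<ge> 1" and b: "N0 \<ge> 0" "Kb \<ge> 0" "Pb \<ge> 0" "A \<ge> 0" and \<eta>: "\<eta> > 0"
  shows "\<exists>\<epsilon>>0. \<forall>\<psi> u k p0 p f q L s \<psi>2 c. \<psi> > 0 \<longrightarrow> u > 0 \<longrightarrow> f > 0 \<longrightarrow> 0 \<le> k \<longrightarrow> k \<le> Kb \<longrightarrow> 0 \<le> p0 \<longrightarrow> p0 \<le> Pb \<longrightarrow> 0 \<le> p \<longrightarrow>
      \<bar>u - \<psi>\<bar> \<le> \<epsilon> * \<psi> \<longrightarrow> \<bar>p - p0\<bar> \<le> A * \<epsilon> \<longrightarrow> \<bar>f - 1\<bar> \<le> \<epsilon> \<longrightarrow>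
      \<psi> * \<psi>2 = k * (1 + p0) \<longrightarrow> \<psi> * (\<psi>2 + c) = m - 1 + k * p0 \<longrightarrow>
      q \<le> p * (\<psi>2 + \<epsilon> / \<psi>) \<longrightarrow> L \<ge> \<psi>2 + c - N0 * (\<epsilon> / \<psi>) \<longrightarrow>
      1/2 * (m + inverse (1 + f * p)) * s = - f * L + f\<^sup>2 / (1 + f * p) * q + (m - 1) / u \<longrightarrow>
      (u * q + p * (u * s / (2 * f))) * f / (1 + f * p) \<le> p * (k + \<eta>)"
proof -
  define \<eta>1 where "\<eta>1 = \<eta> / (1 + 2 * (Pb + 2))"
  have \<eta>1: "\<eta>1 > 0" "\<eta>1 + 2 * (Pb + 2) * \<eta>1 = \<eta>"
  proof -
    have d: "1 + 2 * (Pb + 2) > 0" using b by (intro add_pos_nonneg mult_nonneg_nonneg) auto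
    show "\<eta>1 > 0" using \<eta> d by (simp add: \<eta>1_def)
    have "\<eta>1 * (1 + 2 * (Pb + 2)) = \<eta>" using d unfolding \<eta>1_def by (intro nonzero_eq_divide_eq[THEN iffD1]) auto
    then show "\<eta>1 + 2 * (Pb + 2) * \<eta>1 = \<eta>" by (simp add: algebra_simps)
  qed
  define B where "B = A + 2"
  define c1 where "c1 = Kb * (1 + Pb) + 2 + Kb * B"
  define c2 where "c2 = (m - 1) + Kb * Pb + 2 * N0 + Kb * A + 2 * (m - 1) + 1"
  have c: "B \<ge> 2" "c1 > 0" "c2 > 0" "B \<ge> A"
  proof -
    show B2: "B \<ge> 2" "B \<ge> A" using b by (auto simp: B_def)
    have "Kb * (1 + Pb) \<ge> 0" "Kb * B \<ge> 0" "Kb * Pb \<ge> 0" "Kb * A \<ge> 0"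
      using b B2 by (auto intro!: mult_nonneg_nonneg)
    moreover have "c2 = 3 * m + 2 * N0 + Kb * Pb + Kb * A - 2"
      by (simp add: c2_def algebra_simps)
    ultimately show "c1 > 0" "c2 > 0" using b(1) m unfolding c1_def by linarith+
  qed
  define \<epsilon> where "\<epsilon> = min (1 / (2 * B)) (min (\<eta>1 / (2 * c1)) (\<eta>1 / c2))"
  have \<epsilon>: "\<epsilon> > 0" "B * \<epsilon> \<le> 1/2" "c1 * \<epsilon> \<le> \<eta>1 / 2" "c2 * \<epsilon> \<le> \<eta>1"
  proof -
    show "\<epsilon> > 0" using c \<eta>1 by (auto simp: \<epsilon>_def)
    have "B * \<epsilon> \<le> B * (1 / (2 * B))" using c by (intro mult_left_mono) (auto simp: \<epsilon>_def)
    then show "B * \<epsilon> \<le> 1/2" using c by simp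
    have "c1 * \<epsilon> \<le> c1 * (\<eta>1 / (2 * c1))" using c by (intro mult_left_mono) (auto simp: \<epsilon>_def)
    then show "c1 * \<epsilon> \<le> \<eta>1 / 2" using c by simp
    have "c2 * \<epsilon> \<le> c2 * (\<eta>1 / c2)" using c by (intro mult_left_mono) (auto simp: \<epsilon>_def)
    then show "c2 * \<epsilon> \<le> \<eta>1" using c by simp
  qed
  have \<epsilon>4: "\<epsilon> \<le> 1/4" using \<epsilon>(2) mult_right_mono[OF c(1), of \<epsilon>] \<epsilon>(1) by linarith
  show ?thesis
  proof (intro exI[of _ \<epsilon>] conjI allI impI)
    show "\<epsilon> > 0" by fact
    fix \<psi> u k p0 p f q L s \<psi>2 c0 :: real
    assume \<psi>: "\<psi> > 0" and u: "u > 0" and f: "f > 0" and k: "0 \<le> k" "k \<le> Kb"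
      and p0: "0 \<le> p0" "p0 \<le> Pb" and p: "0 \<le> p" and u\<psi>: "\<bar>u - \<psi>\<bar> \<le> \<epsilon> * \<psi>"
      and pp0: "\<bar>p - p0\<bar> \<le> A * \<epsilon>" and f1: "\<bar>f - 1\<bar> \<le> \<epsilon>"
      and ode1: "\<psi> * \<psi>2 = k * (1 + p0)" and ode2: "\<psi> * (\<psi>2 + c0) = m - 1 + k * p0"
      and q: "q \<le> p * (\<psi>2 + \<epsilon> / \<psi>)" and L: "L \<ge> \<psi>2 + c0 - N0 * (\<epsilon> / \<psi>)"
      and min: "1/2 * (m + inverse (1 + f * p)) * s = - f * L + f\<^sup>2 / (1 + f * p) * q + (m - 1) / u"
    define U where "U = u / \<psi>"
    have U: "1 - \<epsilon> \<le> U" "U \<le> 1 + \<epsilon>" using u\<psi> \<psi> by (auto simp: U_def field_simps abs_le_iff)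
    have U2: "0 \<le> U" "U \<le> 2" using U \<epsilon>4 by auto
    have uU: "u = U * \<psi>" using \<psi> by (simp add: U_def)
    define v where "v = 1 / f"
    have v: "\<bar>v - 1\<bar> \<le> 2 * \<epsilon>" "v > 0"
    proof -
      show "v > 0" using f by (simp add: v_def)
      have f12: "f \<ge> 1/2" using f1 \<epsilon>4 by linarith
      have "\<bar>v - 1\<bar> = \<bar>f - 1\<bar> / f" using f by (simp add: v_def divide_simps abs_if)
      also have "\<dots> \<le> \<epsilon> / (1/2)" using f1 f12 \<epsilon> by (intro frac_le) auto
      finally show "\<bar>v - 1\<bar> \<le> 2 * \<epsilon>" by simp
    qed
    \<comment> \<open>Since \<phi> = 1 / (v + p), the bound \<phi> K2 \<le> k + \<eta>1 becomes a
      product estimate. For the exact solution, where v = 1 and p = p0, it is the equality K2 = k (1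
      + p0).\<close>
    define \<phi> where "\<phi> = f / (1 + f * p)"
    have N: "1 + f * p > 0" using f p by (auto intro: add_pos_nonneg)
    have \<phi>v: "\<phi> * (v + p) = 1" 
  proof -
      have "v + p = (1 + f * p) / f" using f by (simp add: v_def field_simps)
      then show ?thesis using f N by (simp add: \<phi>_def)
    qed
    have \<phi>: "\<phi> > 0" using f N by (simp add: \<phi>_def)
    have vp: "v + p \<ge> 1 + p0 - B * \<epsilon>" using v pp0 by (simp add: B_def algebra_simps abs_le_iff)
    then have vp2: "v + p \<ge> 1/2" using \<epsilon>(2) p0 by linarith
    have \<phi>2: "\<phi> \<le> 2"
    proof -
      have "\<phi> * (1/2) \<le> \<phi> * (v + p)" using vp2 \<phi> by (intro mult_left_mono) auto
      then show ?thesis using \<phi>v by simp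
    qed
    define K2 where "K2 = U * (k * (1 + p0) + \<epsilon>)"
    have uq: "u * q \<le> p * K2"
    proof -
      have "u * q \<le> u * (p * (\<psi>2 + \<epsilon> / \<psi>))" using q u by (intro mult_left_mono) auto
      also have "\<dots> = p * (U * (\<psi> * \<psi>2 + \<epsilon>))" using \<psi> by (simp add: uU field_simps)
      finally show ?thesis by (simp add: K2_def ode1)
    qed
    have kp: "k * (1 + p0) \<le> Kb * (1 + Pb)" "0 \<le> k * (1 + p0)" "k * p0 \<le> Kb * Pb" "0 \<le> k * p0"
      using k p0 b by (auto intro!: mult_mono)
    have K2: "K2 \<le> (k + \<eta>1) * (v + p)"
    proof -
      have "K2 \<le> (1 + \<epsilon>) * (k * (1 + p0)) + 2 * \<epsilon>"
        unfolding K2_def distrib_left[of U] using U U2 kp \<epsilon> by (intro add_mono mult_right_mono) auto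
      also have "\<dots> \<le> k * (1 + p0) + (Kb * (1 + Pb) + 2) * \<epsilon>"
        using mult_right_mono[OF kp(1), of \<epsilon>] \<epsilon> by (simp add: algebra_simps)
      also have "\<dots> = k * (1 + p0) + c1 * \<epsilon> - Kb * (B * \<epsilon>)" by (simp add: c1_def algebra_simps)
      also have "\<dots> \<le> k * (1 + p0) + \<eta>1 / 2 - Kb * (B * \<epsilon>)" using \<epsilon> by simp
      also have "\<dots> \<le> k * (1 + p0) + \<eta>1 / 2 - k * (B * \<epsilon>)"
        using k \<epsilon> c by (simp add: mult_right_mono)
      also have "\<dots> \<le> (k + \<eta>1) * (1 + p0 - B * \<epsilon>)"
      proof -
        have "\<eta>1 * (1/2) \<le> \<eta>1 * (1 + p0 - B * \<epsilon>)" using \<eta>1 \<epsilon>(2) p0 by (intro mult_left_mono) auto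
        then show ?thesis by (simp add: algebra_simps)
      qed
      also have "\<dots> \<le> (k + \<eta>1) * (v + p)" using vp k \<eta>1 by (intro mult_left_mono) auto
      finally show ?thesis .
    qed
    have \<phi>K2: "\<phi> * K2 \<le> k + \<eta>1"
    proof -
      have "\<phi> * K2 \<le> \<phi> * ((k + \<eta>1) * (v + p))" using K2 \<phi> by (intro mult_left_mono) auto
      also have "\<dots> = (k + \<eta>1) * (\<phi> * (v + p))" by simp
      finally show ?thesis by (simp add: \<phi>v)
    qed
    \<comment> \<open>For the exact radial solution with f = 1 the right-hand side of
      \<open>S_eq\<close> is -(m - 1 + k p0) + k p0 + (m - 1) = 0, so only error terms contribute to
      the upper bound of \<open>S\<close>.\<close>
    define S where "S = u * s / (2 * f)"
    have S_eq: "S * (m + inverse (1 + f * p)) = - (u * L) + \<phi> * (u * q) + (m - 1) * v"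
    proof -
      have "S * (m + inverse (1 + f * p)) = u / f * (1/2 * (m + inverse (1 + f * p)) * s)"
        by (simp add: S_def mult.commute mult.left_commute)
      also have "\<dots> = - (u * L) + \<phi> * (u * q) + (m - 1) * v"
        unfolding min using f u by (simp add: \<phi>_def v_def field_simps power2_eq_square)
      finally show ?thesis .
    qed
    have uL: "u * L \<ge> (1 - \<epsilon>) * (m - 1 + k * p0) - 2 * N0 * \<epsilon>"
    proof -
      have "u * L \<ge> u * (\<psi>2 + c0 - N0 * (\<epsilon> / \<psi>))" using L u by (intro mult_left_mono) auto
      moreover have "u * (\<psi>2 + c0 - N0 * (\<epsilon> / \<psi>)) = U * (m - 1 + k * p0) - U * (N0 * \<epsilon>)"
        unfolding ode2[symmetric] using \<psi> by (simp add: uU field_simps)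
      moreover have "U * (m - 1 + k * p0) \<ge> (1 - \<epsilon>) * (m - 1 + k * p0)"
        using U m kp by (intro mult_right_mono) auto
      moreover have "U * (N0 * \<epsilon>) \<le> 2 * (N0 * \<epsilon>)" using U2 b \<epsilon> by (intro mult_right_mono) auto
      ultimately show ?thesis by simp
    qed
    have pq: "\<phi> * (u * q) \<le> p * (k + \<eta>1)"
    proof -
      have "\<phi> * (u * q) \<le> \<phi> * (p * K2)" using uq \<phi> by (intro mult_left_mono) auto
      also have "\<dots> = p * (\<phi> * K2)" by simp
      also have "\<dots> \<le> p * (k + \<eta>1)" using \<phi>K2 p by (intro mult_left_mono) auto
      finally show ?thesis .
    qed
    have pk: "p * (k + \<eta>1) \<le> k * p0 + Kb * A * \<epsilon> + (Pb + 1) * \<eta>1"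
    proof -
      have pA: "p \<le> p0 + A * \<epsilon>" using pp0 by linarith
      have A1: "A * \<epsilon> \<le> 1" using \<epsilon>(1,2) mult_right_mono[OF c(4), of \<epsilon>] by linarith
      have "p * k \<le> (p0 + A * \<epsilon>) * k" using pA k by (intro mult_right_mono) auto
      moreover have "A * \<epsilon> * k \<le> A * \<epsilon> * Kb" using k b \<epsilon> by (intro mult_left_mono) auto
      moreover have "p * \<eta>1 \<le> (Pb + 1) * \<eta>1" using pA A1 p0 \<eta>1 by (intro mult_right_mono) auto
      ultimately show ?thesis by (simp add: algebra_simps)
    qed
    have "(m - 1) * v \<le> (m - 1) * (1 + 2 * \<epsilon>)" using v m by (intro mult_left_mono) (auto simp: abs_le_iff)
    then have "S * (m + inverse (1 + f * p)) \<le> - ((1 - \<epsilon>) * (m - 1 + k * p0)) + 2 * N0 * \<epsilon>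
        + (k * p0 + Kb * A * \<epsilon> + (Pb + 1) * \<eta>1) + (m - 1) * (1 + 2 * \<epsilon>)"
      unfolding S_eq using uL pq pk by linarith
    also have "\<dots> = \<epsilon> * (m - 1 + k * p0 + 2 * N0 + Kb * A + 2 * (m - 1)) + (Pb + 1) * \<eta>1"
      by (simp add: algebra_simps)
    also have "\<dots> \<le> \<epsilon> * c2 + (Pb + 1) * \<eta>1"
      using kp \<epsilon> by (intro add_mono[OF mult_left_mono order_refl]) (auto simp: c2_def)
    also have "\<dots> \<le> (Pb + 2) * \<eta>1" using \<epsilon>(4) by (simp add: algebra_simps)
    finally have Sb: "S * (m + inverse (1 + f * p)) \<le> (Pb + 2) * \<eta>1" .
    have S: "S \<le> (Pb + 2) * \<eta>1"
    proof (cases "S \<le> 0")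
      case True
      then show ?thesis using b \<eta>1 by (intro order_trans[OF True]) auto
    next
      case False
      have "S * 1 \<le> S * (m + inverse (1 + f * p))"
        using False m N by (intro mult_left_mono) (auto intro: add_increasing2)
      then show ?thesis using Sb by linarith
    qed
    have "(u * q + p * S) * \<phi> \<le> (p * K2 + p * ((Pb + 2) * \<eta>1)) * \<phi>"
      using uq S p \<phi> by (intro mult_right_mono add_mono mult_left_mono) auto
    also have "\<dots> = p * (\<phi> * K2 + \<phi> * ((Pb + 2) * \<eta>1))" by (simp add: algebra_simps)
    also have "\<dots> \<le> p * ((k + \<eta>1) + 2 * ((Pb + 2) * \<eta>1))"
      using \<phi>K2 \<phi>2 b \<eta>1 p by (intro mult_left_mono add_mono mult_right_mono) auto
    also have "\<dots> = p * (k + \<eta>)" unfolding \<eta>1(2)[symmetric] by (simp add: algebra_simps)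
    finally show "(u * q + p * (u * s / (2 * f))) * f / (1 + f * p) \<le> p * (k + \<eta>)"
      by (simp add: S_def \<phi>_def)
  qed
qed

text \<open>
  Subtracting the equation of the minimal hypersurface, which is the case \<open>t = u\<close>, \<open>\<rho> = 1\<close>, exhibits the
  zero of the divergence at \<open>t = u\<close> in every summand of the right-hand side.
\<close>

lemma minimal_substitution:
  fixes m s L q u f p t \<rho> r' :: real
  assumes min: "1/2 * (m + inverse (1 + f * p)) * s = - f * L + f\<^sup>2 / (1 + f * p) * q + (m - 1) / u"
    and pos: "f > 0" "p \<ge> 0" "u > 0" "t > 0"
    and J: "J = (u * q + p * (u * s / (2 * f))) * f / (1 + f * p)"
  shows "f * u * ((p + \<rho>\<^sup>2 / f) * (m * s / (2 * f) + L - (m - 1) * \<rho> / (f * t)) - q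
      + \<rho>\<^sup>2 * s / (2 * f\<^sup>2) + p * r' * (\<rho> * t / u - 1) / (f * u)) =
    (m - 1) * (p + \<rho>\<^sup>2 / f) * (1 - \<rho> * u / t) + (\<rho>\<^sup>2 - 1) * J + p * r' * (\<rho> * t / u - 1)"
proof -
  define N where "N = 1 + f * p"
  have N: "N > 0" using pos by (auto simp: N_def intro: add_pos_nonneg)
  have p: "p = (N - 1) / f" using pos by (simp add: N_def)
  have L: "L = (f\<^sup>2 / N * q + (m - 1) / u - 1/2 * (m + 1 / N) * s) / f"
    using min pos by (simp add: N_def field_simps)
  show ?thesis
    unfolding J L N_def[symmetric] unfolding p
    using N pos by (simp add: field_simps power2_eq_square)
qed

section \<open>Signs of the reduced divergence on the two branches\<close>

text \<open>The coefficient of p in the divided numerator, with k an upper bound of J / p. Inserting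
  k = b g P, subtracting the margin 1/10, scaling by a / b and clearing the denominator of g
  produces \<open>inner_poly\<close>, and likewise \<open>outer_poly\<close> from
  \<open>outer_lin\<close>.\<close>

definition inner_lin :: "real \<Rightarrow> real \<Rightarrow> real \<Rightarrow> real \<Rightarrow> real" where
  "inner_lin m d k q = (m - 1) * d * (d + 2 - d * q)\<^sup>2 - k * (((d + 2)\<^sup>2 - d\<^sup>2 * q) * (d + 2 - d * q))
     - 2 * (d + 2) * (d + 2 + d * q)"

definition outer_lin :: "real \<Rightarrow> real \<Rightarrow> real \<Rightarrow> real \<Rightarrow> real" where
  "outer_lin m d k q = 4 * d * (m - 1) * q - k * (2 * ((d + 2)\<^sup>2 - d\<^sup>2 * q))
     - 2 * (d + 2) * (d + 2 + d * q)"

lemma inner_factor_nonneg: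
  fixes d q :: real
  assumes "d > 0" "0 \<le> q" "q \<le> 1"
  shows "0 < d + 2 - d * q" "0 < (d + 2)\<^sup>2 - d\<^sup>2 * q"
proof -
  have "d * q \<le> d" "d\<^sup>2 * q \<le> d\<^sup>2" using assms by (auto simp: mult_left_le)
  moreover have "(d + 2)\<^sup>2 = d\<^sup>2 + 4 * d + 4" by (simp add: power2_eq_square algebra_simps)
  ultimately show "0 < d + 2 - d * q" "0 < (d + 2)\<^sup>2 - d\<^sup>2 * q"
    using assms(1) by linarith+
qed

text \<open>With q = \<theta>^2, each of 1 - \<rho> / \<theta>, \<rho>^2 - 1 and \<rho> \<theta> - 1
  contains the factor 1 - q, and once (1 - q) / D^3 is removed the rest is affine in p and v. Since
  \<rho> \<le> 1 on this branch, an upper bound of J is what a lower bound of the sum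
  requires.\<close>

lemma inner_sign:
  fixes m d p v \<theta> \<rho> r' J k :: real
  assumes d: "d > 0" and \<theta>: "0 < \<theta>" "\<theta> \<le> 1"
    and \<rho>: "\<rho> = 2 * \<theta> / (d + 2 - d * \<theta>\<^sup>2)" and r': "r' = 2 * (d + 2 + d * \<theta>\<^sup>2) / (d + 2 - d * \<theta>\<^sup>2)\<^sup>2"
    and J: "J \<le> p * k"
    and lin: "p * inner_lin m d k (\<theta>\<^sup>2) + v * (4 * d * (m - 1) * \<theta>\<^sup>2) \<ge> 0"
  shows "(m - 1) * (p + \<rho>\<^sup>2 * v) * (1 - \<rho> / \<theta>) + (\<rho>\<^sup>2 - 1) * J + p * r' * (\<rho> * \<theta> - 1) \<ge> 0"
proof -
  define q where "q = \<theta>\<^sup>2"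
  have q: "0 < q" "q \<le> 1" using \<theta> by (auto simp: q_def power_le_one)
  define D where "D = d + 2 - d * q"
  have D: "D > 0" and Z: "0 < (d + 2)\<^sup>2 - d\<^sup>2 * q"
    using inner_factor_nonneg[of d q] d q by (auto simp: D_def)
  have \<rho>2: "\<rho>\<^sup>2 = 4 * q / D\<^sup>2" unfolding \<rho> D_def q_def by (simp add: power_divide power_mult_distrib)
  have 1: "1 - \<rho> / \<theta> = d * (1 - q) / D" 
  proof -
    have "\<rho> / \<theta> = 2 / D" using \<theta> unfolding \<rho> D_def q_def by simp
    then show ?thesis using D by (simp add: field_simps) (simp add: D_def algebra_simps)
  qed
  have 2: "\<rho>\<^sup>2 - 1 = - ((1 - q) * ((d + 2)\<^sup>2 - d\<^sup>2 * q) / D\<^sup>2)"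
  proof -
    have "4 * q - D\<^sup>2 = - ((1 - q) * ((d + 2)\<^sup>2 - d\<^sup>2 * q))"
      unfolding D_def by (simp add: power2_eq_square algebra_simps)
    moreover have "\<rho>\<^sup>2 - 1 = (4 * q - D\<^sup>2) / D\<^sup>2"
      unfolding \<rho>2 using D by (simp add: diff_divide_distrib)
    ultimately show ?thesis by simp
  qed
  have 3: "\<rho> * \<theta> - 1 = - ((d + 2) * (1 - q) / D)"
  proof -
    have "\<rho> * \<theta> = 2 * q / D" unfolding \<rho> D_def q_def by (simp add: power2_eq_square)
    then show ?thesis using D by (simp add: field_simps) (simp add: D_def algebra_simps)
  qed
  have "(\<rho>\<^sup>2 - 1) * J \<ge> (\<rho>\<^sup>2 - 1) * (p * k)"
    unfolding 2 using J q Z by (intro mult_left_mono_neg) auto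
  moreover have "(m - 1) * (p + \<rho>\<^sup>2 * v) * (1 - \<rho> / \<theta>) + (\<rho>\<^sup>2 - 1) * (p * k) + p * r' * (\<rho> * \<theta> - 1)
    = (1 - q) / D ^ 3 * (p * inner_lin m d k q + v * (4 * d * (m - 1) * q))"
    unfolding 1 2 3 unfolding \<rho>2 r' q_def[symmetric] D_def[symmetric] inner_lin_def
    using D by (simp add: field_simps power2_eq_square power3_eq_cube)
  moreover have "\<dots> \<ge> 0" using q D lin by (intro mult_nonneg_nonneg) (auto simp: q_def)
  ultimately show ?thesis by linarith
qed

text \<open>With q = 1 / \<theta>^2 the same factors 1 - q and (d + 2)^2 - d^2 q appear as for the
  inner branch. Now \<rho> \<ge> 1, and the required sign is reversed as well, so the same upper
  bound of J serves both branches.\<close>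

lemma outer_sign:
  fixes m d p v \<theta> \<rho> r' J k :: real
  assumes d: "d > 0" and \<theta>: "1 \<le> \<theta>"
    and \<rho>: "\<rho> = ((d + 2) * \<theta>\<^sup>2 - d) / (2 * \<theta>)" and r': "r' = ((d + 2) + d / \<theta>\<^sup>2) / 2"
    and J: "J \<le> p * k"
    and lin: "p * outer_lin m d k (1 / \<theta>\<^sup>2) + v * (d * (m - 1) * (d + 2 - d / \<theta>\<^sup>2)\<^sup>2) \<ge> 0"
  shows "(m - 1) * (p + \<rho>\<^sup>2 * v) * (1 - \<rho> / \<theta>) + (\<rho>\<^sup>2 - 1) * J + p * r' * (\<rho> * \<theta> - 1) \<le> 0"
proof -
  define q where "q = 1 / \<theta>\<^sup>2"
  have q: "0 < q" "q \<le> 1" using \<theta> by (auto simp: q_def)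
  define D where "D = d + 2 - d * q"
  have D: "D > 0" and Z: "0 < (d + 2)\<^sup>2 - d\<^sup>2 * q"
    using inner_factor_nonneg[of d q] d q by (auto simp: D_def)
  have \<theta>2: "\<theta>\<^sup>2 = 1 / q" by (simp add: q_def)
  have \<rho>\<theta>: "\<rho> = \<theta> * D / 2" using \<theta> unfolding \<rho> D_def q_def by (simp add: field_simps power2_eq_square)
  have \<rho>2: "\<rho>\<^sup>2 = D\<^sup>2 / (4 * q)" unfolding \<rho>\<theta> by (simp add: power_divide power_mult_distrib \<theta>2)
  have 1: "1 - \<rho> / \<theta> = - (d * (1 - q) / 2)" 
  proof -
    have "\<rho> / \<theta> = D / 2" using \<theta> unfolding \<rho>\<theta> by simp
    then show ?thesis by (simp add: D_def field_simps)
  qed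
  have 2: "\<rho>\<^sup>2 - 1 = (1 - q) * ((d + 2)\<^sup>2 - d\<^sup>2 * q) / (4 * q)"
  proof -
    have "D\<^sup>2 - 4 * q = (1 - q) * ((d + 2)\<^sup>2 - d\<^sup>2 * q)"
      unfolding D_def by (simp add: power2_eq_square algebra_simps)
    then show ?thesis unfolding \<rho>2 using q by (simp add: field_simps)
  qed
  have 3: "\<rho> * \<theta> - 1 = (d + 2) * (1 - q) / (2 * q)"
  proof -
    have "\<rho> * \<theta> = \<theta>\<^sup>2 * D / 2" unfolding \<rho>\<theta> by (simp add: power2_eq_square)
    then show ?thesis unfolding \<theta>2 using q by (simp add: D_def field_simps)
  qed
  have r'q: "r' = ((d + 2) + d * q) / 2" unfolding r' q_def by simp
  have "(\<rho>\<^sup>2 - 1) * J \<le> (\<rho>\<^sup>2 - 1) * (p * k)"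
    unfolding 2 using J q Z by (intro mult_left_mono) auto
  moreover have "(m - 1) * (p + \<rho>\<^sup>2 * v) * (1 - \<rho> / \<theta>) + (\<rho>\<^sup>2 - 1) * (p * k) + p * r' * (\<rho> * \<theta> - 1)
    = - ((1 - q) / (8 * q) * (p * outer_lin m d k q + v * (d * (m - 1) * D\<^sup>2)))"
    unfolding 1 2 3 unfolding \<rho>2 r'q outer_lin_def
    using q by (simp add: field_simps power2_eq_square power3_eq_cube)
  moreover have "(1 - q) / (8 * q) * (p * outer_lin m d k q + v * (d * (m - 1) * D\<^sup>2)) \<ge> 0"
    using q D lin by (intro mult_nonneg_nonneg) (auto simp: q_def D_def)
  ultimately show ?thesis by linarith
qed

text \<open>
  \<open>div_expr\<close> is a positive multiple of the divergence, and the ratio \<open>\<rho> = - E\<^sub>t / E\<^sub>u\<close> of the partial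
  derivatives of \<open>E\<close> with respect to \<open>t = |\<xi>|\<close> and \<open>u\<close> depends on \<open>t/u\<close> only.
\<close>

definition div_expr :: "real \<Rightarrow> real \<Rightarrow> real \<Rightarrow> real \<Rightarrow> real \<Rightarrow> real \<Rightarrow> real \<Rightarrow> real \<Rightarrow> real \<Rightarrow> real \<Rightarrow> real" where
  "div_expr m u f p q L s t \<rho> r' =
     (p + \<rho>\<^sup>2 / f) * (m * s / (2 * f) + L - (m - 1) * \<rho> / (f * t)) - q
      + \<rho>\<^sup>2 * s / (2 * f\<^sup>2) + p * r' * (\<rho> * t / u - 1) / (f * u)"

definition inner_ratio :: "real \<Rightarrow> real \<Rightarrow> real" where
  "inner_ratio d \<theta> = 2 * \<theta> / (d + 2 - d * \<theta>\<^sup>2)"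

definition inner_ratio' :: "real \<Rightarrow> real \<Rightarrow> real" where
  "inner_ratio' d \<theta> = 2 * (d + 2 + d * \<theta>\<^sup>2) / (d + 2 - d * \<theta>\<^sup>2)\<^sup>2"

definition outer_ratio :: "real \<Rightarrow> real \<Rightarrow> real" where
  "outer_ratio d \<theta> = ((d + 2) * \<theta>\<^sup>2 - d) / (2 * \<theta>)"

definition outer_ratio' :: "real \<Rightarrow> real \<Rightarrow> real" where
  "outer_ratio' d \<theta> = ((d + 2) + d / \<theta>\<^sup>2) / 2"

lemma (in barrier) scaled_base:
  assumes P: "0 < P" "P \<le> 1" and X: "(A + s * P) * (P * (X0 - 1/10 - b * g P * Z) + a / b * Y) \<ge> 0"
  shows "b / a * P * (X0 - b * g P * Z) + Y \<ge> b / a / 10 * P"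
proof -
  have "P * (X0 - 1/10 - b * g P * Z) + a / b * Y \<ge> 0"
    using X den[of P] P by (simp add: zero_le_mult_iff)
  then have "b / a * (P * (X0 - 1/10 - b * g P * Z) + a / b * Y) \<ge> 0"
    using a b by (intro mult_nonneg_nonneg) auto
  moreover have "b / a * (P * (X0 - 1/10 - b * g P * Z) + a / b * Y) =
      b / a * P * (X0 - b * g P * Z) + Y - b / a / 10 * P"
    using a b by (simp add: field_simps)
  ultimately show ?thesis by linarith
qed

text \<open>The analytic core in terms of numbers at one point: G is |Du|, q is D^2u(Du, Du), L is
  the Laplacian of u, S is Df . Du; the numbers \<psi>, \<psi>1, \<psi>2 and c0 = a \<psi>' / r come
  from the radial model and k is its curvature term. The threshold \<epsilon> is fixed before any of
  them.\<close>

lemma (in barrier) sign_threshold: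
  fixes d N0 :: real
  assumes d: "d > 0" and N0: "N0 \<ge> 0"
    and inner: "\<forall>P q. 0 \<le> P \<longrightarrow> P \<le> 1 \<longrightarrow> 0 \<le> q \<longrightarrow> q \<le> 1 \<longrightarrow> inner_poly a b d c A s P q \<ge> 0"
    and outer: "\<forall>P q. 0 \<le> P \<longrightarrow> P \<le> 1 \<longrightarrow> 0 \<le> q \<longrightarrow> q \<le> 1 \<longrightarrow> outer_poly a b d c A s P q \<ge> 0"
  obtains \<epsilon> where "\<epsilon> > 0" "\<And>\<psi> u k \<psi>1 G f q L S \<psi>2 c0. \<lbrakk>\<psi> > 0;
      u > 0;
      f > 0;
      0 \<le> k;
      \<psi>1\<^sup>2 * a / b \<le> 1;
      k \<le> b * g (\<psi>1\<^sup>2 * a / b);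
      0 \<le> G;
      \<bar>u - \<psi>\<bar> \<le> \<epsilon> * \<psi>;
      \<bar>G - \<bar>\<psi>1\<bar>\<bar> \<le> \<epsilon>;
      \<bar>f - 1\<bar> \<le> \<epsilon>;
      \<psi> * \<psi>2 = k * (1 + \<psi>1\<^sup>2);
      \<psi> * (\<psi>2 + c0) = b + k * \<psi>1\<^sup>2;
      q \<le> G\<^sup>2 * (\<psi>2 + \<epsilon> / \<psi>);
      L \<ge> \<psi>2 + c0 - N0 * (\<epsilon> / \<psi>);
      1/2 * (b + 1 + inverse (1 + f * G\<^sup>2)) * S = - f * L + f\<^sup>2 / (1 + f * G\<^sup>2) * q + b / u\<rbrakk> \<Longrightarrow>
      (\<forall>t. 0 < t \<longrightarrow> t \<le> u \<longrightarrow> div_expr (b + 1) u f (G\<^sup>2) q L S t (inner_ratio d (t / u)) (inner_ratio' d (t / u)) \<ge> 0) \<and>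
      (\<forall>t. u \<le> t \<longrightarrow> div_expr (b + 1) u f (G\<^sup>2) q L S t (outer_ratio d (t / u)) (outer_ratio' d (t / u)) \<le> 0)"
proof -
  define \<alpha>2 where "\<alpha>2 = b / a"
  have \<alpha>2: "\<alpha>2 > 0" using a b by (simp add: \<alpha>2_def)
  obtain Lg where Lg: "Lg \<ge> 0" "\<And>P P'. \<lbrakk>0 \<le> P; P \<le> 1; 0 \<le> P'; P' \<le> 1\<rbrakk> \<Longrightarrow> g P \<le> g P' + Lg * \<bar>P - P'\<bar>"
    using g_lipschitz by blast
  have g1: "0 \<le> g P \<and> g P \<le> 1" if "0 \<le> P" "P \<le> 1" for P using g_bounds[OF that] by simp
  have Db: "0 \<le> d + 2 - d * q \<and> d + 2 - d * q \<le> d + 2" "0 \<le> (d + 2)\<^sup>2 - d\<^sup>2 * q \<and> (d + 2)\<^sup>2 - d\<^sup>2 * q \<le> (d + 2)\<^sup>2"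
    "0 \<le> 2 * (d + 2) * (d + 2 + d * q) \<and> 2 * (d + 2) * (d + 2 + d * q) \<le> 2 * (d + 2) * (d + 2 + d)"
    if "0 \<le> q" "q \<le> 1" for q
    using inner_factor_nonneg[OF d that] d that by (auto intro!: mult_left_mono mult_nonneg_nonneg)
  define Zi where "Zi = (\<lambda>q. ((d + 2)\<^sup>2 - d\<^sup>2 * q) * (d + 2 - d * q))"
  define Xi where "Xi = (\<lambda>q. b * d * (d + 2 - d * q)\<^sup>2 - 2 * (d + 2) * (d + 2 + d * q))"
  define Yi where "Yi = (\<lambda>q. 4 * d * b * q)"
  define Zo where "Zo = (\<lambda>q. 2 * ((d + 2)\<^sup>2 - d\<^sup>2 * q))"
  define Xo where "Xo = (\<lambda>q. 4 * d * b * q - 2 * (d + 2) * (d + 2 + d * q))"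
  define Yo where "Yo = (\<lambda>q. d * b * (d + 2 - d * q)\<^sup>2)"
  define M1 where "M1 = b * d * (d + 2)\<^sup>2 + 4 * d * b + 2 * (d + 2) * (d + 2 + d)"
  define M where "M = M1 + (d + 2)\<^sup>2 * (d + 2) + 2 * (d + 2)\<^sup>2"
  have M1: "M1 \<ge> 0" using b d by (simp add: M1_def)
  have Xb: "\<bar>Xi q\<bar> \<le> M1" "\<bar>Xo q\<bar> \<le> M1" if q: "0 \<le> q" "q \<le> 1" for q
  proof -
    have "0 \<le> b * d * (d + 2 - d * q)\<^sup>2" "b * d * (d + 2 - d * q)\<^sup>2 \<le> b * d * (d + 2)\<^sup>2"
      using b d Db(1)[OF q] by (auto intro!: mult_left_mono power_mono)
    moreover have "0 \<le> 4 * d * b * q" "4 * d * b * q \<le> 4 * d * b" using b d q by (auto simp: mult_left_le)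
    ultimately show "\<bar>Xi q\<bar> \<le> M1" "\<bar>Xo q\<bar> \<le> M1"
      using Db(3)[OF q] unfolding Xi_def Xo_def M1_def by linarith+
  qed
  have sq: "0 \<le> (d + 2)\<^sup>2 * (d + 2)" "0 \<le> 2 * (d + 2)\<^sup>2" using d by auto
  have bi: "\<bar>Xi q\<bar> \<le> M \<and> 0 \<le> Zi q \<and> Zi q \<le> M \<and> 0 \<le> Yi q" if q: "0 \<le> q" "q \<le> 1" for q
  proof -
    have "0 \<le> Zi q" "Zi q \<le> (d + 2)\<^sup>2 * (d + 2)" "0 \<le> Yi q"
      unfolding Zi_def Yi_def using Db(1,2)[OF q] b d q by (auto intro!: mult_mono mult_nonneg_nonneg)
    then show ?thesis using Xb[OF q] M1 sq unfolding M_def by linarith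
  qed
  have bo: "\<bar>Xo q\<bar> \<le> M \<and> 0 \<le> Zo q \<and> Zo q \<le> M \<and> 0 \<le> Yo q" if q: "0 \<le> q" "q \<le> 1" for q
  proof -
    have "0 \<le> Zo q" "Zo q \<le> 2 * (d + 2)\<^sup>2" "0 \<le> Yo q"
      unfolding Zo_def Yo_def using Db(2)[OF q] b d by auto
    then show ?thesis using Xb[OF q] M1 sq unfolding M_def by linarith
  qed
  have basei: "\<alpha>2 * P * (Xi q - b * g P * Zi q) + Yi q \<ge> \<alpha>2 / 10 * P"
    if "0 < P" "P \<le> 1" "0 \<le> q" "q \<le> 1" for P q
    unfolding \<alpha>2_def
  proof (rule scaled_base[OF that(1,2)])
    have E: "A + s * P > 0" using den that by simp
    have "(A + s * P) * (P * (Xi q - 1/10 - b * g P * Zi q) + a / b * Yi q) =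
        P * ((Xi q - 1/10) * (A + s * P) - b * ((A + s * P) * g P) * Zi q) + (a / b * Yi q) * (A + s * P)"
      by (simp add: algebra_simps)
    also have "\<dots> = inner_poly a b d c A s P q"
    proof -
      have 1: "(A + s * P) * g P = c * (1 - P)" using E by (simp add: barrier_fun_def)
      have 2: "a / b * Yi q = 4 * d * a * q" using b by (simp add: Yi_def)
      show ?thesis unfolding 1 2 by (simp add: inner_poly_def Xi_def Zi_def mult.assoc)
    qed
    finally have "(A + s * P) * (P * (Xi q - 1/10 - b * g P * Zi q) + a / b * Yi q) = inner_poly a b d c A s P q" .
    then show "(A + s * P) * (P * (Xi q - 1/10 - b * g P * Zi q) + a / b * Yi q) \<ge> 0"
      using inner[rule_format, of P q] that by simp
  qed
  have baseo: "\<alpha>2 * P * (Xo q - b * g P * Zo q) + Yo q \<ge> \<alpha>2 / 10 * P"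
    if "0 < P" "P \<le> 1" "0 \<le> q" "q \<le> 1" for P q
    unfolding \<alpha>2_def
  proof (rule scaled_base[OF that(1,2)])
    have E: "A + s * P > 0" using den that by simp
    have "(A + s * P) * (P * (Xo q - 1/10 - b * g P * Zo q) + a / b * Yo q) =
        P * ((Xo q - 1/10) * (A + s * P) - b * ((A + s * P) * g P) * Zo q) + (a / b * Yo q) * (A + s * P)"
      by (simp add: algebra_simps)
    also have "\<dots> = outer_poly a b d c A s P q"
    proof -
      have 1: "(A + s * P) * g P = c * (1 - P)" using E by (simp add: barrier_fun_def)
      have 2: "a / b * Yo q = a * d * (d + 2 - d * q)\<^sup>2" using b by (simp add: Yo_def)
      show ?thesis unfolding 1 2 by (simp add: outer_poly_def Xo_def Zo_def mult.assoc)
    qed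
    finally have "(A + s * P) * (P * (Xo q - 1/10 - b * g P * Zo q) + a / b * Yo q) = outer_poly a b d c A s P q" .
    then show "(A + s * P) * (P * (Xo q - 1/10 - b * g P * Zo q) + a / b * Yo q) \<ge> 0"
      using outer[rule_format, of P q] that by simp
  qed
  have pos10: "\<alpha>2 / 10 > 0" using \<alpha>2 by simp
  note b0 = less_imp_le[OF b]
  have "\<exists>\<eta>>0. \<forall>P0 p v k q. 0 \<le> P0 \<longrightarrow> P0 \<le> 1 \<longrightarrow> 0 \<le> p \<longrightarrow> \<bar>p - \<alpha>2 * P0\<bar> \<le> \<eta> \<longrightarrow>
      \<bar>v - 1\<bar> \<le> \<eta> \<longrightarrow> k \<le> b * g P0 + \<eta> \<longrightarrow> 0 \<le> q \<longrightarrow> q \<le> 1 \<longrightarrow>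
      p * (Xi q - k * Zi q) + v * Yi q \<ge> 0"
    by (rule affine_perturbation[where M = M, OF _ _ _ \<alpha>2 b0 Lg(1) pos10]) (use bi g1 Lg(2) basei in blast)+
  then obtain \<eta>i where \<eta>i: "\<eta>i > 0" "\<And>P0 p v k q. \<lbrakk>0 \<le> P0; P0 \<le> 1; 0 \<le> p; \<bar>p - \<alpha>2 * P0\<bar> \<le> \<eta>i; \<bar>v - 1\<bar> \<le> \<eta>i;
      k \<le> b * g P0 + \<eta>i; 0 \<le> q; q \<le> 1\<rbrakk> \<Longrightarrow> p * (Xi q - k * Zi q) + v * Yi q \<ge> 0"
    by blast
  have "\<exists>\<eta>>0. \<forall>P0 p v k q. 0 \<le> P0 \<longrightarrow> P0 \<le> 1 \<longrightarrow> 0 \<le> p \<longrightarrow> \<bar>p - \<alpha>2 * P0\<bar> \<le> \<eta> \<longrightarrow>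
      \<bar>v - 1\<bar> \<le> \<eta> \<longrightarrow> k \<le> b * g P0 + \<eta> \<longrightarrow> 0 \<le> q \<longrightarrow> q \<le> 1 \<longrightarrow>
      p * (Xo q - k * Zo q) + v * Yo q \<ge> 0"
    by (rule affine_perturbation[where M = M, OF _ _ _ \<alpha>2 b0 Lg(1) pos10]) (use bo g1 Lg(2) baseo in blast)+
  then obtain \<eta>o where \<eta>o: "\<eta>o > 0" "\<And>P0 p v k q. \<lbrakk>0 \<le> P0; P0 \<le> 1; 0 \<le> p; \<bar>p - \<alpha>2 * P0\<bar> \<le> \<eta>o; \<bar>v - 1\<bar> \<le> \<eta>o;
      k \<le> b * g P0 + \<eta>o; 0 \<le> q; q \<le> 1\<rbrakk> \<Longrightarrow> p * (Xo q - k * Zo q) + v * Yo q \<ge> 0"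
    by blast
  define \<eta> where "\<eta> = min \<eta>i \<eta>o"
  have \<eta>: "\<eta> > 0" "\<eta> \<le> \<eta>i" "\<eta> \<le> \<eta>o" using \<eta>i \<eta>o by (auto simp: \<eta>_def)
  \<comment> \<open>\<open>B\<close> bounds G + |\<psi>1|, the factor by which an error of the
    gradient length is amplified in its square, since |\<psi>1| \<le> sqrt \<alpha>2 and \<epsilon>
    \<le> 1/2.\<close>
  define B where "B = 2 * sqrt \<alpha>2 + 1"
  have B: "B > 0" "B \<ge> 0" using \<alpha>2 by (auto simp: B_def intro: add_nonneg_pos)
  have m1: "b + 1 \<ge> 1" using b by simp
  from J_upper_bound[OF m1 N0 b0 less_imp_le[OF \<alpha>2] B(2) \<eta>(1)]
  obtain \<epsilon>0 where \<epsilon>0: "\<epsilon>0 > 0" "\<And>\<psi> u k p0 p f q L s \<psi>2 c. \<lbrakk>\<psi> > 0; u > 0; f > 0; 0 \<le> k; k \<le> b; 0 \<le> p0; p0 \<le> \<alpha>2; 0 \<le> p;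
      \<bar>u - \<psi>\<bar> \<le> \<epsilon>0 * \<psi>; \<bar>p - p0\<bar> \<le> B * \<epsilon>0; \<bar>f - 1\<bar> \<le> \<epsilon>0;
      \<psi> * \<psi>2 = k * (1 + p0); \<psi> * (\<psi>2 + c) = b + 1 - 1 + k * p0;
      q \<le> p * (\<psi>2 + \<epsilon>0 / \<psi>); L \<ge> \<psi>2 + c - N0 * (\<epsilon>0 / \<psi>);
      1/2 * (b + 1 + inverse (1 + f * p)) * s = - f * L + f\<^sup>2 / (1 + f * p) * q + (b + 1 - 1) / u\<rbrakk> \<Longrightarrow>
      (u * q + p * (u * s / (2 * f))) * f / (1 + f * p) \<le> p * (k + \<eta>)"
    by blast
  \<comment> \<open>\<eta> / 2 is for v = 1 / f, whose error is at most twice that of f, and \<eta>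
    / B is for the square of the gradient length.\<close>
  define \<epsilon> where "\<epsilon> = min \<epsilon>0 (min (1/2) (min (\<eta> / 2) (\<eta> / B)))"
  have \<epsilon>: "\<epsilon> > 0" "\<epsilon> \<le> \<epsilon>0" "\<epsilon> \<le> 1/2" "\<epsilon> \<le> \<eta> / 2" "\<epsilon> \<le> \<eta> / B"
  proof -
    show "\<epsilon> > 0" using \<epsilon>0(1) \<eta> B by (simp add: \<epsilon>_def)
    show "\<epsilon> \<le> \<epsilon>0" "\<epsilon> \<le> 1/2" "\<epsilon> \<le> \<eta> / 2" "\<epsilon> \<le> \<eta> / B"
      unfolding \<epsilon>_def by (rule min.cobounded1 min.coboundedI2 order_refl)+
  qed
  show thesis
  proof (rule that[OF \<epsilon>(1)])
    fix \<psi> u k \<psi>1 G f q L S \<psi>2 c0 :: real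
    assume pos: "\<psi> > 0" "u > 0" "f > 0" "0 \<le> k" and P1: "\<psi>1\<^sup>2 * a / b \<le> 1"
      and k: "k \<le> b * g (\<psi>1\<^sup>2 * a / b)" and G0: "0 \<le> G"
      and near: "\<bar>u - \<psi>\<bar> \<le> \<epsilon> * \<psi>" "\<bar>G - \<bar>\<psi>1\<bar>\<bar> \<le> \<epsilon>" "\<bar>f - 1\<bar> \<le> \<epsilon>"
      and ode: "\<psi> * \<psi>2 = k * (1 + \<psi>1\<^sup>2)" "\<psi> * (\<psi>2 + c0) = b + k * \<psi>1\<^sup>2"
      and q: "q \<le> G\<^sup>2 * (\<psi>2 + \<epsilon> / \<psi>)" and L: "L \<ge> \<psi>2 + c0 - N0 * (\<epsilon> / \<psi>)"
      and min: "1/2 * (b + 1 + inverse (1 + f * G\<^sup>2)) * S = - f * L + f\<^sup>2 / (1 + f * G\<^sup>2) * q + b / u"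
    define P0 where "P0 = \<psi>1\<^sup>2 * a / b"
    have P0: "0 \<le> P0" "P0 \<le> 1" using P1 a b by (auto simp: P0_def)
    have p0: "\<psi>1\<^sup>2 = \<alpha>2 * P0" using a b by (simp add: P0_def \<alpha>2_def)
    have p0\<alpha>: "\<psi>1\<^sup>2 \<le> \<alpha>2" unfolding p0 using P0 \<alpha>2 by (simp add: mult_left_le)
    have \<psi>1\<alpha>: "\<bar>\<psi>1\<bar> \<le> sqrt \<alpha>2" using p0\<alpha> by (metis real_sqrt_abs real_sqrt_le_iff)
    have Gp: "\<bar>G\<^sup>2 - \<psi>1\<^sup>2\<bar> \<le> B * \<epsilon>"
    proof -
      have "\<bar>G\<^sup>2 - \<psi>1\<^sup>2\<bar> = \<bar>G - \<bar>\<psi>1\<bar>\<bar> * (G + \<bar>\<psi>1\<bar>)"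
      proof -
        have "G\<^sup>2 - \<psi>1\<^sup>2 = (G - \<bar>\<psi>1\<bar>) * (G + \<bar>\<psi>1\<bar>)" by (simp add: algebra_simps power2_eq_square)
        then show ?thesis using G0 by (simp add: abs_mult)
      qed
      also have "\<dots> \<le> \<epsilon> * B"
        using near(2) \<psi>1\<alpha> \<epsilon> G0 unfolding B_def by (intro mult_mono) auto
      finally show ?thesis by (simp add: mult.commute)
    qed
    have Gp': "\<bar>G\<^sup>2 - \<psi>1\<^sup>2\<bar> \<le> B * \<epsilon>0" "\<bar>G\<^sup>2 - \<alpha>2 * P0\<bar> \<le> \<eta>"
    proof -
      show "\<bar>G\<^sup>2 - \<psi>1\<^sup>2\<bar> \<le> B * \<epsilon>0" using Gp mult_left_mono[OF \<epsilon>(2) B(2)] by linarith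
      have "B * \<epsilon> \<le> \<eta>" using mult_left_mono[OF \<epsilon>(5) B(2)] B by simp
      then show "\<bar>G\<^sup>2 - \<alpha>2 * P0\<bar> \<le> \<eta>" using Gp unfolding p0 by linarith
    qed
    define v where "v = 1 / f"
    have v: "\<bar>v - 1\<bar> \<le> \<eta>"
    proof -
      have f12: "f \<ge> 1/2" using near(3) \<epsilon>(3) by linarith
      have "\<bar>v - 1\<bar> = \<bar>f - 1\<bar> / f" using pos by (simp add: v_def divide_simps abs_if)
      also have "\<dots> \<le> \<epsilon> / (1/2)" using near(3) f12 \<epsilon> by (intro frac_le) auto
      finally show ?thesis using \<epsilon>(4) by simp
    qed
    have kb: "k \<le> b"
    proof -
      have "b * g P0 \<le> b * 1" using g1[OF P0] b by (intro mult_left_mono) auto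
      then show ?thesis using k by (simp add: P0_def)
    qed
    have e\<psi>: "\<epsilon> / \<psi> \<le> \<epsilon>0 / \<psi>" using \<epsilon>(2) pos by (simp add: divide_right_mono)
    define J where "J = (u * q + G\<^sup>2 * (u * S / (2 * f))) * f / (1 + f * G\<^sup>2)"
    have J: "J \<le> G\<^sup>2 * (k + \<eta>)"
      unfolding J_def
    proof (rule \<epsilon>0(2)[where \<psi> = \<psi> and ?p0.0 = "\<psi>1\<^sup>2" and ?\<psi>2.0 = \<psi>2 and c = c0])
      show "\<bar>u - \<psi>\<bar> \<le> \<epsilon>0 * \<psi>" using near(1) mult_right_mono[OF \<epsilon>(2), of \<psi>] pos by linarith
      show "\<bar>f - 1\<bar> \<le> \<epsilon>0" using near(3) \<epsilon>(2) by linarith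
      have "G\<^sup>2 * (\<psi>2 + \<epsilon> / \<psi>) \<le> G\<^sup>2 * (\<psi>2 + \<epsilon>0 / \<psi>)" using e\<psi> by (intro mult_left_mono) auto
      then show "q \<le> G\<^sup>2 * (\<psi>2 + \<epsilon>0 / \<psi>)" using q by linarith
      show "L \<ge> \<psi>2 + c0 - N0 * (\<epsilon>0 / \<psi>)" using L mult_left_mono[OF e\<psi> N0] by linarith
    qed (use pos kb p0\<alpha> Gp' ode min in auto)
    have k\<eta>: "k + \<eta> \<le> b * g P0 + \<eta>i" "k + \<eta> \<le> b * g P0 + \<eta>o" using k \<eta> by (auto simp: P0_def)
    have expr: "f * u * div_expr (b + 1) u f (G\<^sup>2) q L S t \<rho> r' =
        b * (G\<^sup>2 + \<rho>\<^sup>2 * v) * (1 - \<rho> / (t / u)) + (\<rho>\<^sup>2 - 1) * J + G\<^sup>2 * r' * (\<rho> * (t / u) - 1)"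
      if "t > 0" for t \<rho> r'
      using minimal_substitution[of "b + 1" f "G\<^sup>2" S L q u t J \<rho> r'] min pos that
      unfolding div_expr_def J_def v_def by simp
    have fu: "f * u > 0" using pos by simp
    show "(\<forall>t. 0 < t \<longrightarrow> t \<le> u \<longrightarrow> div_expr (b + 1) u f (G\<^sup>2) q L S t (inner_ratio d (t / u)) (inner_ratio' d (t / u)) \<ge> 0) \<and>
      (\<forall>t. u \<le> t \<longrightarrow> div_expr (b + 1) u f (G\<^sup>2) q L S t (outer_ratio d (t / u)) (outer_ratio' d (t / u)) \<le> 0)"
    proof (intro conjI allI impI)
      fix t assume t: "0 < t" "t \<le> u"
      have \<theta>: "0 < t / u" "t / u \<le> 1" using t pos by auto
      have "(t / u)\<^sup>2 \<le> 1" using \<theta> by (simp add: power_le_one)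
      from \<eta>i(2)[OF P0 _ order_trans[OF Gp'(2) \<eta>(2)] order_trans[OF v \<eta>(2)] k\<eta>(1) _ this]
      have lin: "G\<^sup>2 * inner_lin (b + 1) d (k + \<eta>) ((t / u)\<^sup>2) + v * (4 * d * (b + 1 - 1) * (t / u)\<^sup>2) \<ge> 0"
        by (simp add: Xi_def Yi_def Zi_def inner_lin_def algebra_simps)
      have "f * u * div_expr (b + 1) u f (G\<^sup>2) q L S t (inner_ratio d (t / u)) (inner_ratio' d (t / u)) \<ge> 0"
        unfolding expr[OF t(1)]
        using inner_sign[OF d \<theta> inner_ratio_def inner_ratio'_def J lin] by simp
      then show "div_expr (b + 1) u f (G\<^sup>2) q L S t (inner_ratio d (t / u)) (inner_ratio' d (t / u)) \<ge> 0"
        using fu by (simp add: zero_le_mult_iff)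
    next
      fix t assume t: "u \<le> t"
      have tp: "t > 0" and \<theta>: "1 \<le> t / u" using t pos by auto
      have q1: "0 \<le> 1 / (t / u)\<^sup>2" "1 / (t / u)\<^sup>2 \<le> 1"
        using one_le_power[OF \<theta>, of 2] by (auto simp: divide_le_eq_1 simp del: power_divide)
      from \<eta>o(2)[OF P0 _ order_trans[OF Gp'(2) \<eta>(3)] order_trans[OF v \<eta>(3)] k\<eta>(2) q1]
      have lin: "G\<^sup>2 * outer_lin (b + 1) d (k + \<eta>) (1 / (t / u)\<^sup>2) + v * (d * (b + 1 - 1) * (d + 2 - d / (t / u)\<^sup>2)\<^sup>2) \<ge> 0"
        by (simp add: Xo_def Yo_def Zo_def outer_lin_def algebra_simps)
      have "f * u * div_expr (b + 1) u f (G\<^sup>2) q L S t (outer_ratio d (t / u)) (outer_ratio' d (t / u)) \<le> 0"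
        unfolding expr[OF tp]
        using outer_sign[OF d \<theta> outer_ratio_def outer_ratio'_def J lin] by simp
      then show "div_expr (b + 1) u f (G\<^sup>2) q L S t (outer_ratio d (t / u)) (outer_ratio' d (t / u)) \<le> 0"
        using pos by (auto simp: mult_le_0_iff)
    qed
  qed
qed

section \<open>Divergence in the warped metric\<close>

abbreviation base_pt :: "'a \<times> 'b \<times> 'c \<Rightarrow> 'a \<times> 'c" where
  "base_pt q \<equiv> (fst q, snd (snd q))"

lemma warped_metric_eq:
  "warped_metric f q v w =
     fst v \<bullet> fst w + f (base_pt q) * (fst (snd v) \<bullet> fst (snd w)) + snd (snd v) \<bullet> snd (snd w)"
  by (simp add: warped_metric_def split: prod.splits)

lemma sum_Basis_pair:
  fixes F :: "'a::euclidean_space \<times> 'b::euclidean_space \<Rightarrow> real"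
  shows "(\<Sum>i\<in>Basis. F i) = (\<Sum>i\<in>Basis. F (i, 0)) + (\<Sum>i\<in>Basis. F (0, i))"
  unfolding Basis_prod_def
  by (subst sum.union_disjoint) (auto simp: sum.reindex inj_on_def)

lemma sum_Basis_triple:
  fixes F :: "'a::euclidean_space \<times> 'b::euclidean_space \<times> 'c::euclidean_space \<Rightarrow> real"
  shows "(\<Sum>b\<in>Basis. F b) =
    (\<Sum>i\<in>Basis. F (i, 0, 0)) + (\<Sum>i\<in>Basis. F (0, i, 0)) + (\<Sum>i\<in>Basis. F (0, 0, i))"
  unfolding sum_Basis_pair by (simp add: sum_Basis_pair zero_prod_def)

lemma prod_Basis_pair:
  fixes F :: "'a::euclidean_space \<times> 'b::euclidean_space \<Rightarrow> real"
  shows "(\<Prod>b\<in>Basis. F b) = (\<Prod>i\<in>Basis. F (i, 0)) * (\<Prod>i\<in>Basis. F (0, i))"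
proof -
  have "inj_on (\<lambda>u. (u::'a, 0::'b)) Basis" "inj_on (\<lambda>u. (0::'a, u::'b)) Basis"
    by (auto intro!: inj_onI)
  then show ?thesis
    unfolding Basis_prod_def
    by (subst prod.union_disjoint) (auto simp: prod.reindex)
qed

text \<open>The coordinate basis is orthogonal for this metric, so every permutation other than the
  identity contributes a vanishing product to the Leibniz formula.\<close>

lemma metric_vol_warped:
  fixes f :: "(real^'n) \<times> (real^'l) \<Rightarrow> real" and q :: "(real^'n) \<times> (real^'m) \<times> (real^'l)"
  shows "metric_vol (warped_metric f) q = sqrt (f (base_pt q) ^ CARD('m))"
proof -
  let ?G = "warped_metric f q" and ?B = "Basis :: ((real^'n) \<times> (real^'m) \<times> (real^'l)) set"
  have orth: "?G b b' = 0" if "b \<in> ?B" "b' \<in> ?B" "b \<noteq> b'" for b b'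
  proof -
    have "(\<exists>i\<in>Basis. a = (i, 0, 0)) \<or> (\<exists>i\<in>Basis. a = (0, i, 0)) \<or> (\<exists>i\<in>Basis. a = (0, 0, i))"
      if "a \<in> ?B" for a using that unfolding Basis_prod_def by (auto simp: zero_prod_def)
    from this[OF that(1)] this[OF that(2)] that(3) show ?thesis
      by (elim disjE bexE) (simp_all add: warped_metric_eq inner_not_same_Basis)
  qed
  have "(\<Prod>b\<in>?B. ?G b (\<pi> b)) = 0" if pi: "\<pi> permutes ?B" "\<pi> \<noteq> id" for \<pi>
  proof -
    obtain b where b: "\<pi> b \<noteq> b"
      using pi(2) by (auto simp: fun_eq_iff)
    then have bB: "b \<in> ?B" using permutes_not_in[OF pi(1)] by blast
    then have "?G b (\<pi> b) = 0"
      using orth[of b "\<pi> b"] b permutes_in_image[OF pi(1), of b] by simp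
    with bB show ?thesis by (intro prod_zero) auto
  qed
  then have "(\<Sum>\<pi> | \<pi> permutes ?B. of_int (sign \<pi>) * (\<Prod>b\<in>?B. ?G b (\<pi> b)))
    = (\<Sum>\<pi>\<in>{id}. of_int (sign \<pi>) * (\<Prod>b\<in>?B. ?G b (\<pi> b)))"
    by (intro sum.mono_neutral_right) (auto simp: permutes_id finite_permutations)
  also have "\<dots> = f (base_pt q) ^ CARD('m)"
    by (simp add: prod_Basis_pair zero_prod_def warped_metric_eq)
  finally show ?thesis unfolding metric_vol_def by simp
qed

lemma metric_grad_warped:
  fixes F :: "(real^'n) \<times> (real^'m) \<times> (real^'l) \<Rightarrow> real"
  assumes F: "(F has_derivative (\<lambda>w. a \<bullet> fst w + b \<bullet> fst (snd w) + c \<bullet> snd (snd w))) (at q)"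
    and f: "f (base_pt q) > 0"
  shows "metric_grad (warped_metric f) F q = (a, b /\<^sub>R f (base_pt q), c)"
  unfolding metric_grad_def
proof (rule the_equality)
  have D: "frechet_derivative F (at q) = (\<lambda>w. a \<bullet> fst w + b \<bullet> fst (snd w) + c \<bullet> snd (snd w))"
    using frechet_derivative_at[OF F] by simp
  show "\<forall>w. warped_metric f q (a, b /\<^sub>R f (base_pt q), c) w = frechet_derivative F (at q) w"
    using f by (simp add: D warped_metric_eq)
  fix v assume v: "\<forall>w. warped_metric f q v w = frechet_derivative F (at q) w"
  have eq: "fst v \<bullet> w1 + f (base_pt q) * (fst (snd v) \<bullet> w2) + snd (snd v) \<bullet> w3 =
    a \<bullet> w1 + b \<bullet> w2 + c \<bullet> w3" for w1 w2 w3
    using v[rule_format, of "(w1, w2, w3)"] by (simp add: D warped_metric_eq)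
  have "fst v = a" using eq[of _ 0 0] by (intro vector_eq_rdot[THEN iffD1]) simp
  moreover have "f (base_pt q) *\<^sub>R fst (snd v) = b"
    using eq[of 0 _ 0] by (intro vector_eq_rdot[THEN iffD1]) simp
  moreover have "snd (snd v) = c" using eq[of 0 0 _] by (intro vector_eq_rdot[THEN iffD1]) simp
  ultimately show "v = (a, b /\<^sub>R f (base_pt q), c)"
    using f by (auto simp: prod_eq_iff)
qed

lemma metric_unit_grad_warped:
  fixes F :: "(real^'n) \<times> (real^'m) \<times> (real^'l) \<Rightarrow> real"
  assumes F: "(F has_derivative (\<lambda>w. A * (g \<bullet> (fst w, snd (snd w)) - \<rho> * (e \<bullet> fst (snd w))))) (at q)"
    and A: "A > 0" and e: "norm e = 1" and f: "f (base_pt q) > 0"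
    and W: "W = sqrt ((norm g)\<^sup>2 + \<rho>\<^sup>2 / f (base_pt q))" "W > 0"
  shows "metric_unit_grad (warped_metric f) F q =
    (fst g /\<^sub>R W, - (\<rho> / (f (base_pt q) * W)) *\<^sub>R e, snd g /\<^sub>R W)"
proof -
  let ?v = "(A *\<^sub>R fst g, (- (A * \<rho>) *\<^sub>R e) /\<^sub>R f (base_pt q), A *\<^sub>R snd g)"
  have v: "metric_grad (warped_metric f) F q = ?v"
    by (rule metric_grad_warped)
      (auto simp: f algebra_simps inner_prod_def intro: has_derivative_eq_rhs[OF F])
  have g2: "fst g \<bullet> fst g + snd g \<bullet> snd g = (norm g)\<^sup>2"
    by (simp add: power2_norm_eq_inner inner_prod_def)
  have "warped_metric f q ?v ?v = A\<^sup>2 * (fst g \<bullet> fst g + snd g \<bullet> snd g) + A\<^sup>2 * (\<rho>\<^sup>2 / f (base_pt q))"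
    using f e unfolding warped_metric_eq by (simp add: norm_eq_1 field_simps power2_eq_square)
  then have "metric_norm (warped_metric f) q ?v = sqrt (A\<^sup>2 * ((norm g)\<^sup>2 + \<rho>\<^sup>2 / f (base_pt q)))"
    unfolding metric_norm_def g2 by (simp add: distrib_left)
  then have n: "metric_norm (warped_metric f) q ?v = A * W"
    using A by (simp add: real_sqrt_mult W)
  show ?thesis
    unfolding metric_unit_grad_def v n
    using A W(2) f by (simp add: divide_simps)
qed

section \<open>Gradient and Hessian as derivatives; divergence by the product rule\<close>

lemma grad_inner_Basis: "i \<in> Basis \<Longrightarrow> grad F z \<bullet> i = iter_partial [i] F z"
  by (simp add: grad_def inner_sum_left inner_Basis if_distrib sum.If_cases
      cong: if_cong)

lemma grad_inner:
  assumes "F differentiable (at z)"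
  shows "frechet_derivative F (at z) w = grad F z \<bullet> w"
proof -
  have lin: "linear (frechet_derivative F (at z))"
    using assms frechet_derivative_works has_derivative_linear by blast
  have "frechet_derivative F (at z) w = frechet_derivative F (at z) (\<Sum>i\<in>Basis. (w \<bullet> i) *\<^sub>R i)"
    by (simp add: euclidean_representation)
  also have "\<dots> = (\<Sum>i\<in>Basis. (w \<bullet> i) * frechet_derivative F (at z) i)"
    using lin by (simp add: linear_sum linear_cmul)
  also have "\<dots> = grad F z \<bullet> w"
    unfolding grad_def inner_sum_left
    by (intro sum.cong) (auto simp: inner_commute mult.commute)
  finally show ?thesis .
qed

definition hess_app :: "('a::euclidean_space \<Rightarrow> real) \<Rightarrow> 'a \<Rightarrow> 'a \<Rightarrow> 'a" where
  "hess_app F z w = (\<Sum>i\<in>Basis. frechet_derivative (iter_partial [i] F) (at z) w *\<^sub>R i)"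

lemma grad_has_derivative:
  assumes "\<And>i. i \<in> Basis \<Longrightarrow> iter_partial [i] F differentiable (at z)"
  shows "(grad F has_derivative hess_app F z) (at z)"
proof -
  have "((\<lambda>z. \<Sum>i\<in>Basis. iter_partial [i] F z *\<^sub>R i) has_derivative
      (\<lambda>w. \<Sum>i\<in>Basis. frechet_derivative (iter_partial [i] F) (at z) w *\<^sub>R i)) (at z)"
    by (intro has_derivative_sum has_derivative_scaleR_left)
      (use assms frechet_derivative_works in blast)
  then show ?thesis unfolding hess_app_def[abs_def] grad_def[abs_def] .
qed

lemma hess_app_Basis:
  assumes "j \<in> Basis"
  shows "hess_app F z w \<bullet> j = frechet_derivative (iter_partial [j] F) (at z) w"
  using assms by (simp add: hess_app_def inner_sum_left inner_Basis if_distrib sum.If_cases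
      cong: if_cong)

lemma laplacian_hess_app: "laplacian F z = (\<Sum>i\<in>Basis. hess_app F z i \<bullet> i)"
  by (simp add: laplacian_def hess_app_Basis)

lemma hess_grad_grad_hess_app:
  assumes "\<And>i. i \<in> Basis \<Longrightarrow> iter_partial [i] F differentiable (at z)"
  shows "hess_grad_grad F z = grad F z \<bullet> hess_app F z (grad F z)"
proof -
  have lin: "linear (frechet_derivative (iter_partial [i] F) (at z))" if "i \<in> Basis" for i
    using assms[OF that] frechet_derivative_works has_derivative_linear by blast
  have "grad F z \<bullet> hess_app F z (grad F z) =
    (\<Sum>j\<in>Basis. iter_partial [j] F z * frechet_derivative (iter_partial [j] F) (at z) (grad F z))"
  proof -
    have "grad F z \<bullet> X = (\<Sum>j\<in>Basis. iter_partial [j] F z * (X \<bullet> j))" for X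
      unfolding grad_def inner_sum_left
      by (intro sum.cong) (auto simp: inner_commute simp del: iter_partial.simps)
    then show ?thesis by (simp add: hess_app_Basis del: iter_partial.simps)
  qed
  also have "\<dots> = (\<Sum>j\<in>Basis. \<Sum>i\<in>Basis. iter_partial [j] F z * (iter_partial [i] F z *
      frechet_derivative (iter_partial [j] F) (at z) i))"
    by (subst grad_def)
      (simp add: lin linear_sum linear_cmul sum_distrib_left del: iter_partial.simps cong: sum.cong)
  finally show ?thesis
    unfolding hess_grad_grad_def
    by (subst sum.swap) (simp add: mult_ac)
qed

lemma linear_comp_Basis_expand:
  fixes l :: "'x::real_vector \<Rightarrow> real" and e :: "'y::euclidean_space \<Rightarrow> 'x"
  assumes "linear l" "linear e"
  shows "l (e g) = (\<Sum>i\<in>Basis. l (e i) * (g \<bullet> i))"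
proof -
  have "l (e g) = l (e (\<Sum>i\<in>Basis. (g \<bullet> i) *\<^sub>R i))"
    by (simp add: euclidean_representation)
  also have "\<dots> = (\<Sum>i\<in>Basis. (g \<bullet> i) * l (e i))"
    using assms by (simp only: linear_sum linear_cmul real_scaleR_def)
  finally show ?thesis by (simp only: mult.commute)
qed

text \<open>Product rule for a field built from a base field G and the Euler field \<xi>: the trace
  of H gives the divergence of G, and the Euler field has divergence equal to the fibre dimension.
  The volume density is meant to be absorbed in the coefficients \<open>c\<close> and
  \<open>\<kappa>\<close>.\<close>

lemma divergence_split:
  fixes Z :: "'a::euclidean_space \<times> 'b::euclidean_space \<times> 'c::euclidean_space \<Rightarrow> 'a \<times> 'b \<times> 'c"
    and c \<kappa> :: "'a \<times> 'b \<times> 'c \<Rightarrow> real"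
  assumes Z: "\<forall>\<^sub>F q in nhds p. Z q =
      (c q *\<^sub>R fst (G (base_pt q)), \<kappa> q *\<^sub>R fst (snd q), c q *\<^sub>R snd (G (base_pt q)))"
    and c: "(c has_derivative c') (at p)" and \<kappa>: "(\<kappa> has_derivative \<kappa>') (at p)"
    and G: "(G has_derivative H) (at (base_pt p))"
  shows "(\<Sum>b\<in>Basis. frechet_derivative (\<lambda>q. Z q \<bullet> b) (at p) b) =
    c' (fst (G (base_pt p)), 0, snd (G (base_pt p))) + c p * (\<Sum>i\<in>Basis. H i \<bullet> i)
    + \<kappa>' (0, fst (snd p), 0) + real DIM('b) * \<kappa> p"
proof -
  let ?Z' = "\<lambda>w. (c' w *\<^sub>R fst (G (base_pt p)) + c p *\<^sub>R fst (H (base_pt w)),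
      \<kappa>' w *\<^sub>R fst (snd p) + \<kappa> p *\<^sub>R fst (snd w),
      c' w *\<^sub>R snd (G (base_pt p)) + c p *\<^sub>R snd (H (base_pt w)))"
  have base: "(base_pt has_derivative base_pt) (at p)"
    by (auto intro!: derivative_eq_intros)
  have Gb: "((\<lambda>q. G (base_pt q)) has_derivative (\<lambda>w. H (base_pt w))) (at p)"
    using has_derivative_compose[OF base G] .
  have Z0: "((\<lambda>q. (c q *\<^sub>R fst (G (base_pt q)), \<kappa> q *\<^sub>R fst (snd q), c q *\<^sub>R snd (G (base_pt q))))
      has_derivative ?Z') (at p)"
    by (auto intro!: derivative_eq_intros c \<kappa> Gb simp: add.commute)
  have Z': "(Z has_derivative ?Z') (at p)"
    by (rule has_derivative_transform_eventually[OF Z0])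
      (use Z eventually_nhds_x_imp_x[OF Z] in \<open>auto simp: eventually_at_filter elim: eventually_mono\<close>)
  have fr: "frechet_derivative (\<lambda>q. Z q \<bullet> b) (at p) b = ?Z' b \<bullet> b" for b
    by (rule fun_cong[OF frechet_derivative_at[OF has_derivative_inner_left[OF Z', of b], symmetric]])
  have lc: "linear c'" and lk: "linear \<kappa>'" and lH: "linear H"
    using c \<kappa> G has_derivative_linear by blast+
  have l1: "linear (\<lambda>i::'a. (i, 0::'b, 0::'c))" and l2: "linear (\<lambda>i::'b. (0::'a, i, 0::'c))"
    and l3: "linear (\<lambda>i::'c. (0::'a, 0::'b, i))"
    by (auto intro!: linearI)
  let ?g = "G (base_pt p)"
  have split: "c' (fst ?g, 0, snd ?g) = c' (fst ?g, 0, 0) + c' (0, 0, snd ?g)"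
    using linear_add[OF lc, of "(fst ?g, 0, 0)" "(0, 0, snd ?g)"] by simp
  have HS: "(\<Sum>i\<in>Basis. H i \<bullet> i) =
      (\<Sum>i\<in>Basis. fst (H (i, 0)) \<bullet> i) + (\<Sum>i\<in>Basis. snd (H (0, i)) \<bullet> i)"
    unfolding Basis_prod_def
    by (subst sum.union_disjoint) (auto simp: sum.reindex inj_on_def inner_prod_def)
  have "(\<Sum>b\<in>Basis. frechet_derivative (\<lambda>q. Z q \<bullet> b) (at p) b) = (\<Sum>b\<in>Basis. ?Z' b \<bullet> b)"
    by (intro sum.cong refl fr)
  also have "\<dots> = c' (fst ?g, 0, 0) + c' (0, 0, snd ?g) + \<kappa>' (0, fst (snd p), 0)
     + c p * ((\<Sum>i\<in>Basis. fst (H (i, 0)) \<bullet> i) + (\<Sum>i\<in>Basis. snd (H (0, i)) \<bullet> i)) + real DIM('b) * \<kappa> p"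
  proof -
    have "(\<Sum>i\<in>Basis. ?Z' (i, 0, 0) \<bullet> (i, 0, 0)) =
        c' (fst ?g, 0, 0) + c p * (\<Sum>i\<in>Basis. fst (H (i, 0)) \<bullet> i)"
      unfolding linear_comp_Basis_expand[OF lc l1, of "fst ?g"]
      by (simp add: inner_add_left sum.distrib sum_distrib_left)
    moreover have "(\<Sum>i\<in>Basis. ?Z' (0, i, 0) \<bullet> (0, i, 0)) = \<kappa>' (0, fst (snd p), 0) + real DIM('b) * \<kappa> p"
      unfolding linear_comp_Basis_expand[OF lk l2, of "fst (snd p)"]
      by (simp add: inner_add_left sum.distrib)
    moreover have "(\<Sum>i\<in>Basis. ?Z' (0, 0, i) \<bullet> (0, 0, i)) =
        c' (0, 0, snd ?g) + c p * (\<Sum>i\<in>Basis. snd (H (0, i)) \<bullet> i)"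
      unfolding linear_comp_Basis_expand[OF lc l3, of "snd ?g"]
      by (simp add: inner_add_left sum.distrib sum_distrib_left)
    ultimately show ?thesis unfolding sum_Basis_triple by (simp only: distrib_left)
  qed
  finally show ?thesis unfolding split HS by simp
qed

text \<open>The differential is A (du - \<rho> d|\<xi>|) with A > 0 and \<rho> = r(|\<xi>| / u). The
  factor A cancels in the unit normal, so it may vary with the point and never has to be
  differentiated; this is why it is quantified pointwise.\<close>

abbreviation gradient_ratio ::
  "('a::euclidean_space \<times> 'b::euclidean_space \<times> 'c::euclidean_space \<Rightarrow> real) \<Rightarrow> ('a \<times> 'c \<Rightarrow> real) \<Rightarrow> (real \<Rightarrow> real) \<Rightarrow> 'a \<times> 'b \<times> 'c \<Rightarrow> bool" where
  "gradient_ratio F u r q \<equiv> \<exists>A>0. (F has_derivative (\<lambda>w. A * (grad u (base_pt q) \<bullet> base_pt w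
     - r (norm (fst (snd q)) / u (base_pt q)) * (sgn (fst (snd q)) \<bullet> fst (snd w))))) (at q)"

text \<open>W is the length of du - \<rho> dt in the metric, t = |\<xi>|. The unit normal has base
  part Du / W and fibre part -(\<rho> / (f W)) \<xi> / t. The factor W^3 clears the denominators
  produced by differentiating 1 / W, and the right-hand side is \<open>div_expr\<close>.\<close>

lemma metric_div_unit_grad_warped:
  fixes F :: "(real^'n) \<times> (real^'m) \<times> (real^'l) \<Rightarrow> real"
    and u f :: "(real^'n) \<times> (real^'l) \<Rightarrow> real" and r :: "real \<Rightarrow> real"
    and p :: "(real^'n) \<times> (real^'m) \<times> (real^'l)"
  defines "z \<equiv> base_pt p" and "t \<equiv> norm (fst (snd p))"
  assumes F: "\<forall>\<^sub>F q in nhds p. gradient_ratio F u r q"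
    and u: "u differentiable (at z)" "u z > 0"
      "\<And>i. i \<in> Basis \<Longrightarrow> iter_partial [i] u differentiable (at z)"
    and f: "f differentiable (at z)" "\<And>z. f z > 0"
    and t: "fst (snd p) \<noteq> 0"
    and r: "(r has_real_derivative r') (at (t / u z))" "r (t / u z) = \<rho>" "\<rho> > 0"
    and W: "W = sqrt ((norm (grad u z))\<^sup>2 + \<rho>\<^sup>2 / f z)"
  shows "W > 0" and "W ^ 3 * metric_div (warped_metric f) (metric_unit_grad (warped_metric f) F) p =
    W\<^sup>2 * (real CARD('m) * (grad f z \<bullet> grad u z) / (2 * f z) + laplacian u z - (real CARD('m) - 1) * \<rho> / (f z * t))
    - hess_grad_grad u z + \<rho>\<^sup>2 * (grad f z \<bullet> grad u z) / (2 * (f z)\<^sup>2)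
    + (norm (grad u z))\<^sup>2 * r' * (\<rho> * t / u z - 1) / (f z * u z)"
proof -
  have fz: "f z > 0" and tp: "t > 0" using f(2) t by (auto simp: t_def)
  define G where "G = grad u"
  define H where "H = hess_app u z"
  have GH: "(G has_derivative H) (at z)"
    unfolding G_def H_def using u(3) by (rule grad_has_derivative)
  define P where "P = G z \<bullet> G z"
  have nP: "(norm (grad u z))\<^sup>2 = P" by (simp add: P_def G_def power2_norm_eq_inner)
  have base: "(base_pt has_derivative base_pt) (at p)"
    by (auto intro!: derivative_eq_intros)
  have Gb: "((\<lambda>q. G (base_pt q)) has_derivative (\<lambda>w. H (base_pt w))) (at p)"
    using has_derivative_compose[OF base] GH unfolding z_def by blast
  have ub: "((\<lambda>q. u (base_pt q)) has_derivative (\<lambda>w. G z \<bullet> base_pt w)) (at p)"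
  proof -
    have "(u has_derivative (\<lambda>w. G z \<bullet> w)) (at z)"
      using frechet_derivative_works[THEN iffD1, OF u(1)] unfolding G_def grad_inner[OF u(1)] .
    then show ?thesis using has_derivative_compose[OF base] unfolding z_def by blast
  qed
  have fb: "((\<lambda>q. f (base_pt q)) has_derivative (\<lambda>w. grad f z \<bullet> base_pt w)) (at p)"
  proof -
    have "(f has_derivative (\<lambda>w. grad f z \<bullet> w)) (at z)"
      using frechet_derivative_works[THEN iffD1, OF f(1)] unfolding grad_inner[OF f(1)] .
    then show ?thesis using has_derivative_compose[OF base] unfolding z_def by blast
  qed
  define e where "e = sgn (fst (snd p))"
  have tb: "((\<lambda>q. norm (fst (snd q))) has_derivative (\<lambda>w. e \<bullet> fst (snd w))) (at p)"
  proof -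
    have "((\<lambda>q. fst (snd q)) has_derivative (\<lambda>w. fst (snd w))) (at p)"
      by (auto intro!: derivative_eq_intros)
    from has_derivative_compose[OF this has_derivative_norm[OF t]] show ?thesis
      by (simp add: e_def inner_commute)
  qed
  define R where "R = (\<lambda>q::(real^'n) \<times> (real^'m) \<times> (real^'l). r (norm (fst (snd q)) / u (base_pt q)))"
  define R' where "R' = (\<lambda>w::(real^'n) \<times> (real^'m) \<times> (real^'l).
      r' * ((e \<bullet> fst (snd w)) / u z - t * (G z \<bullet> base_pt w) / (u z)\<^sup>2))"
  have Rb: "(R has_derivative R') (at p)"
  proof -
    have "((\<lambda>q. norm (fst (snd q)) / u (base_pt q)) has_derivative
        (\<lambda>w. (e \<bullet> fst (snd w)) / u z - t * (G z \<bullet> base_pt w) / (u z)\<^sup>2)) (at p)"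
      using u(2) unfolding z_def t_def
      by (auto intro!: derivative_eq_intros tb ub simp: field_simps power2_eq_square z_def)
    from DERIV_compose_FDERIV[OF _ this] r(1) show ?thesis
      unfolding R_def R'_def t_def z_def by (simp add: mult.commute)
  qed
  have Rp: "R p = \<rho>" using r(2) by (simp add: R_def t_def z_def)
  define W2 where "W2 = (\<lambda>q. G (base_pt q) \<bullet> G (base_pt q) + (R q)\<^sup>2 / f (base_pt q))"
  define W2' where "W2' = (\<lambda>w. 2 * (G z \<bullet> H (base_pt w)) + 2 * \<rho> * R' w / f z
      - \<rho>\<^sup>2 * (grad f z \<bullet> base_pt w) / (f z)\<^sup>2)"
  have W2b: "(W2 has_derivative W2') (at p)"
    using fz Rp unfolding W2_def W2'_def z_def
    by (auto intro!: derivative_eq_intros Gb Rb fb ext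
        simp: field_simps power2_eq_square z_def inner_commute)
  have W2p: "W2 p = P + \<rho>\<^sup>2 / f z" by (simp add: W2_def P_def Rp z_def[symmetric])
  have W2pos: "W2 p > 0" using fz r(3) by (auto simp: W2p P_def intro!: add_nonneg_pos divide_pos_pos)
  have Wp: "W = sqrt (W2 p)" by (simp add: W W2p nP)
  then show Wpos: "W > 0" using W2pos by simp
  have Wsq: "W\<^sup>2 = P + \<rho>\<^sup>2 / f z" using W2pos by (simp add: Wp W2p)
  define V where "V = sqrt (f z ^ CARD('m))"
  have Vpos: "V > 0" using fz by (simp add: V_def)
  define c where "c = (\<lambda>q::(real^'n) \<times> (real^'m) \<times> (real^'l). sqrt (f (base_pt q) ^ CARD('m)) * (1 / sqrt (W2 q)))"
  define c' where "c' = (\<lambda>w. V * (real CARD('m) * (grad f z \<bullet> base_pt w) / (2 * f z) / W - W2' w / (2 * W ^ 3)))"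
  have cp: "c p = V / W" by (simp add: c_def V_def Wp z_def)
  have cb: "(c has_derivative c') (at p)"
  proof -
    have "((\<lambda>s. sqrt (s ^ CARD('m))) has_real_derivative (real CARD('m) * V / (2 * f z))) (at (f z))"
    proof -
      have "((\<lambda>s. sqrt (s ^ CARD('m))) has_real_derivative
          (real CARD('m) * f z ^ (CARD('m) - 1) * (inverse V / 2))) (at (f z))"
        using fz unfolding V_def by (auto intro!: derivative_eq_intros)
      moreover have "real CARD('m) * f z ^ (CARD('m) - 1) * (inverse V / 2) = real CARD('m) * V / (2 * f z)"
      proof -
        have "f z * f z ^ (CARD('m) - 1) = V * V"
          using fz by (simp add: V_def power_eq_if[of _ "CARD('m)"])
        then show ?thesis using fz Vpos by (simp add: field_simps)
      qed
      ultimately show ?thesis by (simp only:)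
    qed
    from DERIV_compose_FDERIV[OF this[unfolded z_def] fb]
    have 1: "((\<lambda>q. sqrt (f (base_pt q) ^ CARD('m))) has_derivative
       (\<lambda>w. (grad f z \<bullet> base_pt w) * (real CARD('m) * V / (2 * f z)))) (at p)"
      by (simp add: z_def)
    have "((\<lambda>s. 1 / sqrt s) has_real_derivative - 1 / (2 * W ^ 3)) (at (W2 p))"
      using W2pos unfolding Wp
      by (auto intro!: derivative_eq_intros simp: field_simps power3_eq_cube)
    from DERIV_compose_FDERIV[OF this W2b]
    have 2: "((\<lambda>q. 1 / sqrt (W2 q)) has_derivative (\<lambda>w. W2' w * (- 1 / (2 * W ^ 3)))) (at p)" .
    show ?thesis
      unfolding c_def
      by (rule has_derivative_eq_rhs[OF has_derivative_mult[OF 1 2]])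
        (use fz Vpos Wpos in \<open>auto simp: c'_def V_def[symmetric] Wp[symmetric] z_def[symmetric] field_simps intro!: ext\<close>)
  qed
  \<comment> \<open>The fibre part is written as a multiple of \<xi> instead of \<xi> / |\<xi>|,
    which is the form required by \<open>divergence_split\<close>.\<close>
  define \<kappa> where "\<kappa> = (\<lambda>q. - (c q * R q / (f (base_pt q) * norm (fst (snd q)))))"
  define \<kappa>' where "\<kappa>' = (\<lambda>w. - (c' w * \<rho> / (f z * t) + V / W * R' w / (f z * t)
     - V / W * \<rho> * (grad f z \<bullet> base_pt w) / ((f z)\<^sup>2 * t)
     - V / W * \<rho> * (e \<bullet> fst (snd w)) / (f z * t\<^sup>2)))"
  have \<kappa>b: "(\<kappa> has_derivative \<kappa>') (at p)"
  proof -
    have 1: "((\<lambda>q. c q * R q) has_derivative (\<lambda>w. V / W * R' w + c' w * \<rho>)) (at p)"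
      using has_derivative_mult[OF cb Rb] by (simp add: cp Rp)
    have 2: "((\<lambda>q. f (base_pt q) * norm (fst (snd q))) has_derivative
       (\<lambda>w. f z * (e \<bullet> fst (snd w)) + (grad f z \<bullet> base_pt w) * t)) (at p)"
      using has_derivative_mult[OF fb tb] by (simp add: z_def t_def)
    have nz: "f (base_pt p) * norm (fst (snd p)) \<noteq> 0" using fz tp by (simp add: z_def t_def)
    show ?thesis
      unfolding \<kappa>_def
      by (rule has_derivative_eq_rhs[OF has_derivative_minus[OF has_derivative_divide'[OF 1 2 nz]]])
        (use fz tp Wpos in \<open>auto simp: \<kappa>'_def cp Rp z_def[symmetric] t_def[symmetric] divide_simps power2_eq_square algebra_simps intro!: ext\<close>)
  qed
  let ?X = "metric_unit_grad (warped_metric f) F"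
  let ?Z = "\<lambda>q. metric_vol (warped_metric f) q *\<^sub>R ?X q"
  have Z: "\<forall>\<^sub>F q in nhds p. ?Z q =
      (c q *\<^sub>R fst (G (base_pt q)), \<kappa> q *\<^sub>R fst (snd q), c q *\<^sub>R snd (G (base_pt q)))"
  proof -
    have "\<forall>\<^sub>F q in nhds p. W2 q > 0"
      by (rule order_tendstoD(1)[OF has_derivative_continuous[OF W2b,
            unfolded isCont_def tendsto_at_iff_tendsto_nhds] W2pos])
    moreover have "\<forall>\<^sub>F q in nhds p. norm (fst (snd q)) > 0"
    proof -
      have "((\<lambda>q. norm (fst (snd q))) \<longlongrightarrow> t) (nhds p)"
        using has_derivative_continuous[OF tb]
          tendsto_at_iff_tendsto_nhds[of "\<lambda>q. norm (fst (snd q))" p]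
        unfolding isCont_def t_def by blast
      from order_tendstoD(1)[OF this tp] show ?thesis .
    qed
    ultimately show ?thesis using F
    proof eventually_elim
      case (elim q)
      then obtain A where A: "A > 0" "(F has_derivative (\<lambda>w. A * (G (base_pt q) \<bullet> base_pt w
        - R q * (sgn (fst (snd q)) \<bullet> fst (snd w))))) (at q)"
        by (auto simp: G_def R_def)
      have w: "sqrt (W2 q) = sqrt ((norm (G (base_pt q)))\<^sup>2 + (R q)\<^sup>2 / f (base_pt q))"
        by (simp add: W2_def power2_norm_eq_inner)
      have "?X q = (fst (G (base_pt q)) /\<^sub>R sqrt (W2 q), - (R q / (f (base_pt q) * sqrt (W2 q))) *\<^sub>R sgn (fst (snd q)),
         snd (G (base_pt q)) /\<^sub>R sqrt (W2 q))"
        by (rule metric_unit_grad_warped[OF A(2,1), where f = f]) (use elim f(2) w in \<open>auto simp: norm_sgn\<close>)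
      then show ?case
        unfolding metric_vol_warped
        by (simp add: c_def \<kappa>_def sgn_div_norm divide_simps)
    qed
  qed
  have div: "metric_div (warped_metric f) ?X p = (c' (fst (G z), 0, snd (G z)) + V / W * (\<Sum>i\<in>Basis. H i \<bullet> i)
    + \<kappa>' (0, fst (snd p), 0) + real CARD('m) * \<kappa> p) / V"
    using divergence_split[OF Z cb \<kappa>b GH[unfolded z_def]]
    unfolding metric_div_def by (simp add: z_def[symmetric] cp metric_vol_warped V_def)
  define s where "s = grad f z \<bullet> G z"
  define L where "L = laplacian u z"
  define Q where "Q = hess_grad_grad u z"
  have L: "(\<Sum>i\<in>Basis. H i \<bullet> i) = L" unfolding L_def H_def laplacian_hess_app ..
  have Q: "G z \<bullet> H (G z) = Q" unfolding Q_def H_def G_def using hess_grad_grad_hess_app[OF u(3)] by simp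
  have H0: "H 0 = 0" using GH has_derivative_linear linear_0 by blast
  have e\<xi>: "e \<bullet> fst (snd p) = t"
    using t by (simp add: e_def sgn_div_norm t_def dot_square_norm power2_eq_square)
  have zero: "(0::real^'n, 0::real^'l) = 0" by (simp add: zero_prod_def)
  have \<kappa>p: "\<kappa> p = - (V * \<rho> / (W * f z * t))"
    by (simp add: \<kappa>_def cp Rp z_def t_def)
  have R'1: "R' (fst (G z), 0, snd (G z)) = - (r' * t * P / (u z)\<^sup>2)"
    by (simp add: R'_def P_def)
  have R'2: "R' (0, fst (snd p), 0) = r' * t / u z"
    by (simp add: R'_def e\<xi> zero)
  have W2'1: "W2' (fst (G z), 0, snd (G z)) = 2 * Q - 2 * \<rho> * r' * t * P / ((u z)\<^sup>2 * f z) - \<rho>\<^sup>2 * s / (f z)\<^sup>2"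
    by (simp add: W2'_def R'1 Q s_def)
  have W2'2: "W2' (0, fst (snd p), 0) = 2 * \<rho> * r' * t / (u z * f z)"
    by (simp add: W2'_def R'2 zero H0)
  have c'1: "c' (fst (G z), 0, snd (G z)) = V * (real CARD('m) * s / (2 * f z) / W -
      (2 * Q - 2 * \<rho> * r' * t * P / ((u z)\<^sup>2 * f z) - \<rho>\<^sup>2 * s / (f z)\<^sup>2) / (2 * W ^ 3))"
    unfolding c'_def W2'1 by (simp add: s_def)
  have c'2: "c' (0, fst (snd p), 0) = - V * \<rho> * r' * t / (u z * f z * W ^ 3)"
    unfolding c'_def W2'2 by (simp add: zero)
  have \<kappa>'2: "\<kappa>' (0, fst (snd p), 0) = V * (\<rho>\<^sup>2 * r' / (u z * (f z)\<^sup>2 * W ^ 3) - r' / (W * f z * u z) + \<rho> / (W * f z * t))"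
    unfolding \<kappa>'_def c'2 R'2 e\<xi> using tp fz Wpos u(2) 
    by (simp add: zero e\<xi> field_simps power2_eq_square)
  have "W ^ 3 * metric_div (warped_metric f) ?X p =
    W\<^sup>2 * (real CARD('m) * s / (2 * f z) + L - (real CARD('m) - 1) * \<rho> / (f z * t))
    - Q + \<rho> * r' * t * P / ((u z)\<^sup>2 * f z) + \<rho>\<^sup>2 * s / (2 * (f z)\<^sup>2) + \<rho>\<^sup>2 * r' / (u z * (f z)\<^sup>2)
     - W\<^sup>2 * r' / (f z * u z)"
    unfolding div L c'1 \<kappa>'2 \<kappa>p using tp fz Wpos u(2) Vpos
    by (simp add: field_simps power2_eq_square power3_eq_cube)
  \<comment> \<open>Only in the last term is W^2 expanded as P + \<rho>^2 / f: its second part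
    cancels \<rho>^2 r' / (u f^2), and the first combines with \<rho> r' t P / (u^2 f).\<close>
  also have "\<dots> = W\<^sup>2 * (real CARD('m) * s / (2 * f z) + L - (real CARD('m) - 1) * \<rho> / (f z * t))
    - Q + \<rho>\<^sup>2 * s / (2 * (f z)\<^sup>2) + P * r' * (\<rho> * t / u z - 1) / (f z * u z)"
    using fz u(2) unfolding Wsq[THEN arg_cong[where f = "\<lambda>a. a * r' / (f z * u z)"]]
    by (simp add: field_simps power2_eq_square)
  finally show "W ^ 3 * metric_div (warped_metric f) ?X p =
    W\<^sup>2 * (real CARD('m) * (grad f z \<bullet> grad u z) / (2 * f z) + laplacian u z - (real CARD('m) - 1) * \<rho> / (f z * t))
    - hess_grad_grad u z + \<rho>\<^sup>2 * (grad f z \<bullet> grad u z) / (2 * (f z)\<^sup>2)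
    + (norm (grad u z))\<^sup>2 * r' * (\<rho> * t / u z - 1) / (f z * u z)"
    unfolding nP s_def L_def Q_def G_def .
qed

section \<open>Comparison with radial functions\<close>

lemma deriv_norm_1: "deriv_norm 1 F z = norm (grad F z)"
proof -
  have "{vs. length vs = 1 \<and> set vs \<subseteq> Basis} = (\<lambda>i::'a. [i]) ` Basis"
    by (auto simp: length_Suc_conv)
  then have "(\<Sum>vs \<in> {vs. length vs = 1 \<and> set vs \<subseteq> Basis}. (iter_partial vs F z)\<^sup>2) =
      (\<Sum>i\<in>Basis. (iter_partial [i] F z)\<^sup>2)"
    by (simp add: sum.reindex inj_on_def)
  also have "\<dots> = (norm (grad F z))\<^sup>2"
    unfolding power2_norm_eq_inner by (subst euclidean_inner) (simp add: grad_inner_Basis power2_eq_square)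
  finally show ?thesis by (simp add: deriv_norm_def)
qed

lemma deriv_norm_2:
  fixes F :: "'a::euclidean_space \<Rightarrow> real"
  shows "deriv_norm 2 F z = sqrt (\<Sum>(i, j)\<in>Basis \<times> Basis. (iter_partial [i, j] F z)\<^sup>2)"
proof -
  have "{vs. length vs = 2 \<and> set vs \<subseteq> Basis} = (\<lambda>(i::'a, j). [i, j]) ` (Basis \<times> Basis)"
  proof -
    have "length vs = 2 \<longleftrightarrow> (\<exists>i j. vs = [i, j])" for vs :: "'a list"
      by (auto simp: length_Suc_conv numeral_2_eq_2)
    then show ?thesis by (auto simp: image_iff)
  qed
  then have "(\<Sum>vs \<in> {vs. length vs = 2 \<and> set vs \<subseteq> Basis}. (iter_partial vs F z)\<^sup>2) =
      (\<Sum>(i, j)\<in>Basis \<times> Basis. (iter_partial [i, j] F z)\<^sup>2)"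
    by (simp add: sum.reindex inj_on_def case_prod_beta del: iter_partial.simps)
  then show ?thesis by (simp only: deriv_norm_def)
qed

text \<open>Cauchy-Schwarz over pairs of basis vectors. It keeps the factor |v|^2, which for v = Du
  makes the Hessian error proportional to |Du|^2.\<close>

lemma hess_quadratic_bound:
  fixes F :: "'a::euclidean_space \<Rightarrow> real"
  shows "\<bar>\<Sum>i\<in>Basis. \<Sum>j\<in>Basis. (v \<bullet> i) * (v \<bullet> j) * iter_partial [i, j] F z\<bar> \<le> (norm v)\<^sup>2 * deriv_norm 2 F z"
proof -
  let ?B = "Basis \<times> Basis :: ('a \<times> 'a) set"
  have "(\<Sum>i\<in>Basis. \<Sum>j\<in>Basis. (v \<bullet> i) * (v \<bullet> j) * iter_partial [i, j] F z)\<^sup>2 =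
    (\<Sum>p\<in>?B. ((v \<bullet> fst p) * (v \<bullet> snd p)) * iter_partial [fst p, snd p] F z)\<^sup>2"
    by (simp add: sum.cartesian_product case_prod_beta del: iter_partial.simps)
  also have "\<dots> \<le> (\<Sum>p\<in>?B. ((v \<bullet> fst p) * (v \<bullet> snd p))\<^sup>2) * (\<Sum>p\<in>?B. (iter_partial [fst p, snd p] F z)\<^sup>2)"
    by (rule Cauchy_Schwarz_ineq_sum)
  also have "(\<Sum>p\<in>?B. ((v \<bullet> fst p) * (v \<bullet> snd p))\<^sup>2) = ((norm v)\<^sup>2)\<^sup>2"
  proof -
    have "(norm v)\<^sup>2 = (\<Sum>i\<in>Basis. (v \<bullet> i)\<^sup>2)"
      unfolding power2_norm_eq_inner by (subst euclidean_inner) (simp add: power2_eq_square)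
    then show ?thesis
      by (simp add: power2_eq_square[of "sum _ _"] sum_product sum.cartesian_product case_prod_beta power_mult_distrib)
  qed
  also have "(\<Sum>p\<in>?B. (iter_partial [fst p, snd p] F z)\<^sup>2) = (deriv_norm 2 F z)\<^sup>2"
    unfolding deriv_norm_2 by (simp add: case_prod_beta sum_nonneg del: iter_partial.simps)
  also have "((norm v)\<^sup>2)\<^sup>2 * (deriv_norm 2 F z)\<^sup>2 = ((norm v)\<^sup>2 * deriv_norm 2 F z)\<^sup>2"
    by (simp add: power_mult_distrib)
  finally show ?thesis
    by (rule abs_le_square_iff[THEN iffD2, THEN order_trans])
      (simp add: deriv_norm_def sum_nonneg)
qed

lemma laplacian_bound:
  fixes F :: "'a::euclidean_space \<Rightarrow> real"
  shows "\<bar>laplacian F z\<bar> \<le> real DIM('a) * deriv_norm 2 F z"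
proof -
  have "\<bar>iter_partial [i, i] F z\<bar> \<le> deriv_norm 2 F z" if "i \<in> Basis" for i
  proof -
    have "(iter_partial [i, i] F z)\<^sup>2 \<le> (\<Sum>p\<in>Basis \<times> Basis. (iter_partial [fst p, snd p] F z)\<^sup>2)"
      using member_le_sum[of "(i, i)" "Basis \<times> Basis" "\<lambda>p. (iter_partial [fst p, snd p] F z)\<^sup>2"] that
      by (simp del: iter_partial.simps)
    then show ?thesis unfolding deriv_norm_2
      by (simp add: case_prod_beta real_le_rsqrt del: iter_partial.simps)
  qed
  then have "\<bar>laplacian F z\<bar> \<le> (\<Sum>i\<in>(Basis::'a set). deriv_norm 2 F z)"
    unfolding laplacian_def by (intro order_trans[OF sum_abs] sum_mono) blast
  then show ?thesis by simp
qed

lemma sum_grad_fst: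
  fixes G :: "'a::euclidean_space \<times> 'b::euclidean_space"
  shows "(\<Sum>i\<in>Basis. (G \<bullet> i) * (v \<bullet> fst i)) = v \<bullet> fst G"
proof -
  have "(v, 0) \<bullet> G = (\<Sum>i\<in>Basis. ((v, 0) \<bullet> i) * (G \<bullet> i))" by (rule euclidean_inner)
  then show ?thesis by (simp add: inner_prod_def mult.commute)
qed

lemma norm_fst_has_derivative:
  fixes z :: "'a::euclidean_space \<times> 'b::euclidean_space"
  assumes "fst z \<noteq> 0"
  shows "((\<lambda>q. norm (fst q)) has_derivative (\<lambda>w. sgn (fst z) \<bullet> fst w)) (at z)"
proof -
  have "(fst has_derivative fst) (at z)" by (rule has_derivative_fst[OF has_derivative_ident])
  from has_derivative_compose[OF this has_derivative_norm[OF assms]] show ?thesis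
    by (simp only: inner_commute)
qed

text \<open>u does not change when a point is moved to the ray through x at the same radius (the map
  \<open>N\<close>). Differentiating u = u o N at (x, y) leaves only the radial part of the
  x-gradient. This is needed because the Hessian of a radial function has the unwanted tangential
  eigenvalue \<psi>' / r.\<close>

lemma radial_gradient:
  fixes u :: "'a::euclidean_space \<times> 'b::euclidean_space \<Rightarrow> real"
  assumes rad: "\<And>x x' y. norm x = norm x' \<Longrightarrow> u (x, y) = u (x', y)"
    and x: "x \<noteq> 0" and u: "u differentiable (at (x, y))"
  obtains A where "fst (grad u (x, y)) = A *\<^sub>R x"
proof -
  let ?G = "grad u (x, y)"
  have u': "(u has_derivative (\<lambda>w. ?G \<bullet> w)) (at (x, y))"
    using frechet_derivative_works[THEN iffD1, OF u] unfolding grad_inner[OF u] .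
  define N where "N = (\<lambda>q::'a \<times> 'b. ((norm (fst q) / norm x) *\<^sub>R x, snd q))"
  have n: "((\<lambda>q::'a \<times> 'b. norm (fst q)) has_derivative (\<lambda>w. sgn x \<bullet> fst w)) (at (x, y))"
    using norm_fst_has_derivative[of "(x, y)"] x by simp
  have "((\<lambda>q::'a \<times> 'b. norm (fst q) / norm x) has_derivative (\<lambda>w. (sgn x \<bullet> fst w) / norm x)) (at (x, y))"
    using has_derivative_mult_left[OF n, of "inverse (norm x)"] by (simp add: divide_inverse)
  from has_derivative_Pair[OF has_derivative_scaleR_left[OF this] has_derivative_snd[OF has_derivative_ident]]
  have N': "(N has_derivative (\<lambda>w. (((sgn x \<bullet> fst w) / norm x) *\<^sub>R x, snd w))) (at (x, y))"
    unfolding N_def .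
  have Nx: "N (x, y) = (x, y)" using x by (simp add: N_def)
  have "((\<lambda>q. u (N q)) has_derivative (\<lambda>w. ?G \<bullet> (((sgn x \<bullet> fst w) / norm x) *\<^sub>R x, snd w))) (at (x, y))"
    by (rule has_derivative_compose[OF N']) (unfold Nx, rule u')
  moreover have "u (N q) = u q" for q
    using rad[of "(norm (fst q) / norm x) *\<^sub>R x" "fst q" "snd q"] x by (simp add: N_def)
  ultimately have *: "(u has_derivative (\<lambda>w. ?G \<bullet> (((sgn x \<bullet> fst w) / norm x) *\<^sub>R x, snd w))) (at (x, y))"
    by simp
  have "fst ?G \<bullet> v = (((fst ?G \<bullet> x) / norm x) *\<^sub>R sgn x) \<bullet> v" for v
  proof -
    have "?G \<bullet> (v, 0) = ?G \<bullet> (((sgn x \<bullet> v) / norm x) *\<^sub>R x, 0)"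
      using fun_cong[OF has_derivative_unique[OF u' *], of "(v, 0)"] by (simp only: fst_conv snd_conv)
    then show ?thesis unfolding inner_prod_def by (simp only: fst_conv snd_conv) simp
  qed
  then have "fst ?G = ((fst ?G \<bullet> x) / norm x) *\<^sub>R sgn x"
    by (intro vector_eq_rdot[THEN iffD1]) blast
  also have "\<dots> = ((fst ?G \<bullet> x) / norm x / norm x) *\<^sub>R x" by (simp add: sgn_div_norm divide_inverse)
  finally show thesis by (rule that)
qed

lemma frechet_derivative_eqI: "(F has_derivative F') (at z) \<Longrightarrow> frechet_derivative F (at z) = F'"
  by (rule frechet_derivative_at[symmetric])

lemma radial_first_derivative:
  fixes z :: "'a::euclidean_space \<times> 'b::euclidean_space"
  assumes \<psi>: "(\<psi> has_real_derivative \<psi>1) (at (norm (fst z)))" and z: "fst z \<noteq> 0"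
  shows "((\<lambda>q. \<psi> (norm (fst q))) has_derivative (\<lambda>w. \<psi>1 / norm (fst z) * (fst z \<bullet> fst w))) (at z)"
proof -
  from DERIV_compose_FDERIV[OF \<psi> norm_fst_has_derivative[OF z]] show ?thesis
    by (simp add: sgn_div_norm divide_inverse mult_ac)
qed

lemma radial_second_derivative:
  fixes z :: "'a::euclidean_space \<times> 'b::euclidean_space"
  assumes \<psi>: "(\<psi>1 has_real_derivative \<psi>2) (at (norm (fst z)))" and z: "fst z \<noteq> 0"
  shows "((\<lambda>q. \<psi>1 (norm (fst q)) / norm (fst q) * (fst q \<bullet> v)) has_derivative
    (\<lambda>w. (\<psi>2 - \<psi>1 (norm (fst z)) / norm (fst z)) / (norm (fst z))\<^sup>2 * (fst z \<bullet> fst w) * (fst z \<bullet> v)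
      + \<psi>1 (norm (fst z)) / norm (fst z) * (fst w \<bullet> v))) (at z)"
proof -
  let ?r = "norm (fst z)"
  have "((\<lambda>\<rho>. \<psi>1 \<rho> / \<rho>) has_real_derivative (\<psi>2 * ?r - \<psi>1 ?r) / (?r * ?r)) (at ?r)"
    using z by (auto intro!: derivative_eq_intros \<psi>)
  from radial_first_derivative[OF this z]
  have 1: "((\<lambda>q. \<psi>1 (norm (fst q)) / norm (fst q)) has_derivative
     (\<lambda>w. (\<psi>2 * ?r - \<psi>1 ?r) / (?r * ?r) / ?r * (fst z \<bullet> fst w))) (at z)" .
  have 2: "((\<lambda>q::'a \<times> 'b. fst q \<bullet> v) has_derivative (\<lambda>w. fst w \<bullet> v)) (at z)"
    by (auto intro!: derivative_eq_intros)
  have 3: "(\<psi>2 * ?r - \<psi>1 ?r) / (?r * ?r) / ?r = (\<psi>2 - \<psi>1 ?r / ?r) / ?r\<^sup>2"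
    using z by (simp add: field_simps power2_eq_square)
  show ?thesis
    by (rule has_derivative_eq_rhs[OF has_derivative_mult[OF 1 2]]) (rule ext, simp only: 3 add.commute)
qed

text \<open>The Hessian of \<psi>(|x|) has eigenvalue \<psi>'' in the radial direction, \<psi>' / r
  in the tangential ones and 0 along y. As the x-part of Du is radial, D^2\<psi>(Du, Du) is \<psi>''
  times the square of that part, at most \<psi>'' |Du|^2 since \<psi>'' \<ge> 0. The remaining terms
  come from D^2w.\<close>

lemma radial_comparison:
  fixes u :: "'a::euclidean_space \<times> 'b::euclidean_space \<Rightarrow> real"
    and \<psi> \<psi>1 \<psi>2 :: "real \<Rightarrow> real"
  defines "r \<equiv> \<lambda>q::'a \<times> 'b. norm (fst q)"
  defines "w \<equiv> \<lambda>q. u q - \<psi> (r q)"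
  assumes deriv: "\<forall>\<rho>>0. (\<psi> has_real_derivative \<psi>1 \<rho>) (at \<rho>) \<and> (\<psi>1 has_real_derivative \<psi>2 \<rho>) (at \<rho>)"
    and S: "open S" "z \<in> S" "\<forall>q\<in>S. u differentiable (at q)"
    and second: "\<forall>i\<in>Basis. iter_partial [i] u differentiable (at z)"
    and rad: "fst (grad u z) = B *\<^sub>R fst z" and z: "fst z \<noteq> 0" and pos: "\<psi>2 (r z) \<ge> 0"
  shows "\<bar>norm (grad u z) - \<bar>\<psi>1 (r z)\<bar>\<bar> \<le> deriv_norm 1 w z"
    and "hess_grad_grad u z \<le> (norm (grad u z))\<^sup>2 * (\<psi>2 (r z) + deriv_norm 2 w z)"
    and "laplacian u z \<ge> \<psi>2 (r z) + (real DIM('a) - 1) * \<psi>1 (r z) / r z - real DIM('a \<times> 'b) * deriv_norm 2 w z"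
proof -
  have \<psi>: "\<And>\<rho>. \<rho> > 0 \<Longrightarrow> (\<psi> has_real_derivative \<psi>1 \<rho>) (at \<rho>)"
      "\<And>\<rho>. \<rho> > 0 \<Longrightarrow> (\<psi>1 has_real_derivative \<psi>2 \<rho>) (at \<rho>)"
    and u2: "\<And>i. i \<in> Basis \<Longrightarrow> iter_partial [i] u differentiable (at z)"
    using deriv second by blast+
  define \<Psi> where "\<Psi> = (\<lambda>q::'a \<times> 'b. \<psi> (norm (fst q)))"
  define S' where "S' = S \<inter> {q. fst q \<noteq> 0}"
  have S': "open S'" "z \<in> S'"
  proof -
    have "open {q::'a \<times> 'b. fst q \<noteq> 0}" by (intro open_Collect_neq continuous_intros)
    then show "open S'" using S by (auto simp: S'_def)
    show "z \<in> S'" using S z by (simp add: S'_def)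
  qed
  have d\<Psi>: "(\<Psi> has_derivative (\<lambda>w. \<psi>1 (norm (fst q)) / norm (fst q) * (fst q \<bullet> fst w))) (at q)" if "q \<in> S'" for q
    unfolding \<Psi>_def by (rule radial_first_derivative[OF \<psi>(1)]) (use that in \<open>auto simp: S'_def\<close>)
  have p\<Psi>: "iter_partial [i] \<Psi> q = \<psi>1 (norm (fst q)) / norm (fst q) * (fst q \<bullet> fst i)" if "q \<in> S'" for i q
    using frechet_derivative_eqI[OF d\<Psi>[OF that]] by simp
  have pw: "iter_partial [i] w q = iter_partial [i] u q - \<psi>1 (norm (fst q)) / norm (fst q) * (fst q \<bullet> fst i)"
    if "q \<in> S'" for i q
  proof -
    have "u differentiable (at q)" using that S by (simp add: S'_def)
    from has_derivative_diff[OF frechet_derivative_works[THEN iffD1, OF this] d\<Psi>[OF that]]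
    have "(w has_derivative (\<lambda>h. frechet_derivative u (at q) h - \<psi>1 (norm (fst q)) / norm (fst q) * (fst q \<bullet> fst h))) (at q)"
      by (simp add: w_def \<Psi>_def r_def)
    from frechet_derivative_eqI[OF this] show ?thesis by simp
  qed
  define \<alpha> where "\<alpha> = (\<psi>2 (r z) - \<psi>1 (r z) / r z) / (r z)\<^sup>2"
  define \<beta> where "\<beta> = \<psi>1 (r z) / r z"
  have pw2: "iter_partial [j, i] u z = iter_partial [j, i] w z + (\<alpha> * (fst z \<bullet> fst j) * (fst z \<bullet> fst i) + \<beta> * (fst j \<bullet> fst i))"
    if "i \<in> Basis" for i j
  proof -
    have 1: "((\<lambda>q. \<psi>1 (norm (fst q)) / norm (fst q) * (fst q \<bullet> fst i)) has_derivative
      (\<lambda>w. \<alpha> * (fst z \<bullet> fst w) * (fst z \<bullet> fst i) + \<beta> * (fst w \<bullet> fst i))) (at z)"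
      unfolding \<alpha>_def \<beta>_def r_def by (rule radial_second_derivative[OF \<psi>(2) z]) (use z in simp)
    note 2 = has_derivative_diff[OF frechet_derivative_works[THEN iffD1, OF u2[OF that]] 1]
    have "(iter_partial [i] w has_derivative (\<lambda>h. frechet_derivative (iter_partial [i] u) (at z) h -
       (\<alpha> * (fst z \<bullet> fst h) * (fst z \<bullet> fst i) + \<beta> * (fst h \<bullet> fst i)))) (at z)"
      by (rule has_derivative_transform_within_open[OF 2 S']) (simp add: pw del: iter_partial.simps)
    from frechet_derivative_eqI[OF this]
    have "iter_partial [j, i] w z = frechet_derivative (iter_partial [i] u) (at z) j -
       (\<alpha> * (fst z \<bullet> fst j) * (fst z \<bullet> fst i) + \<beta> * (fst j \<bullet> fst i))"
      by (subst iter_partial.simps(2)) simp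
    then show ?thesis by simp
  qed
  have rz: "r z > 0" using z by (simp add: r_def)
  have xx: "fst z \<bullet> fst z = (r z)\<^sup>2" by (simp add: r_def power2_norm_eq_inner)
  let ?G = "grad u z"
  have "?G - grad w z = (\<beta> *\<^sub>R fst z, 0)"
  proof (rule euclidean_eqI)
    fix i :: "'a \<times> 'b" assume i: "i \<in> Basis"
    show "(?G - grad w z) \<bullet> i = (\<beta> *\<^sub>R fst z, 0) \<bullet> i"
      unfolding inner_diff_left grad_inner_Basis[OF i] pw[OF S'(2)] \<beta>_def r_def
      by (simp add: inner_prod_def)
  qed
  moreover have "norm (\<beta> *\<^sub>R fst z, 0::'b) = \<bar>\<psi>1 (r z)\<bar>"
    using rz by (simp add: norm_Pair \<beta>_def r_def)
  ultimately have "norm (?G - grad w z) = \<bar>\<psi>1 (r z)\<bar>" by simp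
  then show "\<bar>norm (grad u z) - \<bar>\<psi>1 (r z)\<bar>\<bar> \<le> deriv_norm 1 w z"
    unfolding deriv_norm_1 using norm_triangle_ineq3[of ?G "?G - grad w z"] by simp
  show "hess_grad_grad u z \<le> (norm ?G)\<^sup>2 * (\<psi>2 (r z) + deriv_norm 2 w z)"
  proof -
    have "hess_grad_grad u z = (\<Sum>i\<in>Basis. \<Sum>j\<in>Basis. (?G \<bullet> i) * (?G \<bullet> j) * (iter_partial [i, j] w z
        + (\<alpha> * (fst z \<bullet> fst i) * (fst z \<bullet> fst j) + \<beta> * (fst i \<bullet> fst j))))"
      unfolding hess_grad_grad_def
      by (intro sum.cong refl) (simp only: pw2 grad_inner_Basis)
    also have "\<dots> = (\<Sum>i\<in>Basis. \<Sum>j\<in>Basis. (?G \<bullet> i) * (?G \<bullet> j) * iter_partial [i, j] w z)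
      + (\<Sum>i\<in>Basis. \<Sum>j\<in>Basis. \<alpha> * (((?G \<bullet> i) * (fst z \<bullet> fst i)) * ((?G \<bullet> j) * (fst z \<bullet> fst j))))
      + (\<Sum>i\<in>Basis. \<Sum>j\<in>Basis. \<beta> * ((?G \<bullet> i) * ((?G \<bullet> j) * (fst i \<bullet> fst j))))"
      unfolding sum.distrib[symmetric] by (intro sum.cong refl) (simp add: algebra_simps del: iter_partial.simps)
    also have "(\<Sum>i\<in>Basis. \<Sum>j\<in>Basis. \<alpha> * (((?G \<bullet> i) * (fst z \<bullet> fst i)) * ((?G \<bullet> j) * (fst z \<bullet> fst j)))) =
      \<alpha> * (fst z \<bullet> fst ?G)\<^sup>2"
      unfolding sum_grad_fst[of ?G "fst z", symmetric] power2_eq_square unfolding sum_product unfolding sum_distrib_left ..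
    also have "(\<Sum>i\<in>Basis. \<Sum>j\<in>Basis. \<beta> * ((?G \<bullet> i) * ((?G \<bullet> j) * (fst i \<bullet> fst j)))) = \<beta> * (fst ?G \<bullet> fst ?G)"
    proof -
      have "(\<Sum>i\<in>Basis. \<Sum>j\<in>Basis. \<beta> * ((?G \<bullet> i) * ((?G \<bullet> j) * (fst i \<bullet> fst j)))) =
          (\<Sum>i\<in>Basis. \<beta> * ((?G \<bullet> i) * (fst i \<bullet> fst ?G)))"
        unfolding sum_distrib_left[symmetric] sum_grad_fst ..
      also have "\<dots> = (\<Sum>i\<in>Basis. \<beta> * ((?G \<bullet> i) * (fst ?G \<bullet> fst i)))"
        by (intro sum.cong refl arg_cong2[where f = "(*)"] inner_commute)
      also have "\<dots> = \<beta> * (fst ?G \<bullet> fst ?G)"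
        unfolding sum_grad_fst[of ?G "fst ?G", symmetric] sum_distrib_left ..
      finally show ?thesis .
    qed
    \<comment> \<open>Equality in Cauchy-Schwarz for the parallel vectors \<open>fst ?G\<close> and
      \<open>fst z\<close>; the term with \<psi>1 / r then cancels against
      \<open>\<beta>\<close>.\<close>
    also have "\<alpha> * (fst z \<bullet> fst ?G)\<^sup>2 = (\<psi>2 (r z) - \<psi>1 (r z) / r z) * (fst ?G \<bullet> fst ?G)"
      unfolding rad using rz by (simp add: xx \<alpha>_def power2_eq_square)
    also have "(\<Sum>i\<in>Basis. \<Sum>j\<in>Basis. (?G \<bullet> i) * (?G \<bullet> j) * iter_partial [i, j] w z)
        + (\<psi>2 (r z) - \<psi>1 (r z) / r z) * (fst ?G \<bullet> fst ?G) + \<beta> * (fst ?G \<bullet> fst ?G)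
      = (\<Sum>i\<in>Basis. \<Sum>j\<in>Basis. (?G \<bullet> i) * (?G \<bullet> j) * iter_partial [i, j] w z) + \<psi>2 (r z) * (fst ?G \<bullet> fst ?G)"
      by (simp add: \<beta>_def algebra_simps del: iter_partial.simps)
    also have "\<dots> \<le> (norm ?G)\<^sup>2 * deriv_norm 2 w z + \<psi>2 (r z) * (norm ?G)\<^sup>2"
    proof (intro add_mono mult_left_mono pos)
      show "(\<Sum>i\<in>Basis. \<Sum>j\<in>Basis. (?G \<bullet> i) * (?G \<bullet> j) * iter_partial [i, j] w z) \<le> (norm ?G)\<^sup>2 * deriv_norm 2 w z"
        by (rule order_trans[OF abs_ge_self hess_quadratic_bound])
      show "fst ?G \<bullet> fst ?G \<le> (norm ?G)\<^sup>2" by (simp add: power2_norm_eq_inner inner_prod_def)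
    qed
    finally show ?thesis by (simp add: algebra_simps)
  qed
  show "laplacian u z \<ge> \<psi>2 (r z) + (real DIM('a) - 1) * \<psi>1 (r z) / r z - real DIM('a \<times> 'b) * deriv_norm 2 w z"
  proof -
    have "laplacian u z = laplacian w z + \<alpha> * (\<Sum>i\<in>(Basis::('a \<times> 'b) set). (fst z \<bullet> fst i) * (fst z \<bullet> fst i))
        + \<beta> * (\<Sum>i\<in>(Basis::('a \<times> 'b) set). fst i \<bullet> fst i)"
    proof -
      have "laplacian u z = (\<Sum>i\<in>Basis. iter_partial [i, i] w z +
          (\<alpha> * ((fst z \<bullet> fst i) * (fst z \<bullet> fst i)) + \<beta> * (fst i \<bullet> fst i)))"
        unfolding laplacian_def by (intro sum.cong refl) (simp only: pw2 mult.assoc)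
      then show ?thesis unfolding laplacian_def sum.distrib sum_distrib_left by (simp only: add.assoc)
    qed
    also have "(\<Sum>i\<in>(Basis::('a \<times> 'b) set). (fst z \<bullet> fst i) * (fst z \<bullet> fst i)) = (r z)\<^sup>2"
      unfolding xx[symmetric] using euclidean_inner[of "fst z" "fst z"]
      by (simp add: sum_Basis_pair)
    also have "(\<Sum>i\<in>(Basis::('a \<times> 'b) set). fst i \<bullet> fst i) = real DIM('a)"
      by (simp add: sum_Basis_pair)
    also have "laplacian w z + \<alpha> * (r z)\<^sup>2 + \<beta> * real DIM('a) =
        laplacian w z + (\<psi>2 (r z) + (real DIM('a) - 1) * \<psi>1 (r z) / r z)"
      using rz by (simp add: \<alpha>_def \<beta>_def field_simps)
    finally show ?thesis using laplacian_bound[of w z] by linarith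
  qed
qed

section \<open>The two model functions: the cone and the rescaled profile\<close>

text \<open>The upper bound integrates \<phi>' \<le> \<alpha>, that is P \<le> 1; the lower one
  integrates \<phi> \<phi>' \<ge> b r / (2 a), that is Y \<ge> 1/2. Together they make \<phi>
  comparable to 1 + r, which converts the weight \<lambda> + |x| of the core estimates into the
  model function itself.\<close>

lemma (in barrier) profile_growth:
  fixes D :: "nat \<Rightarrow> real \<Rightarrow> real"
  assumes sol: "profile_derivs a b D"
    and r: "r > 0"
  shows "D 0 r \<le> 1 + sqrt (b / a) * r" and "min 1 (sqrt (b / (2 * a))) / 2 * (1 + r) \<le> D 0 r"
proof -
  have deriv: "\<And>k r. r \<ge> 0 \<Longrightarrow> (D k has_real_derivative D (Suc k) r) (at r within {0..})"
    and init: "D 0 0 = 1" "D 1 0 = 0" and ge1: "\<And>r. r \<ge> 0 \<Longrightarrow> 1 \<le> D 0 r"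
    and ode: "\<And>r. r > 0 \<Longrightarrow> D 2 r * D 0 r / (1 + (D 1 r)\<^sup>2) + a / r * D 0 r * D 1 r = b"
    using sol by (auto simp only: profile_derivs_def)
  have der: "(D 0 has_real_derivative D 1 r) (at r)" if "r > 0" for r
    using deriv[of r 0] that at_within_interior[of r "{0..}"] by simp
  have cont: "continuous_on {0..r} (D 0)"
  proof -
    have "continuous (at x within {0..}) (D 0)" if "x \<ge> 0" for x
      using DERIV_continuous[OF deriv[OF that]] .
    then have "continuous_on {0..} (D 0)" by (simp add: continuous_on_eq_continuous_within)
    then show ?thesis by (rule continuous_on_subset) auto
  qed
  note est = profile_in_barrier[OF sol]
  have D1: "D 1 x \<le> sqrt (b / a)" if "x > 0" for x
  proof -
    have "(D 1 x)\<^sup>2 \<le> b / a" using est(1)[OF that] a b by (simp add: field_simps)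
    then show ?thesis by (rule real_le_rsqrt)
  qed
  have "D 0 r - sqrt (b / a) * r \<le> D 0 0 - sqrt (b / a) * 0"
  proof (rule DERIV_nonpos_imp_decreasing_open[where f = "\<lambda>x. D 0 x - sqrt (b / a) * x"])
    show "\<exists>y. ((\<lambda>x. D 0 x - sqrt (b / a) * x) has_real_derivative y) (at x) \<and> y \<le> 0" if "0 < x" "x < r" for x
      using D1[OF that(1)] der[OF that(1)]
      by (intro exI[of _ "D 1 x - sqrt (b / a)"]) (auto intro!: derivative_eq_intros)
    show "continuous_on {0..r} (\<lambda>x. D 0 x - sqrt (b / a) * x)" by (intro continuous_intros cont)
  qed (use r in simp)
  then show "D 0 r \<le> 1 + sqrt (b / a) * r" using init by simp
  define \<beta> where "\<beta> = b / (2 * a)"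
  have \<beta>: "\<beta> > 0" using a b by (simp add: \<beta>_def)
  have DD: "D 0 x * D 1 x \<ge> \<beta> * x" if "x > 0" for x
  proof -
    have P: "0 \<le> (D 1 x)\<^sup>2 * a / b" using a b by simp
    have "1 - D 0 x * D 1 x / x * a / b < 1/2"
      using est(3)[OF that] g_bounds(2)[OF P] est(1)[OF that] by simp
    then show ?thesis using that a b by (simp add: \<beta>_def field_simps)
  qed
  have "(D 0 0)\<^sup>2 - \<beta> * 0\<^sup>2 \<le> (D 0 r)\<^sup>2 - \<beta> * r\<^sup>2"
  proof (rule DERIV_nonneg_imp_increasing_open[where f = "\<lambda>x. (D 0 x)\<^sup>2 - \<beta> * x\<^sup>2"])
    show "\<exists>y. ((\<lambda>x. (D 0 x)\<^sup>2 - \<beta> * x\<^sup>2) has_real_derivative y) (at x) \<and> 0 \<le> y" if "0 < x" "x < r" for x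
    proof (intro exI conjI)
      show "((\<lambda>x. (D 0 x)\<^sup>2 - \<beta> * x\<^sup>2) has_real_derivative 2 * (D 0 x * D 1 x) - 2 * (\<beta> * x)) (at x)"
        by (rule derivative_eq_intros der[OF that(1)] refl)+ simp
      show "0 \<le> 2 * (D 0 x * D 1 x) - 2 * (\<beta> * x)" using DD[OF that(1)] by simp
    qed
    show "continuous_on {0..r} (\<lambda>x. (D 0 x)\<^sup>2 - \<beta> * x\<^sup>2)" by (intro continuous_intros cont)
  qed (use r in simp)
  moreover have "(sqrt \<beta> * r)\<^sup>2 = \<beta> * r\<^sup>2" using \<beta> by (simp add: power_mult_distrib)
  ultimately have sq: "(sqrt \<beta> * r)\<^sup>2 \<le> (D 0 r)\<^sup>2" unfolding init by simp
  have 1: "sqrt \<beta> * r \<le> D 0 r"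
  proof (rule power2_le_imp_le[OF sq])
    show "0 \<le> D 0 r" using ge1[of r] r by linarith
  qed
  have 2: "1 \<le> D 0 r" using ge1[of r] r by simp
  define e where "e = min 1 (sqrt \<beta>)"
  have "e * r \<le> sqrt \<beta> * r" "e \<le> 1" using r by (auto simp: e_def intro!: mult_right_mono)
  then have "e + e * r \<le> 2 * D 0 r" using 1 2 by linarith
  then show "min 1 (sqrt (b / (2 * a))) / 2 * (1 + r) \<le> D 0 r"
    unfolding \<beta>_def[symmetric] e_def[symmetric] by (simp add: distrib_left)
qed

lemma deriv_norm_locally_zero:
  assumes T: "open T" "z \<in> T" and w: "\<And>q. q \<in> T \<Longrightarrow> w q = 0"
  shows "deriv_norm 1 w z = 0" "deriv_norm 2 w z = 0"
proof -
  have 1: "iter_partial [i] w q = 0" if "q \<in> T" for i q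
  proof -
    have "(w has_derivative (\<lambda>h. 0)) (at q)"
      by (rule has_derivative_transform_within_open[OF has_derivative_const T(1) that]) (simp add: w)
    from frechet_derivative_eqI[OF this] show ?thesis by simp
  qed
  have 2: "iter_partial [i, j] w z = 0" for i j
  proof -
    have "(iter_partial [j] w has_derivative (\<lambda>h. 0)) (at z)"
      by (rule has_derivative_transform_within_open[OF has_derivative_const T]) (simp add: 1 del: iter_partial.simps)
    from frechet_derivative_eqI[OF this] show ?thesis by (subst iter_partial.simps(2)) simp
  qed
  show "deriv_norm 1 w z = 0" unfolding deriv_norm_1 grad_def by (simp add: 1[OF T(2)] del: iter_partial.simps)
  show "deriv_norm 2 w z = 0" unfolding deriv_norm_2 by (simp add: 2 del: iter_partial.simps)
qed

lemma deriv_norm_0: "deriv_norm 0 F z = \<bar>F z\<bar>"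
proof -
  have "{vs::'a list. length vs = 0 \<and> set vs \<subseteq> Basis} = {[]}" by auto
  then show ?thesis by (simp add: deriv_norm_def)
qed

text \<open>
  The radial function \<open>\<psi>\<close>, with derivatives \<open>\<psi>1\<close> and \<open>\<psi>2\<close>, is a solution of the profile equation
  (the cone or a rescaled profile) that satisfies the barrier estimate and is \<open>\<epsilon>\<close>-close to \<open>u\<close> at \<open>z\<close>,
  in a scale-invariant sense.
\<close>

definition comparison :: "real \<Rightarrow> real \<Rightarrow> (real \<Rightarrow> real) \<Rightarrow> real \<Rightarrow> ('a::euclidean_space \<times> 'b::euclidean_space \<Rightarrow> real) \<Rightarrow>
    real \<Rightarrow> 'a \<times> 'b \<Rightarrow> (real \<Rightarrow> real) \<Rightarrow> (real \<Rightarrow> real) \<Rightarrow> (real \<Rightarrow> real) \<Rightarrow> real \<Rightarrow> bool" where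
  "comparison a b G \<epsilon> u fz z \<psi> \<psi>1 \<psi>2 k \<longleftrightarrow> (let r = norm (fst z); w = (\<lambda>q. u q - \<psi> (norm (fst q))) in
     (\<forall>\<rho>>0. (\<psi> has_real_derivative \<psi>1 \<rho>) (at \<rho>) \<and> (\<psi>1 has_real_derivative \<psi>2 \<rho>) (at \<rho>)) \<and>
     \<psi> r > 0 \<and> 0 \<le> k \<and> (\<psi>1 r)\<^sup>2 * a / b \<le> 1 \<and> k \<le> b * G ((\<psi>1 r)\<^sup>2 * a / b) \<and>
     \<psi> r * \<psi>2 r = k * (1 + (\<psi>1 r)\<^sup>2) \<and> \<psi> r * (\<psi>2 r + a * \<psi>1 r / r) = b + k * (\<psi>1 r)\<^sup>2 \<and>
     \<bar>w z\<bar> \<le> \<epsilon> * \<psi> r \<and> deriv_norm 1 w z \<le> \<epsilon> \<and> deriv_norm 2 w z \<le> \<epsilon> / \<psi> r \<and> \<bar>fz - 1\<bar> \<le> \<epsilon>)"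

lemma (in barrier) cone_comparison:
  fixes z :: "'a::euclidean_space \<times> 'b::euclidean_space"
  assumes z: "fst z \<noteq> 0" and \<epsilon>: "\<epsilon> > 0"
    and w: "\<bar>u z - sqrt (b / a) * norm (fst z)\<bar> \<le> \<epsilon> * (sqrt (b / a) * norm (fst z))"
      "deriv_norm 1 (\<lambda>q. u q - sqrt (b / a) * norm (fst q)) z \<le> \<epsilon>"
      "deriv_norm 2 (\<lambda>q. u q - sqrt (b / a) * norm (fst q)) z \<le> \<epsilon> / (sqrt (b / a) * norm (fst z))"
    and f: "\<bar>fz - 1\<bar> \<le> \<epsilon>"
  shows "comparison a b g \<epsilon> u fz z (\<lambda>\<rho>. sqrt (b / a) * \<rho>) (\<lambda>_. sqrt (b / a)) (\<lambda>_. 0) 0"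
proof -
  define \<alpha> where "\<alpha> = sqrt (b / a)"
  have \<alpha>: "\<alpha> > 0" "\<alpha>\<^sup>2 = b / a" using a b by (auto simp: \<alpha>_def)
  have \<alpha>1: "\<alpha>\<^sup>2 * a / b = 1" using a b by (simp add: \<alpha>)
  have "\<alpha> * norm (fst z) * (a * \<alpha> / norm (fst z)) = a * \<alpha>\<^sup>2" using z by (simp add: power2_eq_square)
  then have 1: "\<alpha> * norm (fst z) * (a * \<alpha> / norm (fst z)) = b" using a by (simp add: \<alpha>)
  show ?thesis
    unfolding comparison_def Let_def \<alpha>_def[symmetric]
    using \<alpha> \<alpha>1 1 z w[folded \<alpha>_def] f
    by (auto simp: barrier_fun_def intro!: derivative_eq_intros)
qed

text \<open>The profile equation is invariant under \<psi>(\<rho>) = l \<phi>(\<rho> / l): the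
  quantities \<psi>', \<psi> \<psi>'' and \<psi> \<psi>' / \<rho> at \<rho> equal those of \<phi> at
  \<rho> / l, so the barrier estimate for \<phi> applies to every scale l.\<close>

lemma (in barrier) core_comparison:
  fixes D :: "nat \<Rightarrow> real \<Rightarrow> real" and z :: "'a::euclidean_space \<times> 'b::euclidean_space"
  defines "c1 \<equiv> min 1 (sqrt (b / (2 * a))) / 2"
  assumes sol: "profile_derivs a b D"
    and z: "fst z \<noteq> 0" and l: "l > 0" and \<delta>: "\<delta> > 0" "\<delta> \<le> \<epsilon>" "\<delta> \<le> \<epsilon> * c1" "\<delta> * (1 + sqrt (b / a)) \<le> \<epsilon>"
    and w: "\<bar>u z - scaled_profile (D 0) l (norm (fst z))\<bar> \<le> \<delta> * (l + norm (fst z))"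
      "deriv_norm 1 (\<lambda>q. u q - scaled_profile (D 0) l (norm (fst q))) z \<le> \<delta>"
      "(l + norm (fst z)) * deriv_norm 2 (\<lambda>q. u q - scaled_profile (D 0) l (norm (fst q))) z \<le> \<delta>"
    and f: "fz = 1"
  shows "\<exists>\<psi> \<psi>1 \<psi>2 k. comparison a b g \<epsilon> u fz z \<psi> \<psi>1 \<psi>2 k"
proof -
  have deriv: "\<And>k r. r \<ge> 0 \<Longrightarrow> (D k has_real_derivative D (Suc k) r) (at r within {0..})"
    and init: "D 0 0 = 1" "D 1 0 = 0" and ge1: "\<And>r. r \<ge> 0 \<Longrightarrow> 1 \<le> D 0 r"
    and ode: "\<And>r. r > 0 \<Longrightarrow> D 2 r * D 0 r / (1 + (D 1 r)\<^sup>2) + a / r * D 0 r * D 1 r = b"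
    using sol by (auto simp only: profile_derivs_def)
  define \<psi> where "\<psi> = scaled_profile (D 0) l"
  define \<psi>1 where "\<psi>1 = (\<lambda>\<rho>. D 1 (\<rho> / l))"
  define \<psi>2 where "\<psi>2 = (\<lambda>\<rho>. D 2 (\<rho> / l) / l)"
  define r where "r = norm (fst z)"
  have r: "r > 0" using z by (simp add: r_def)
  define R where "R = r / l"
  have R: "R > 0" using r l by (simp add: R_def)
  \<comment> \<open>This is b (1 - Y), which by the profile equation equals \<phi> \<phi>'' / (1 +
    \<phi>'^2).\<close>
  define k where "k = b * (1 - D 0 R * D 1 R / R * a / b)"
  have der: "(D k has_real_derivative D (Suc k) x) (at x)" if "x > 0" for k x
    using deriv[of x k] that at_within_interior[of x "{0..}"] by simp
  have scale: "((\<lambda>\<rho>. \<rho> / l) has_real_derivative 1 / l) (at \<rho>)" for \<rho>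
    using l by (auto intro!: derivative_eq_intros)
  have d1: "(\<psi> has_real_derivative \<psi>1 \<rho>) (at \<rho>)" if "\<rho> > 0" for \<rho>
  proof -
    have "((\<lambda>\<rho>. D 0 (\<rho> / l)) has_real_derivative D 1 (\<rho> / l) * (1 / l)) (at \<rho>)"
      using DERIV_chain2[OF der[of "\<rho> / l" 0] scale] that l by simp
    from DERIV_cmult[OF this, of l] show ?thesis
      using l by (simp add: \<psi>_def \<psi>1_def scaled_profile_def[abs_def])
  qed
  have d2: "(\<psi>1 has_real_derivative \<psi>2 \<rho>) (at \<rho>)" if "\<rho> > 0" for \<rho>
    using DERIV_chain2[OF der[of "\<rho> / l" 1] scale] that l by (simp add: \<psi>1_def \<psi>2_def numeral_2_eq_2)
  note est = profile_in_barrier[OF sol R]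
  note gr = profile_growth[OF sol R]
  have \<psi>r: "\<psi> r = l * D 0 R" by (simp add: \<psi>_def scaled_profile_def R_def)
  have D0: "D 0 R \<ge> 1" using ge1[of R] R by simp
  have \<psi>pos: "\<psi> r > 0" using l D0 by (simp add: \<psi>r)
  have kk: "D 2 R * D 0 R = k * (1 + (D 1 R)\<^sup>2)"
  proof -
    have N: "1 + (D 1 R)\<^sup>2 > 0" by (simp add: add_pos_nonneg)
    have "k = b - a / R * D 0 R * D 1 R" using b by (simp add: k_def right_diff_distrib)
    also have "\<dots> = D 2 R * D 0 R / (1 + (D 1 R)\<^sup>2)" using ode[OF R] by linarith
    finally show ?thesis using N by simp
  qed
  have o1: "\<psi> r * \<psi>2 r = k * (1 + (\<psi>1 r)\<^sup>2)"
    using kk l by (simp add: \<psi>r \<psi>1_def \<psi>2_def R_def[symmetric] mult.commute)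
  have o2: "\<psi> r * (\<psi>2 r + a * \<psi>1 r / r) = b + k * (\<psi>1 r)\<^sup>2"
  proof -
    have "\<psi> r * (a * \<psi>1 r / r) = a / R * D 0 R * D 1 R"
      using l r by (simp add: \<psi>r \<psi>1_def R_def)
    also have "\<dots> = b - k" using b by (simp add: k_def right_diff_distrib)
    finally show ?thesis unfolding distrib_left o1 by (simp add: algebra_simps)
  qed
  have k: "0 \<le> k" "k \<le> b * g ((\<psi>1 r)\<^sup>2 * a / b)"
    using est(2,3) b by (auto simp: k_def \<psi>1_def R_def[symmetric] intro!: mult_left_mono)
  have lr: "l * (1 + R) = l + r" using l by (simp add: R_def distrib_left)
  have up: "\<psi> r \<le> (1 + sqrt (b / a)) * (l + r)"
  proof -
    have "\<psi> r \<le> l * (1 + sqrt (b / a) * R)" unfolding \<psi>r using gr(1) l by (intro mult_left_mono) auto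
    also have "\<dots> = l + sqrt (b / a) * r" using l by (simp add: R_def distrib_left)
    also have "\<dots> \<le> (1 + sqrt (b / a)) * (l + r)" using l r a b by (simp add: algebra_simps add_nonneg_nonneg)
    finally show ?thesis .
  qed
  have lo: "c1 * (l + r) \<le> \<psi> r"
  proof -
    have "l * (c1 * (1 + R)) \<le> \<psi> r" unfolding \<psi>r c1_def using gr(2) l by (intro mult_left_mono) auto
    moreover have "l * (c1 * (1 + R)) = c1 * (l + r)" by (simp only: lr[symmetric] mult.left_commute)
    ultimately show ?thesis by simp
  qed
  have e: "\<epsilon> > 0" using \<delta> by linarith
  have w0: "\<bar>u z - \<psi> r\<bar> \<le> \<epsilon> * \<psi> r"
  proof -
    have "\<delta> * (l + r) \<le> \<epsilon> * c1 * (l + r)" using \<delta>(3) l r by (intro mult_right_mono) auto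
    also have "\<dots> \<le> \<epsilon> * \<psi> r" using lo e by (simp add: mult.assoc)
    finally show ?thesis using w(1) by (simp add: \<psi>_def r_def)
  qed
  let ?dn = "deriv_norm 2 (\<lambda>q. u q - \<psi> (norm (fst q))) z"
  have w2: "?dn \<le> \<epsilon> / \<psi> r"
  proof -
    have dn0: "?dn \<ge> 0" by (simp add: deriv_norm_def sum_nonneg)
    have "?dn * \<psi> r \<le> ?dn * ((1 + sqrt (b / a)) * (l + r))" using up dn0 by (intro mult_left_mono) auto
    also have "\<dots> = (1 + sqrt (b / a)) * ((l + r) * ?dn)" by simp
    also have "\<dots> \<le> (1 + sqrt (b / a)) * \<delta>"
      using w(3) a b by (intro mult_left_mono) (auto simp: \<psi>_def r_def)
    also have "\<dots> \<le> \<epsilon>" using \<delta>(4) by (simp add: mult.commute)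
    finally show ?thesis using \<psi>pos by (simp add: pos_le_divide_eq)
  qed
  have P1: "(\<psi>1 r)\<^sup>2 * a / b \<le> 1" using est(1) by (simp add: \<psi>1_def R_def[symmetric])
  have w1: "deriv_norm 1 (\<lambda>q. u q - \<psi> (norm (fst q))) z \<le> \<epsilon>" using w(2) \<delta>(2) by (simp add: \<psi>_def)
  have "comparison a b g \<epsilon> u fz z \<psi> \<psi>1 \<psi>2 k"
    unfolding comparison_def Let_def r_def[symmetric]
    using d1 d2 \<psi>pos k P1 o1 o2 w0 w1 w2 f e by simp
  then show ?thesis by blast
qed

lemma smooth_on_differentiable:
  assumes "smooth_on S F" "z \<in> S"
  shows "F differentiable (at z)" "i \<in> Basis \<Longrightarrow> iter_partial [i] F differentiable (at z)"
proof -
  have *: "set vs \<subseteq> Basis \<Longrightarrow> iter_partial vs F differentiable (at z)" for vs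
    using assms by (simp only: smooth_on_def)
  show "F differentiable (at z)" using *[of "[]"] by simp
  show "i \<in> Basis \<Longrightarrow> iter_partial [i] F differentiable (at z)" using *[of "[i]"] by (simp del: iter_partial.simps)
qed

section \<open>The two branches of the calibrating function\<close>

lemma norm_fst_snd_has_derivative:
  fixes q :: "'a::euclidean_space \<times> 'b::euclidean_space \<times> 'c::euclidean_space"
  assumes "fst (snd q) \<noteq> 0"
  shows "((\<lambda>q. norm (fst (snd q))) has_derivative (\<lambda>w. sgn (fst (snd q)) \<bullet> fst (snd w))) (at q)"
proof -
  have "((\<lambda>q::'a \<times> 'b \<times> 'c. fst (snd q)) has_derivative (\<lambda>w. fst (snd w))) (at q)"
    by (intro derivative_intros)
  from has_derivative_compose[OF this has_derivative_norm[OF assms]] show ?thesis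
    by (simp only: inner_commute)
qed

lemma base_has_derivative:
  fixes u :: "'a::euclidean_space \<times> 'c::euclidean_space \<Rightarrow> real" and q :: "'a \<times> 'b::euclidean_space \<times> 'c"
  assumes "u differentiable (at (base_pt q))"
  shows "((\<lambda>q::'a \<times> 'b \<times> 'c. u (base_pt q)) has_derivative (\<lambda>w. grad u (base_pt q) \<bullet> base_pt w)) (at q)"
proof -
  have "(base_pt has_derivative base_pt) (at q)"
    by (auto intro!: derivative_eq_intros)
  moreover have "(u has_derivative (\<lambda>w. grad u (base_pt q) \<bullet> w)) (at (base_pt q))"
    using frechet_derivative_works[THEN iffD1, OF assms] unfolding grad_inner[OF assms] .
  ultimately show ?thesis by (rule has_derivative_compose)
qed

lemma powr_has_derivative:
  fixes U :: "'v::real_normed_vector \<Rightarrow> real"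
  assumes "(U has_derivative U') (at q)" "U q > 0"
  shows "((\<lambda>q. U q powr d) has_derivative (\<lambda>w. U' w * (d * U q powr d / U q))) (at q)"
proof -
  have "((\<lambda>s. s powr d) has_real_derivative d * U q powr (d - 1)) (at (U q))"
    using assms(2) by (rule has_real_derivative_powr)
  moreover have "d * U q powr (d - 1) = d * U q powr d / U q" using assms(2) by (simp add: powr_diff)
  ultimately have "((\<lambda>s. s powr d) has_real_derivative d * U q powr d / U q) (at (U q))"
    by (simp only:)
  from DERIV_compose_FDERIV[OF this assms(1)] show ?thesis .
qed

text \<open>The last hypothesis says E_u > 0, as E_u = u^(d - 1) ((d + 2) u^2 - d t^2). It holds
  strictly at t = u, hence on a full neighbourhood of {|\<xi>| = u}, where the inner branch is also
  differentiated.\<close>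

lemma E_inner_has_derivative:
  fixes u :: "(real^'n) \<times> (real^'l) \<Rightarrow> real" and q :: "(real^'n) \<times> (real^'m) \<times> (real^'l)"
  assumes u: "u differentiable (at (base_pt q))" "u (base_pt q) > 0" and \<xi>: "fst (snd q) \<noteq> 0"
    and d: "d * (norm (fst (snd q)))\<^sup>2 < (d + 2) * (u (base_pt q))\<^sup>2"
  shows "gradient_ratio (E_inner d u) u (inner_ratio d) q"
proof -
  define U where "U = u (base_pt q)"
  define T where "T = norm (fst (snd q))"
  define dU where "dU = (\<lambda>w::(real^'n) \<times> (real^'m) \<times> (real^'l). grad u (base_pt q) \<bullet> base_pt w)"
  define dT where "dT = (\<lambda>w::(real^'n) \<times> (real^'m) \<times> (real^'l). sgn (fst (snd q)) \<bullet> fst (snd w))"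
  note Ud = base_has_derivative[OF u(1), folded dU_def]
  note Td = norm_fst_snd_has_derivative[OF \<xi>, folded dT_def]
  have Up: "U > 0" using u by (simp add: U_def)
  define V where "V = U powr d"
  have V: "V > 0" using Up by (simp add: V_def)
  define D where "D = d + 2 - d * (T / U)\<^sup>2"
  have D: "D > 0" using d Up unfolding D_def T_def[symmetric] U_def[symmetric] by (simp add: field_simps)
  have "((\<lambda>q. (u (base_pt q))\<^sup>2 - (norm (fst (snd q)))\<^sup>2) has_derivative (\<lambda>w. 2 * U * dU w - 2 * T * dT w)) (at q)"
    unfolding U_def T_def by (auto intro!: derivative_eq_intros Ud Td)
  from has_derivative_mult[OF this powr_has_derivative[OF Ud u(2), of d]]
  have 1: "((\<lambda>q. ((u (base_pt q))\<^sup>2 - (norm (fst (snd q)))\<^sup>2) * u (base_pt q) powr d) has_derivative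
    (\<lambda>w. (U\<^sup>2 - T\<^sup>2) * (dU w * (d * V / U)) + (2 * U * dU w - 2 * T * dT w) * V)) (at q)"
    unfolding U_def[symmetric] T_def[symmetric] V_def[symmetric] .
  have 2: "E_inner d u = (\<lambda>q. ((u (base_pt q))\<^sup>2 - (norm (fst (snd q)))\<^sup>2) * u (base_pt q) powr d)"
    by (auto simp: E_inner_def)
  have UD: "U * D = ((d + 2) * U\<^sup>2 - d * T\<^sup>2) / U"
    using Up by (simp add: D_def power2_eq_square field_simps)
  have 3: "(U\<^sup>2 - T\<^sup>2) * (x * (d * V / U)) + (2 * U * x - 2 * T * y) * V =
      V * (U * D) * (x - inner_ratio d (T / U) * y)" for x y
  proof -
    have "V * (U * D) * (x - inner_ratio d (T / U) * y) = V * (U * D) * x - V * (U * (D * inner_ratio d (T / U))) * y"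
      by (simp add: algebra_simps)
    also have "D * inner_ratio d (T / U) = 2 * (T / U)" using D by (simp add: inner_ratio_def D_def)
    also have "V * (U * D) * x - V * (U * (2 * (T / U))) * y = (U\<^sup>2 - T\<^sup>2) * (x * (d * V / U)) + (2 * U * x - 2 * T * y) * V"
      unfolding UD using Up by (simp add: field_simps power2_eq_square)
    finally show ?thesis by simp
  qed
  have "(E_inner d u has_derivative (\<lambda>w. V * (U * D) * (dU w - inner_ratio d (T / U) * dT w))) (at q)"
    unfolding 2 using 1 unfolding 3 .
  moreover have "V * (U * D) > 0" using V Up D by simp
  ultimately show ?thesis unfolding dU_def dT_def U_def T_def by blast
qed

lemma E_outer_has_derivative:
  fixes u :: "(real^'n) \<times> (real^'l) \<Rightarrow> real" and q :: "(real^'n) \<times> (real^'m) \<times> (real^'l)"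
  assumes u: "u differentiable (at (base_pt q))" "u (base_pt q) > 0" and \<xi>: "fst (snd q) \<noteq> 0"
  shows "gradient_ratio (E_outer d u) u (outer_ratio d) q"
proof -
  define U where "U = u (base_pt q)"
  define T where "T = norm (fst (snd q))"
  define dU where "dU = (\<lambda>w::(real^'n) \<times> (real^'m) \<times> (real^'l). grad u (base_pt q) \<bullet> base_pt w)"
  define dT where "dT = (\<lambda>w::(real^'n) \<times> (real^'m) \<times> (real^'l). sgn (fst (snd q)) \<bullet> fst (snd w))"
  note Ud = base_has_derivative[OF u(1), folded dU_def]
  note Td = norm_fst_snd_has_derivative[OF \<xi>, folded dT_def]
  have Up: "U > 0" and Tp: "T > 0" and Tq: "norm (fst (snd q)) > 0" using u \<xi> by (auto simp: U_def T_def)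
  define V where "V = T powr d"
  have V: "V > 0" using Tp by (simp add: V_def)
  have "((\<lambda>q. (u (base_pt q))\<^sup>2 - (norm (fst (snd q)))\<^sup>2) has_derivative (\<lambda>w. 2 * U * dU w - 2 * T * dT w)) (at q)"
    unfolding U_def T_def by (auto intro!: derivative_eq_intros Ud Td)
  from has_derivative_mult[OF this powr_has_derivative[OF Td Tq, of d]]
  have 1: "((\<lambda>q. ((u (base_pt q))\<^sup>2 - (norm (fst (snd q)))\<^sup>2) * norm (fst (snd q)) powr d) has_derivative
    (\<lambda>w. (U\<^sup>2 - T\<^sup>2) * (dT w * (d * V / T)) + (2 * U * dU w - 2 * T * dT w) * V)) (at q)"
    unfolding U_def[symmetric] T_def[symmetric] V_def[symmetric] .
  have 2: "E_outer d u = (\<lambda>q. ((u (base_pt q))\<^sup>2 - (norm (fst (snd q)))\<^sup>2) * norm (fst (snd q)) powr d)"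
    by (auto simp: E_outer_def)
  have 3: "(U\<^sup>2 - T\<^sup>2) * (y * (d * V / T)) + (2 * U * x - 2 * T * y) * V =
      2 * U * V * (x - outer_ratio d (T / U) * y)" for x y
    using Up Tp by (simp add: outer_ratio_def field_simps power2_eq_square)
  have "(E_outer d u has_derivative (\<lambda>w. 2 * U * V * (dU w - outer_ratio d (T / U) * dT w))) (at q)"
    unfolding 2 using 1 unfolding 3 .
  moreover have "2 * U * V > 0" using V Up by simp
  ultimately show ?thesis unfolding dU_def dT_def U_def T_def by blast
qed

lemma inner_ratio_has_derivative:
  assumes "d > 0" "0 < \<theta>" "\<theta> \<le> 1"
  shows "(inner_ratio d has_real_derivative inner_ratio' d \<theta>) (at \<theta>)" "inner_ratio d \<theta> > 0"
proof -
  have D: "d + 2 - d * \<theta>\<^sup>2 > 0" using inner_factor_nonneg(1)[of d "\<theta>\<^sup>2"] assms by (simp add: power_le_one)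
  then show "inner_ratio d \<theta> > 0" using assms by (simp add: inner_ratio_def)
  show "(inner_ratio d has_real_derivative inner_ratio' d \<theta>) (at \<theta>)"
    unfolding inner_ratio_def[abs_def] inner_ratio'_def using D
    by (auto intro!: derivative_eq_intros simp: field_simps power2_eq_square)
qed

lemma outer_ratio_has_derivative:
  assumes "d > 0" "1 \<le> \<theta>"
  shows "(outer_ratio d has_real_derivative outer_ratio' d \<theta>) (at \<theta>)" "outer_ratio d \<theta> > 0"
proof -
  have "d * 1 \<le> d * \<theta>\<^sup>2" using assms by (intro mult_left_mono) auto
  then have "(d + 2) * \<theta>\<^sup>2 - d > 0" 
  proof -
    have "\<theta>\<^sup>2 > 0" using assms by simp
    then show ?thesis using \<open>d * 1 \<le> d * \<theta>\<^sup>2\<close> unfolding distrib_right by linarith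
  qed
  then show "outer_ratio d \<theta> > 0" using assms by (simp add: outer_ratio_def)
  show "(outer_ratio d has_real_derivative outer_ratio' d \<theta>) (at \<theta>)"
    unfolding outer_ratio_def[abs_def] outer_ratio'_def using assms(2)
    by (auto intro!: derivative_eq_intros simp: field_simps power2_eq_square)
qed

text \<open>W^3 times the divergence is X and W > 0, so only the sign of X matters. Off {|\<xi>| =
  u} the piecewise E agrees locally with one branch; on this set each branch is extended to both
  sides.\<close>

lemma branch_div_sign:
  fixes u f :: "(real^'n) \<times> (real^'l) \<Rightarrow> real" and p :: "(real^'n) \<times> (real^'m) \<times> (real^'l)" and d :: real
  defines "z \<equiv> base_pt p" and "t \<equiv> norm (fst (snd p))"
  defines "X \<equiv> \<lambda>\<rho> r'. div_expr (real CARD('m)) (u z) (f z) ((norm (grad u z))\<^sup>2) (hess_grad_grad u z) (laplacian u z)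
      (grad f z \<bullet> grad u z) t \<rho> r'"
  assumes open_S: "open S" "z \<in> S" and on_S: "\<forall>q\<in>S. u differentiable (at q)" "\<forall>q\<in>S. u q > 0"
    and cont: "continuous_on UNIV u"
    and second: "\<forall>i\<in>Basis. iter_partial [i] u differentiable (at z)"
    and weight: "f differentiable (at z)" "\<forall>z. f z > 0" and t: "fst (snd p) \<noteq> 0" and d: "d > 0"
  shows "\<lbrakk>t \<le> u z; X (inner_ratio d (t / u z)) (inner_ratio' d (t / u z)) \<ge> 0\<rbrakk> \<Longrightarrow>
      metric_div (warped_metric f) (metric_unit_grad (warped_metric f) (E_inner d u)) p \<ge> 0"
    and "\<lbrakk>u z \<le> t; X (outer_ratio d (t / u z)) (outer_ratio' d (t / u z)) \<le> 0\<rbrakk> \<Longrightarrow>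
      metric_div (warped_metric f) (metric_unit_grad (warped_metric f) (E_outer d u)) p \<le> 0"
    and "\<lbrakk>t < u z; X (inner_ratio d (t / u z)) (inner_ratio' d (t / u z)) \<ge> 0\<rbrakk> \<Longrightarrow>
      metric_div (warped_metric f) (metric_unit_grad (warped_metric f) (E_fun d u)) p \<ge> 0"
    and "\<lbrakk>u z < t; X (outer_ratio d (t / u z)) (outer_ratio' d (t / u z)) \<le> 0\<rbrakk> \<Longrightarrow>
      metric_div (warped_metric f) (metric_unit_grad (warped_metric f) (E_fun d u)) p \<le> 0"
proof -
  have S: "open S" "z \<in> S" "\<And>q. q \<in> S \<Longrightarrow> u differentiable (at q)" "\<And>q. q \<in> S \<Longrightarrow> u q > 0"
    and u2: "\<And>i. i \<in> Basis \<Longrightarrow> iter_partial [i] u differentiable (at z)"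
    and f: "f differentiable (at z)" "\<And>z. f z > 0"
    using open_S on_S second weight by blast+
  have uz: "u z > 0" and ud: "u differentiable (at z)" using S by auto
  have tp: "t > 0" using t by (simp add: t_def)
  have cu: "continuous_on UNIV (\<lambda>q::(real^'n) \<times> (real^'m) \<times> (real^'l). u (base_pt q))"
    by (rule continuous_on_compose2[OF cont]) (auto intro!: continuous_intros)
  have ct: "continuous_on UNIV (\<lambda>q::(real^'n) \<times> (real^'m) \<times> (real^'l). norm (fst (snd q)))"
    by (intro continuous_intros)
  have W: "W ^ 3 * metric_div (warped_metric f) (metric_unit_grad (warped_metric f) F) p = X \<rho> r' \<and> W > 0"
    if F: "\<forall>\<^sub>F q in nhds p. gradient_ratio F u r q"
    and r: "(r has_real_derivative r') (at (t / u z))" "r (t / u z) = \<rho>" "\<rho> > 0"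
    and W: "W = sqrt ((norm (grad u z))\<^sup>2 + \<rho>\<^sup>2 / f z)" for F r r' \<rho> W
  proof -
    note * = metric_div_unit_grad_warped[OF F ud[unfolded z_def] uz[unfolded z_def] u2[unfolded z_def] f[unfolded z_def] t
        r[unfolded z_def t_def] W[unfolded z_def]]
    have "W\<^sup>2 = (norm (grad u z))\<^sup>2 + \<rho>\<^sup>2 / f z"
      using f(2)[of z] unfolding W by (simp add: add_nonneg_nonneg less_imp_le)
    then show ?thesis using * unfolding X_def div_expr_def z_def t_def by simp
  qed
  have cancel_nonneg: "D \<ge> 0" if "W ^ 3 * D = y \<and> W > 0" "y \<ge> 0" for W D y :: real
    using that by (auto simp: zero_le_mult_iff)
  have cancel_nonpos: "D \<le> 0" if "W ^ 3 * D = y \<and> W > 0" "y \<le> 0" for W D y :: real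
    using that by (auto simp: mult_le_0_iff)
  define T where "T = {q::(real^'n) \<times> (real^'m) \<times> (real^'l). base_pt q \<in> S \<and> fst (snd q) \<noteq> 0}"
  have "open T"
  proof -
    have "open (base_pt -` S :: ((real^'n) \<times> (real^'m) \<times> (real^'l)) set)"
      by (rule open_vimage[OF S(1)]) (auto intro!: continuous_intros)
    moreover have "open {q::(real^'n) \<times> (real^'m) \<times> (real^'l). fst (snd q) \<noteq> 0}"
      by (intro open_Collect_neq continuous_intros)
    ultimately have "open (base_pt -` S \<inter> {q::(real^'n) \<times> (real^'m) \<times> (real^'l). fst (snd q) \<noteq> 0})" by (rule open_Int)
    then show ?thesis by (simp add: T_def vimage_def Collect_conj_eq)
  qed
  have pT: "p \<in> T" using S(2) t by (simp add: T_def z_def)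
  \<comment> \<open>The open set where the inner branch has E_u > 0; it contains all points with t
    \<le> u and extends beyond them.\<close>
  define Ti where "Ti = T \<inter> {q. d * (norm (fst (snd q)))\<^sup>2 < (d + 2) * (u (base_pt q))\<^sup>2}"
  have "open Ti" unfolding Ti_def
    by (intro open_Int \<open>open T\<close> open_Collect_less continuous_intros cu ct)
  \<comment> \<open>On the open sets \<open>A1\<close> and \<open>A2\<close> the piecewise function
    coincides with the inner and the outer branch, so derivatives transfer.\<close>
  define A1 where "A1 = Ti \<inter> {q. norm (fst (snd q)) < u (base_pt q)}"
  define A2 where "A2 = T \<inter> {q. u (base_pt q) < norm (fst (snd q))}"
  have "open A1" unfolding A1_def by (intro open_Int \<open>open Ti\<close> open_Collect_less cu ct)
  have "open A2" unfolding A2_def by (intro open_Int \<open>open T\<close> open_Collect_less cu ct)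
  have Di: "gradient_ratio (E_inner d u) u (inner_ratio d) q"
    if "q \<in> Ti" for q
    using that S by (intro E_inner_has_derivative) (auto simp: Ti_def T_def)
  have Do: "gradient_ratio (E_outer d u) u (outer_ratio d) q"
    if "q \<in> T" for q
    using that S by (intro E_outer_has_derivative) (auto simp: T_def)
  have pTi: "p \<in> Ti" if "t \<le> u z"
  proof -
    have "t\<^sup>2 \<le> (u z)\<^sup>2" using that tp by (intro power_mono) auto
    then have "d * t\<^sup>2 \<le> d * (u z)\<^sup>2" using d by simp
    also have "\<dots> < (d + 2) * (u z)\<^sup>2" using uz by simp
    finally show ?thesis using pT by (simp add: Ti_def z_def t_def)
  qed
  show "metric_div (warped_metric f) (metric_unit_grad (warped_metric f) (E_inner d u)) p \<ge> 0"
    if h: "t \<le> u z" "X (inner_ratio d (t / u z)) (inner_ratio' d (t / u z)) \<ge> 0"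
  proof -
    have "\<forall>\<^sub>F q in nhds p. q \<in> Ti" using \<open>open Ti\<close> pTi[OF h(1)] by (rule eventually_nhds_in_open)
    then have F: "\<forall>\<^sub>F q in nhds p. gradient_ratio (E_inner d u) u (inner_ratio d) q"
      by eventually_elim (rule Di)
    have \<theta>: "0 < t / u z" "t / u z \<le> 1" using tp uz h by auto
    note R = inner_ratio_has_derivative[OF d \<theta>]
    show ?thesis by (rule cancel_nonneg[OF W[OF F R(1) refl R(2) refl] h(2)])
  qed
  show "metric_div (warped_metric f) (metric_unit_grad (warped_metric f) (E_outer d u)) p \<le> 0"
    if h: "u z \<le> t" "X (outer_ratio d (t / u z)) (outer_ratio' d (t / u z)) \<le> 0"
  proof -
    have "\<forall>\<^sub>F q in nhds p. q \<in> T" using \<open>open T\<close> pT by (rule eventually_nhds_in_open)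
    then have F: "\<forall>\<^sub>F q in nhds p. gradient_ratio (E_outer d u) u (outer_ratio d) q"
      by eventually_elim (rule Do)
    have \<theta>: "1 \<le> t / u z" using tp uz h by auto
    note R = outer_ratio_has_derivative[OF d \<theta>]
    show ?thesis by (rule cancel_nonpos[OF W[OF F R(1) refl R(2) refl] h(2)])
  qed
  show "metric_div (warped_metric f) (metric_unit_grad (warped_metric f) (E_fun d u)) p \<ge> 0"
    if h: "t < u z" "X (inner_ratio d (t / u z)) (inner_ratio' d (t / u z)) \<ge> 0"
  proof -
    have pA: "p \<in> A1" using pTi h by (simp add: A1_def z_def t_def)
    have "\<forall>\<^sub>F q in nhds p. q \<in> A1" using \<open>open A1\<close> pA by (rule eventually_nhds_in_open)
    then have F: "\<forall>\<^sub>F q in nhds p. gradient_ratio (E_fun d u) u (inner_ratio d) q"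
    proof eventually_elim
      case (elim q)
      then obtain A where A: "A > 0" "(E_inner d u has_derivative (\<lambda>w. A * (grad u (base_pt q) \<bullet> base_pt w
        - inner_ratio d (norm (fst (snd q)) / u (base_pt q)) * (sgn (fst (snd q)) \<bullet> fst (snd w))))) (at q)"
        using Di[of q] by (auto simp: A1_def)
      have "E_inner d u q' = E_fun d u q'" if "q' \<in> A1" for q'
        using that by (auto simp: A1_def E_fun_def E_inner_def split: prod.splits)
      from has_derivative_transform_within_open[OF A(2) \<open>open A1\<close> elim this] A(1) show ?case by blast
    qed
    have \<theta>: "0 < t / u z" "t / u z \<le> 1" using tp uz h by auto
    note R = inner_ratio_has_derivative[OF d \<theta>]
    show ?thesis by (rule cancel_nonneg[OF W[OF F R(1) refl R(2) refl] h(2)])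
  qed
  show "metric_div (warped_metric f) (metric_unit_grad (warped_metric f) (E_fun d u)) p \<le> 0"
    if h: "u z < t" "X (outer_ratio d (t / u z)) (outer_ratio' d (t / u z)) \<le> 0"
  proof -
    have pA: "p \<in> A2" using pT h by (simp add: A2_def z_def t_def)
    have "\<forall>\<^sub>F q in nhds p. q \<in> A2" using \<open>open A2\<close> pA by (rule eventually_nhds_in_open)
    then have F: "\<forall>\<^sub>F q in nhds p. gradient_ratio (E_fun d u) u (outer_ratio d) q"
    proof eventually_elim
      case (elim q)
      then obtain A where A: "A > 0" "(E_outer d u has_derivative (\<lambda>w. A * (grad u (base_pt q) \<bullet> base_pt w
        - outer_ratio d (norm (fst (snd q)) / u (base_pt q)) * (sgn (fst (snd q)) \<bullet> fst (snd w))))) (at q)"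
        using Do[of q] by (auto simp: A2_def)
      have "E_outer d u q' = E_fun d u q'" if "q' \<in> A2" for q'
        using that by (auto simp: A2_def E_fun_def split: prod.splits)
      from has_derivative_transform_within_open[OF A(2) \<open>open A2\<close> elim this] A(1) show ?case by blast
    qed
    have \<theta>: "1 \<le> t / u z" using tp uz h by auto
    note R = outer_ratio_has_derivative[OF d \<theta>]
    show ?thesis by (rule cancel_nonpos[OF W[OF F R(1) refl R(2) refl] h(2)])
  qed
qed

section \<open>A model function at every point of Simon's data\<close>

text \<open>Three zones: u is exactly the cone near (x, y); a transition zone where u is close to
  the cone because h^2 is of order \<tau>; and the core, where u is close to a profile of scale u(0,
  y).\<close>

lemma (in barrier) simon_comparison:
  fixes \<phi> :: "real \<Rightarrow> real" and C \<epsilon> :: real and m :: nat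
  assumes \<phi>: "profile CARD('n) m \<phi>" and aN: "a = real CARD('n) - 1" and bm: "b = real m - 1"
    and C: "C \<ge> 1" and \<epsilon>: "\<epsilon> > 0"
  obtains \<tau>0 \<delta>0 where "\<tau>0 > 0" "\<delta>0 > 0"
    "\<And>K \<tau> \<delta> (h :: real^'l \<Rightarrow> real) (u :: (real^'n) \<times> (real^'l) \<Rightarrow> real) f x y.
      \<lbrakk>\<tau> \<le> \<tau>0; \<delta> \<le> \<delta>0; simon_data m \<phi> K \<tau> \<delta> C h u f; x \<noteq> 0\<rbrakk> \<Longrightarrow>
      \<exists>\<psi> \<psi>1 \<psi>2 k. comparison a b g \<epsilon> u (f (x, y)) (x, y) \<psi> \<psi>1 \<psi>2 k"
proof -
  define \<alpha> where "\<alpha> = sqrt (b / a)"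
  have \<alpha>: "\<alpha> > 0" using a b by (simp add: \<alpha>_def)
  have slope: "cone_slope CARD('n) m = \<alpha>" by (simp add: cone_slope_def \<alpha>_def aN bm)
  obtain D where D: "D 0 = \<phi>" "\<And>k r. r \<ge> 0 \<Longrightarrow> (D k has_real_derivative D (Suc k) r) (at r within {0..})"
    "\<phi> 0 = 1" "D 1 0 = 0"
    "\<And>r. r > 0 \<Longrightarrow> D 2 r * \<phi> r / (1 + (D 1 r)\<^sup>2) + (real CARD('n) - 1) / r * \<phi> r * D 1 r = real m - 1"
    and \<phi>1: "\<And>r. r \<ge> 0 \<Longrightarrow> 1 \<le> \<phi> r"
    using \<phi> unfolding profile_def by blast
  have sol: "profile_derivs a b D"
    unfolding profile_derivs_def aN bm D(1) using D(2-5) \<phi>1 by blast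
  define c1 where "c1 = min 1 (sqrt (b / (2 * a))) / 2"
  have c1: "c1 > 0" using a b by (simp add: c1_def)
  \<comment> \<open>The entries control, in this order, f and the first derivatives, the value of u,
    and its second derivatives. The powers of C come from h^2 \<le> C^2 \<tau> and |x| \<le> C^2 in
    the transition zone.\<close>
  define \<tau>0 where "\<tau>0 = min (\<epsilon> / C) (min (\<epsilon> * \<alpha> / (2 * C ^ 3)) (\<epsilon> / (\<alpha> * C ^ 3)))"
  \<comment> \<open>The entries serve the gradient, the value (through \<psi> \<ge> c1 (l + r)) and
    the second derivatives (through \<psi> \<le> (1 + \<alpha>) (l + r)).\<close>
  define \<delta>0 where "\<delta>0 = min \<epsilon> (min (\<epsilon> * c1) (\<epsilon> / (1 + \<alpha>)))"
  have C0: "C > 0" "C ^ 3 > 0" using C by auto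
  have \<tau>0: "\<tau>0 > 0" "\<tau>0 \<le> \<epsilon> / C" "\<tau>0 \<le> \<epsilon> * \<alpha> / (2 * C ^ 3)" "\<tau>0 \<le> \<epsilon> / (\<alpha> * C ^ 3)"
  proof -
    show "\<tau>0 > 0" using \<epsilon> \<alpha> C0 by (simp add: \<tau>0_def)
    show "\<tau>0 \<le> \<epsilon> / C" "\<tau>0 \<le> \<epsilon> * \<alpha> / (2 * C ^ 3)" "\<tau>0 \<le> \<epsilon> / (\<alpha> * C ^ 3)"
      unfolding \<tau>0_def by (rule min.cobounded1 min.coboundedI2 order_refl)+
  qed
  have \<delta>0: "\<delta>0 > 0" "\<delta>0 \<le> \<epsilon>" "\<delta>0 \<le> \<epsilon> * c1" "\<delta>0 \<le> \<epsilon> / (1 + \<alpha>)"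
  proof -
    show "\<delta>0 > 0" using \<epsilon> \<alpha> c1 by (simp add: \<delta>0_def)
    show "\<delta>0 \<le> \<epsilon>" "\<delta>0 \<le> \<epsilon> * c1" "\<delta>0 \<le> \<epsilon> / (1 + \<alpha>)"
      unfolding \<delta>0_def by (rule min.cobounded1 min.coboundedI2 order_refl)+
  qed
  show thesis
  proof (rule that[OF \<tau>0(1) \<delta>0(1)])
    fix K \<tau> \<delta> and h :: "real^'l \<Rightarrow> real" and u f :: "(real^'n) \<times> (real^'l) \<Rightarrow> real"
      and x :: "real^'n" and y :: "real^'l"
    assume \<tau>: "\<tau> \<le> \<tau>0" and \<delta>: "\<delta> \<le> \<delta>0" and data: "simon_data m \<phi> K \<tau> \<delta> C h u f" and x: "x \<noteq> 0"
    note dat = data[unfolded simon_data_def Let_def slope]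
    have \<tau>0': "0 < \<tau>" using dat by (elim conjE)
    have \<tau>1': "\<tau> < 1" using dat by (elim conjE)
    note \<tau>1 = \<tau>0' \<tau>1'
    have \<delta>1: "0 < \<delta>" using dat by (elim conjE)
    have hs: "smooth_on UNIV h" using dat by (elim conjE)
    have hK: "\<forall>y. h y = 0 \<longleftrightarrow> y \<in> K" using dat by (elim conjE)
    have h0: "\<forall>y. 0 \<le> h y" using dat by (elim conjE)
    have hb: "\<forall>k\<le>3. \<forall>y. deriv_norm k h y \<le> C * \<tau>" using dat by (elim conjE)
    have upos: "\<forall>p. p \<notin> {0} \<times> K \<longrightarrow> 0 < u p" using dat by (elim conjE)
    have ucone: "\<forall>x y. y \<in> K \<or> y \<notin> K \<and> 3/4 * (h y)\<^sup>2 \<le> norm x \<longrightarrow> u (x, y) = \<alpha> * norm x"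
      using dat by (elim conjE)
    have fone: "\<forall>x y. y \<in> K \<or> y \<notin> K \<and> norm x \<le> 1/2 * (h y)\<^sup>2 \<longrightarrow> f (x, y) = 1"
      using dat by (elim conjE)
    have out: "\<forall>x y. y \<notin> K \<and> 1/2 * (h y)\<^sup>2 < norm x \<longrightarrow>
          \<bar>f (x, y) - 1\<bar> \<le> C * \<tau> \<and>
          deriv_norm 1 f (x, y) \<le> C * \<tau> \<and>
          deriv_norm 1 (\<lambda>q. u q - \<alpha> * norm (fst q)) (x, y) \<le> C * \<tau> \<and>
          deriv_norm 2 (\<lambda>q. u q - \<alpha> * norm (fst q)) (x, y) \<le> C * \<tau> \<and>
          (norm x < 3/4 * (h y)\<^sup>2 \<longrightarrow> \<bar>u (x, y) - \<alpha> * norm x\<bar> \<le> C * h y ^ 4)"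
      using dat by (elim conjE)
    have core: "\<forall>x y. y \<notin> K \<and> norm x \<le> 1/2 * (h y)\<^sup>2 \<longrightarrow>
            inverse (u (0, y) + norm x) * \<bar>u (x, y) - scaled_profile \<phi> (u (0, y)) (norm (fst (x, y)))\<bar> < \<delta> \<and>
            deriv_norm 1 (\<lambda>q. u q - scaled_profile \<phi> (u (0, y)) (norm (fst q))) (x, y) < \<delta> \<and>
            (u (0, y) + norm x) * deriv_norm 2 (\<lambda>q. u q - scaled_profile \<phi> (u (0, y)) (norm (fst q))) (x, y) < \<delta>"
      using dat by (elim conjE)
    have C\<tau>: "C * \<tau> \<le> \<epsilon>"
    proof -
      have "C * \<tau> \<le> C * (\<epsilon> / C)" using \<tau> \<tau>0(2) C0 by (intro mult_left_mono) auto
      then show ?thesis using C0 by simp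
    qed
    have nx: "norm x > 0" using x by simp
    have nz: "fst (x, y) \<noteq> 0" using x by simp
    \<comment> \<open>The strict inequality makes the first zone open, so that u - \<alpha>|x|
      vanishes near the point with all its derivatives. It contains every point with y in K, since h
      = 0 there.\<close>
    consider "3/4 * (h y)\<^sup>2 < norm x" | "y \<notin> K" "1/2 * (h y)\<^sup>2 < norm x" "norm x \<le> 3/4 * (h y)\<^sup>2"
      | "y \<notin> K" "norm x \<le> 1/2 * (h y)\<^sup>2"
    proof (cases "y \<in> K")
      case True
      then have "h y = 0" using hK by blast
      then show thesis using that(1) nx by simp
    next
      case False then show thesis using that by linarith
    qed
    then show "\<exists>\<psi> \<psi>1 \<psi>2 k. comparison a b g \<epsilon> u (f (x, y)) (x, y) \<psi> \<psi>1 \<psi>2 k"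
    proof cases
      case 1
      define T where "T = {q::(real^'n) \<times> (real^'l). 3/4 * (h (snd q))\<^sup>2 < norm (fst q)}"
      have "continuous_on UNIV h"
        using smooth_on_differentiable(1)[OF hs] by (intro continuous_at_imp_continuous_on ballI differentiable_imp_continuous_within) auto
      then have "continuous_on UNIV (\<lambda>q::(real^'n) \<times> (real^'l). h (snd q))"
        by (rule continuous_on_compose2) (auto intro!: continuous_intros)
      then have T: "open T" unfolding T_def by (intro open_Collect_less continuous_intros)
      have zT: "(x, y) \<in> T" using 1 by (simp add: T_def)
      have w0: "u q - \<alpha> * norm (fst q) = 0" if "q \<in> T" for q
      proof -
        have "3/4 * (h (snd q))\<^sup>2 \<le> norm (fst q)" using that by (simp add: T_def)
        then have "u (fst q, snd q) = \<alpha> * norm (fst q)" using ucone by blast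
        then show ?thesis by simp
      qed
      have "\<bar>f (x, y) - 1\<bar> \<le> \<epsilon>"
      proof (cases "y \<in> K")
        case True then show ?thesis using fone \<epsilon> by simp
      next
        case False
        have "1/2 * (h y)\<^sup>2 \<le> 3/4 * (h y)\<^sup>2" by simp
        then have "1/2 * (h y)\<^sup>2 < norm x" using 1 by linarith
        then have "\<bar>f (x, y) - 1\<bar> \<le> C * \<tau>" using out False by blast
        then show ?thesis using C\<tau> by linarith
      qed
      then have "comparison a b g \<epsilon> u (f (x, y)) (x, y) (\<lambda>\<rho>. sqrt (b / a) * \<rho>) (\<lambda>_. sqrt (b / a)) (\<lambda>_. 0) 0"
        using deriv_norm_locally_zero[OF T zT w0] w0[OF zT] \<epsilon> \<alpha> nx
        by (intro cone_comparison[OF nz \<epsilon>]) (auto simp: \<alpha>_def[symmetric])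
      then show ?thesis by blast
    next
      case 2
      have hle: "h y \<le> C * \<tau>" using hb[rule_format, of 0 y] by (simp add: deriv_norm_0)
      have hy: "0 \<le> h y" using h0 by blast
      have h2: "(h y)\<^sup>2 \<le> C\<^sup>2 * \<tau>"
      proof -
        have "(h y)\<^sup>2 \<le> (C * \<tau>)\<^sup>2" using hle hy by (rule power_mono)
        also have "\<dots> = C\<^sup>2 * (\<tau> * \<tau>)" by (simp add: power2_eq_square)
        also have "\<dots> \<le> C\<^sup>2 * \<tau>" using \<tau>1 by (intro mult_left_mono) (auto simp: mult_left_le)
        finally show ?thesis .
      qed
      note o = out[rule_format, OF conjI[OF 2(1,2)]]
      have u0: "\<bar>u (x, y) - \<alpha> * norm x\<bar> \<le> \<epsilon> * (\<alpha> * norm x)"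
      proof (cases "norm x < 3/4 * (h y)\<^sup>2")
        case True
        then have "\<bar>u (x, y) - \<alpha> * norm x\<bar> \<le> C * h y ^ 4" using o by blast
        also have "\<dots> = C * ((h y)\<^sup>2 * (h y)\<^sup>2)" by (simp add: power2_eq_square power4_eq_xxxx)
        \<comment> \<open>One factor h^2 provides the smallness and the other, through h^2 < 2 |x|,
          the scale |x| of the cone.\<close>
        also have "\<dots> \<le> C * ((C\<^sup>2 * \<tau>) * (2 * norm x))"
          using h2 2(2) C0 \<tau>1 by (intro mult_left_mono mult_mono) auto
        also have "\<dots> = (2 * C ^ 3 * \<tau>) * norm x" by (simp add: power2_eq_square power3_eq_cube)
        also have "\<dots> \<le> (\<epsilon> * \<alpha>) * norm x"
        proof (rule mult_right_mono)
          have "\<tau> \<le> \<epsilon> * \<alpha> / (2 * C ^ 3)" using \<tau> \<tau>0(3) by linarith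
          then show "2 * C ^ 3 * \<tau> \<le> \<epsilon> * \<alpha>" using C0 by (simp add: pos_le_divide_eq mult.commute mult.left_commute)
        qed simp
        finally show ?thesis by (simp add: mult.assoc)
      next
        case False
        then have "u (x, y) = \<alpha> * norm x" using ucone 2(1) by simp
        then show ?thesis using \<epsilon> \<alpha> by simp
      qed
      have d2: "deriv_norm 2 (\<lambda>q. u q - \<alpha> * norm (fst q)) (x, y) \<le> \<epsilon> / (\<alpha> * norm x)"
      proof -
        have "norm x \<le> C\<^sup>2"
        proof -
          have "C\<^sup>2 * \<tau> \<le> C\<^sup>2" using \<tau>1 by (simp add: mult_left_le)
          then show ?thesis using 2(3) h2 nx by linarith
        qed
        then have "(C * \<tau>) * (\<alpha> * norm x) \<le> (C * \<tau>) * (\<alpha> * C\<^sup>2)"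
          using C0 \<tau>1 \<alpha> by (intro mult_left_mono) auto
        also have "\<dots> = \<alpha> * C ^ 3 * \<tau>" by (simp add: power2_eq_square power3_eq_cube)
        also have "\<dots> \<le> \<epsilon>"
        proof -
          have "\<tau> \<le> \<epsilon> / (\<alpha> * C ^ 3)" using \<tau> \<tau>0(4) by linarith
          then show ?thesis using C0 \<alpha> by (simp add: pos_le_divide_eq mult.commute mult.left_commute)
        qed
        finally have "C * \<tau> \<le> \<epsilon> / (\<alpha> * norm x)" using \<alpha> nx by (simp add: pos_le_divide_eq)
        then show ?thesis using o by linarith
      qed
      have "comparison a b g \<epsilon> u (f (x, y)) (x, y) (\<lambda>\<rho>. sqrt (b / a) * \<rho>) (\<lambda>_. sqrt (b / a)) (\<lambda>_. 0) 0"
        using o u0 d2 C\<tau> by (intro cone_comparison[OF nz \<epsilon>]) (auto simp: \<alpha>_def[symmetric])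
      then show ?thesis by blast
    next
      case 3
      note c = core[rule_format, OF conjI[OF 3], folded D(1)]
      have l: "u (0, y) > 0" using upos 3(1) by simp
      have "\<bar>u (x, y) - scaled_profile (D 0) (u (0, y)) (norm (fst (x, y)))\<bar> \<le> \<delta> * (u (0, y) + norm (fst (x, y)))"
      proof -
        have "inverse (u (0, y) + norm x) * \<bar>u (x, y) - scaled_profile (D 0) (u (0, y)) (norm x)\<bar> \<le> \<delta>"
          using c by simp
        moreover have "u (0, y) + norm x > 0" by (rule add_pos_pos[OF l nx])
        ultimately show ?thesis by (simp add: field_simps)
      qed
      moreover have "\<delta> * (1 + sqrt (b / a)) \<le> \<epsilon>"
      proof -
        have "\<delta> \<le> \<epsilon> / (1 + \<alpha>)" using \<delta> \<delta>0(4) by linarith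
        then show ?thesis using \<alpha> by (simp add: \<alpha>_def[symmetric] pos_le_divide_eq)
      qed
      moreover have "f (x, y) = 1" using fone 3 by blast
      moreover have "\<delta> \<le> \<epsilon>" "\<delta> \<le> \<epsilon> * (min 1 (sqrt (b / (2 * a))) / 2)"
        using \<delta> \<delta>0(2,3) unfolding c1_def by linarith+
      ultimately show ?thesis
        using c by (intro core_comparison[OF sol nz l \<delta>1]) auto
    qed
  qed
qed

text \<open>Order of choices: the barrier and \<epsilon> depend only on the dimensions and d, then
  \<tau>0 and \<delta>0 on \<epsilon>, C and the slopes of the model. All are fixed before K and the
  data, which gives the uniformity. The rest is pointwise.\<close>

theorem lemma1p4:
  fixes \<phi> :: "real \<Rightarrow> real" and d C :: real
  assumes "CARD('n::finite) \<ge> 3" and "CARD('m::finite) \<ge> 2" and "CARD('l::finite) \<ge> 1"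
    and "profile CARD('n) CARD('m) \<phi>"
    and "d = 9/5 \<and> (CARD('n), CARD('m)) \<in> {(4, 4), (5, 3)} \<or>
         d = 3 \<and> CARD('n) + CARD('m) \<ge> 9"
    and "C \<ge> 1"
  shows "\<exists>\<tau>0>0. \<exists>\<delta>0>0.
    \<forall>(K :: (real^'l) set) \<tau> \<delta> (h :: real^'l \<Rightarrow> real)
      (u :: (real^'n) \<times> (real^'l) \<Rightarrow> real) (f :: (real^'n) \<times> (real^'l) \<Rightarrow> real).
      closed K \<longrightarrow> 0 < \<tau> \<longrightarrow> \<tau> \<le> \<tau>0 \<longrightarrow> 0 < \<delta> \<longrightarrow> \<delta> \<le> \<delta>0 \<longrightarrow>
      simon_data CARD('m) \<phi> K \<tau> \<delta> C h u f \<longrightarrow>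
      (\<forall>(x :: real^'n) (\<xi> :: real^'m) (y :: real^'l). x \<noteq> 0 \<longrightarrow> \<xi> \<noteq> 0 \<longrightarrow>
        (let g = warped_metric f; div_unit = (\<lambda>F. metric_div g (metric_unit_grad g F) (x, \<xi>, y)) in
          (u (x, y) - norm \<xi> > 0 \<longrightarrow> div_unit (E_fun d u) \<ge> 0) \<and>
          (u (x, y) - norm \<xi> < 0 \<longrightarrow> div_unit (E_fun d u) \<le> 0) \<and>
          (u (x, y) - norm \<xi> = 0 \<longrightarrow>
             div_unit (E_inner d u) \<ge> 0 \<and> div_unit (E_outer d u) \<le> 0)))"
proof -
  define a where "a = real CARD('n) - 1"
  define b where "b = real CARD('m) - 1"
  have ab: "a > 0" "b > 0" using assms(1,2) by (auto simp: a_def b_def)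
  have d: "d > 0" using assms(5) by auto
  obtain c A s where cAs: "c > 0" "A > 0" "A + s > 0" "2 * c \<le> A" "A < c * real CARD('n)"
    and bar: "\<And>P. \<lbrakk>0 \<le> P; P \<le> 1\<rbrakk> \<Longrightarrow> barrier_poly a b c A s P > 0"
    and inn: "\<forall>P q. 0 \<le> P \<longrightarrow> P \<le> 1 \<longrightarrow> 0 \<le> q \<longrightarrow> q \<le> 1 \<longrightarrow> inner_poly a b d c A s P q \<ge> 0"
    and outp: "\<forall>P q. 0 \<le> P \<longrightarrow> P \<le> 1 \<longrightarrow> 0 \<le> q \<longrightarrow> q \<le> 1 \<longrightarrow> outer_poly a b d c A s P q \<ge> 0"
    unfolding a_def b_def using exists_barrier[OF assms(1,2,5)] by blast
  interpret barrier a b c A s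
    by unfold_locales (use ab cAs bar in \<open>auto simp: a_def\<close>)
  define N0 where "N0 = real DIM((real^'n) \<times> (real^'l))"
  have N0: "N0 \<ge> 0" by (simp add: N0_def)
  obtain \<epsilon> where \<epsilon>: "\<epsilon> > 0" and thr: "\<And>\<psi> u k \<psi>1 G f q L S \<psi>2 c0. \<lbrakk>\<psi> > 0; u > 0; f > 0; 0 \<le> k;
      \<psi>1\<^sup>2 * a / b \<le> 1; k \<le> b * g (\<psi>1\<^sup>2 * a / b); 0 \<le> G;
      \<bar>u - \<psi>\<bar> \<le> \<epsilon> * \<psi>; \<bar>G - \<bar>\<psi>1\<bar>\<bar> \<le> \<epsilon>; \<bar>f - 1\<bar> \<le> \<epsilon>;
      \<psi> * \<psi>2 = k * (1 + \<psi>1\<^sup>2); \<psi> * (\<psi>2 + c0) = b + k * \<psi>1\<^sup>2;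
      q \<le> G\<^sup>2 * (\<psi>2 + \<epsilon> / \<psi>); L \<ge> \<psi>2 + c0 - N0 * (\<epsilon> / \<psi>);
      1/2 * (b + 1 + inverse (1 + f * G\<^sup>2)) * S = - f * L + f\<^sup>2 / (1 + f * G\<^sup>2) * q + b / u\<rbrakk> \<Longrightarrow>
      (\<forall>t. 0 < t \<longrightarrow> t \<le> u \<longrightarrow> div_expr (b + 1) u f (G\<^sup>2) q L S t (inner_ratio d (t / u)) (inner_ratio' d (t / u)) \<ge> 0) \<and>
      (\<forall>t. u \<le> t \<longrightarrow> div_expr (b + 1) u f (G\<^sup>2) q L S t (outer_ratio d (t / u)) (outer_ratio' d (t / u)) \<le> 0)"
    by (fact sign_threshold[OF d N0 inn outp])
  obtain \<tau>0 \<delta>0 where \<tau>0: "\<tau>0 > 0" and \<delta>0: "\<delta>0 > 0" and comp: "\<And>K \<tau> \<delta> (h :: real^'l \<Rightarrow> real)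
      (u :: (real^'n) \<times> (real^'l) \<Rightarrow> real) f x y.
    \<lbrakk>\<tau> \<le> \<tau>0; \<delta> \<le> \<delta>0; simon_data CARD('m) \<phi> K \<tau> \<delta> C h u f; x \<noteq> 0\<rbrakk> \<Longrightarrow>
    \<exists>\<psi> \<psi>1 \<psi>2 k. comparison a b g \<epsilon> u (f (x, y)) (x, y) \<psi> \<psi>1 \<psi>2 k"
    by (fact simon_comparison[OF assms(4) a_def b_def assms(6) \<epsilon>])
  show ?thesis
  proof (rule exI[of _ \<tau>0], rule conjI[OF \<tau>0], rule exI[of _ \<delta>0], rule conjI[OF \<delta>0], intro allI impI)
    fix K \<tau> \<delta> and h :: "real^'l \<Rightarrow> real" and u f :: "(real^'n) \<times> (real^'l) \<Rightarrow> real"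
      and x :: "real^'n" and \<xi> :: "real^'m" and y :: "real^'l"
    assume K: "closed K" and \<tau>: "\<tau> \<le> \<tau>0" and \<delta>: "\<delta> \<le> \<delta>0"
      and data: "simon_data CARD('m) \<phi> K \<tau> \<delta> C h u f" and x: "x \<noteq> 0" and \<xi>: "\<xi> \<noteq> 0"
    note dat = data[unfolded simon_data_def Let_def]
    have cont: "continuous_on UNIV u" using dat by (elim conjE)
    have rad: "\<forall>x x' y. norm x = norm x' \<longrightarrow> u (x, y) = u (x', y)" using dat by (elim conjE)
    have us: "smooth_on (- ({0} \<times> K)) u" using dat by (elim conjE)
    have upos: "\<forall>p. p \<notin> {0} \<times> K \<longrightarrow> 0 < u p" using dat by (elim conjE)
    have fs: "smooth_on UNIV f" using dat by (elim conjE)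
    have fpos: "\<forall>p. 0 < f p" using dat by (elim conjE)
    have minimal: "\<forall>p. p \<notin> {0} \<times> K \<longrightarrow>
          1/2 * (real CARD('m) + inverse (1 + f p * (norm (grad u p))\<^sup>2)) * (grad f p \<bullet> grad u p)
          = - f p * laplacian u p
            + (f p)\<^sup>2 / (1 + f p * (norm (grad u p))\<^sup>2) * hess_grad_grad u p
            + (real CARD('m) - 1) / u p" using dat by (elim conjE)
    define S where "S = - ({0::real^'n} \<times> K)"
    have S: "open S" using K unfolding S_def by (intro open_Compl closed_Times) auto
    define z where "z = (x, y)"
    \<comment> \<open>x \<noteq> 0 keeps the point off {0} x K, so u is smooth and positive there
      and the minimality equation holds even when y lies in K.\<close>
    have zS: "z \<in> S" and zK: "z \<notin> {0} \<times> K" using x by (auto simp: S_def z_def)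
    have ud: "\<forall>q\<in>S. u differentiable (at q)"
      using smooth_on_differentiable(1)[OF us] by (simp add: S_def)
    have u2: "\<forall>i\<in>Basis. iter_partial [i] u differentiable (at z)"
      using smooth_on_differentiable(2)[OF us zS[unfolded S_def]] by blast
    have uS: "\<forall>q\<in>S. u q > 0" using upos unfolding S_def by blast
    have fd: "f differentiable (at z)" using smooth_on_differentiable(1)[OF fs] by simp
    obtain \<psi> \<psi>1 \<psi>2 k where cmp: "comparison a b g \<epsilon> u (f z) z \<psi> \<psi>1 \<psi>2 k"
      using comp[OF \<tau> \<delta> data x] unfolding z_def by blast
    define r where "r = norm (fst z)"
    define w where "w = (\<lambda>q. u q - \<psi> (norm (fst q)))"
    note cmp' = cmp[unfolded comparison_def Let_def, folded r_def w_def]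
    have dd: "\<forall>\<rho>>0. (\<psi> has_real_derivative \<psi>1 \<rho>) (at \<rho>) \<and> (\<psi>1 has_real_derivative \<psi>2 \<rho>) (at \<rho>)"
      using cmp' by (elim conjE)
    have \<psi>pos: "\<psi> r > 0" and k0: "0 \<le> k" and P1: "(\<psi>1 r)\<^sup>2 * a / b \<le> 1"
      and kg: "k \<le> b * g ((\<psi>1 r)\<^sup>2 * a / b)" and o1: "\<psi> r * \<psi>2 r = k * (1 + (\<psi>1 r)\<^sup>2)"
      and o2: "\<psi> r * (\<psi>2 r + a * \<psi>1 r / r) = b + k * (\<psi>1 r)\<^sup>2" and w0: "\<bar>u z - \<psi> r\<bar> \<le> \<epsilon> * \<psi> r"
      and w1: "deriv_norm 1 w z \<le> \<epsilon>" and w2: "deriv_norm 2 w z \<le> \<epsilon> / \<psi> r" and f1: "\<bar>f z - 1\<bar> \<le> \<epsilon>"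
      using cmp' by (simp_all only:)
    have \<psi>2: "\<psi>2 r \<ge> 0"
    proof -
      have "\<psi> r * \<psi>2 r \<ge> 0" unfolding o1 using k0 by simp
      then show ?thesis using \<psi>pos by (simp add: zero_le_mult_iff)
    qed
    have fz: "fst z \<noteq> 0" using x by (simp add: z_def)
    obtain B where B: "fst (grad u (x, y)) = B *\<^sub>R x"
      using radial_gradient[OF _ x ud[rule_format, OF zS, unfolded z_def]] rad by blast
    have Bz: "fst (grad u z) = B *\<^sub>R fst z" using B by (simp add: z_def)
    note rc = radial_comparison[OF dd S zS ud u2 Bz fz \<psi>2[unfolded r_def], folded r_def w_def]
    define G where "G = norm (grad u z)"
    have G1: "\<bar>G - \<bar>\<psi>1 r\<bar>\<bar> \<le> \<epsilon>" using rc(1) w1 unfolding G_def by linarith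
    have q: "hess_grad_grad u z \<le> G\<^sup>2 * (\<psi>2 r + \<epsilon> / \<psi> r)"
    proof -
      have "G\<^sup>2 * (\<psi>2 r + deriv_norm 2 w z) \<le> G\<^sup>2 * (\<psi>2 r + \<epsilon> / \<psi> r)"
        using w2 by (intro mult_left_mono) auto
      then show ?thesis using rc(2) unfolding G_def by linarith
    qed
    have L: "laplacian u z \<ge> \<psi>2 r + a * \<psi>1 r / r - N0 * (\<epsilon> / \<psi> r)"
    proof -
      have "N0 * deriv_norm 2 w z \<le> N0 * (\<epsilon> / \<psi> r)" using w2 N0 by (intro mult_left_mono) auto
      moreover have "real DIM(real^'n) - 1 = a" by (simp add: a_def)
      ultimately show ?thesis using rc(3) unfolding N0_def by simp
    qed
    have m: "b + 1 = real CARD('m)" by (simp add: b_def)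
    have mn: "1/2 * (b + 1 + inverse (1 + f z * G\<^sup>2)) * (grad f z \<bullet> grad u z)
          = - f z * laplacian u z + (f z)\<^sup>2 / (1 + f z * G\<^sup>2) * hess_grad_grad u z + b / u z"
      unfolding G_def m unfolding b_def by (rule minimal[rule_format, OF zK])
    have G0: "0 \<le> G" by (simp add: G_def)
    note sg = thr[OF \<psi>pos uS[rule_format, OF zS] fpos[rule_format] k0 P1 kg G0 w0 G1 f1 o1 o2 q L mn, unfolded m G_def]
    define p where "p = (x, \<xi>, y)"
    have bp: "base_pt p = z" and t: "fst (snd p) = \<xi>" by (simp_all add: p_def z_def)
    have tn: "fst (snd p) \<noteq> 0" using \<xi> by (simp add: t)
    have tpos: "norm \<xi> > 0" using \<xi> by simp
    note sgi = sg[THEN conjunct1, rule_format] and sgo = sg[THEN conjunct2, rule_format]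
    note br = branch_div_sign[of S p u f d, unfolded bp t, OF S zS ud uS cont u2 fd fpos \<xi> d]
    show "let g = warped_metric f; div_unit = (\<lambda>F. metric_div g (metric_unit_grad g F) (x, \<xi>, y)) in
          (u (x, y) - norm \<xi> > 0 \<longrightarrow> div_unit (E_fun d u) \<ge> 0) \<and>
          (u (x, y) - norm \<xi> < 0 \<longrightarrow> div_unit (E_fun d u) \<le> 0) \<and>
          (u (x, y) - norm \<xi> = 0 \<longrightarrow> div_unit (E_inner d u) \<ge> 0 \<and> div_unit (E_outer d u) \<le> 0)"
      unfolding Let_def p_def[symmetric] z_def[symmetric]
    proof (intro conjI impI)
      assume h: "u z - norm \<xi> > 0"
      show "metric_div (warped_metric f) (metric_unit_grad (warped_metric f) (E_fun d u)) p \<ge> 0"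
        by (rule br(3)[OF _ sgi[OF tpos]]) (use h in linarith)+
    next
      assume h: "u z - norm \<xi> < 0"
      show "metric_div (warped_metric f) (metric_unit_grad (warped_metric f) (E_fun d u)) p \<le> 0"
        by (rule br(4)[OF _ sgo]) (use h in linarith)+
    next
      assume h: "u z - norm \<xi> = 0"
      show "metric_div (warped_metric f) (metric_unit_grad (warped_metric f) (E_inner d u)) p \<ge> 0"
        by (rule br(1)[OF _ sgi[OF tpos]]) (use h in linarith)+
    next
      assume h: "u z - norm \<xi> = 0"
      show "metric_div (warped_metric f) (metric_unit_grad (warped_metric f) (E_outer d u)) p \<le> 0"
        by (rule br(2)[OF _ sgo]) (use h in linarith)+
    qed
  qed
qed

end
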